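(* Let $n\ge 1$ and let $\lambda^{(1)}/\mu^{(1)},\ldots,\lambda^{(k)}/\mu^{(k)}$ be skew shapes, each of which does not contain a $3\times 2$ block of cells, with $\ell(\lambda^{(i)})\le n$ for all $i$. Then for every $\tau\in\mathcal B_n$, the multi-symmetric function \[\mathrm{Imm}_{\tau}\left(\mathrm{JT}^n_{\lambda^{(1)}/\mu^{(1)}}(\mathbf x^{(1)})*\cdots*\mathrm{JT}^n_{\lambda^{(k)}/\mu^{(k)}}(\mathbf x^{(k)})\right)\] is Schur positive.
   Context: For variables $\mathbf x=(x_1,x_2,\dots)$, $e_d(\mathbf x)$ denotes the elementary symmetric function, with $e_0=1$ and $e_d=0$ for $d<0$. Partitions $\lambda$ have $\lambda_i=0$ for $i>\ell(\lambda)$ ($\ell(\lambda)$ = number of nonzero parts). For partitions $\mu\subseteq\lambda$ (i.e. $\mu_i\le\lambda_i$ for all $i$), the skew shape $\lambda/\mu$ is the set of cells $(i,j)$ with $\mu_i<j\le\lambda_i$ (row $i$, column $j$, rows numbered top to bottom). $\lambda/\mu$ contains a $3\times 2$ block of cells if there are $i,j$ with $(i,j),(i,j+1),(i+1,j),(i+1,j+1),(i+2,j),(i+2,j+1)$ all in $\lambda/\mu$; equivalently $\lambda_{i+2}\ge\mu_i+2$ for some $i$. For $n\ge\ell(\lambda)$, $\mathrm{JT}^n_{\lambda/\mu}(\mathbf x)=(e_{\lambda_i-\mu_j-i+j}(\mathbf x))_{i,j=1}^n$ (so $\det\mathrm{JT}^n_{\lambda/\mu}(\mathbf x)=s_{\lambda'/\mu'}(\mathbf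 x)$). For $n\times n$ matrices $A^{(p)}$ with entries in $\Lambda(\mathbf x^{(p)})$ (symmetric functions in the variable set $\mathbf x^{(p)}$, the variable sets being distinct), the Hadamard product $A^{(1)}*\cdots*A^{(k)}$ is the entrywise product, with entries in $\Lambda(\mathbf x^{(1)})\otimes\cdots\otimes\Lambda(\mathbf x^{(k)})$. Such a multi-symmetric function is Schur positive if its expansion in the basis $s_{\nu_1}(\mathbf x^{(1)})\cdots s_{\nu_k}(\mathbf x^{(k)})$ has nonnegative coefficients (monomial positive: same with monomial symmetric functions $m_\nu$). Immanants: for $f:\mathfrak S_n\to\mathbb C$, extended linearly to $\mathbb C[\mathfrak S_n]$, $\mathrm{Imm}_f(M)=\sum_{w\in\mathfrak S_n}f(w)M_{1,w(1)}\cdots M_{n,w(n)}$. $\mathrm{TL}_n(2)$ is the associative $\mathbb C$-algebra generated by $t_1,\dots,t_{n-1}$ with relations $t_i^2=2t_i$, $t_it_jt_i=t_i$ if $|i-j|=1$, $t_it_j=t_jt_i$ if $|i-j|\ge 2$. It has the standard basis $\mathcal B_n$ of Kauffman diagrams (noncrossing perfect matchings on $2n$ points arranged in two columns of $n$; multiplication is concatenation, each closed loop removed giving a factor $2$; $t_i$ is the diagram joining the $i$th and $(i+1)$st points on each side, all other points joined horizontally; $1$ is the all-horizontal diagram). Let $s_i=(i,i+1)\in\mathfrak S_n$ (permutations composed left to right) and let $\theta:\mathbb C[\mathfrak S_n]\to\mathrm{TL}_n(2)$ be the algebra homomorphism with $\theta(s_i)=t_i-1$. For $\tau\in\mathcal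 B_n$, $f_\tau(w)$ is the coefficient of $\tau$ in $\theta(w)$ in the basis $\mathcal B_n$, and $\mathrm{Imm}_\tau:=\mathrm{Imm}_{f_\tau}$ (the Temperley–Lieb immanant). For $\tau=1$, $\mathrm{Imm}_\tau=\det$. *)

theory Defs
  imports Complex_Main "HOL-Combinatorics.Permutations"
begin

section \<open>Formal power series in several sets of countably many variables\<close>

text \<open>A monomial is m :: nat => nat => nat, where m p i is the exponent of the
  variable x_i of the p-th variable set (variable sets indexed 0,1,...;
  variables within a set indexed 0,1,...). A series is its coefficient function.\<close>

type_synonym mono = "nat \<Rightarrow> nat \<Rightarrow> nat"
type_synonym ser = "mono \<Rightarrow> int"

definition finsupp :: "mono \<Rightarrow> bool" where
  "finsupp m \<longleftrightarrow> finite {(p, i). m p i \<noteq> 0}"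

definition fmul :: "ser \<Rightarrow> ser \<Rightarrow> ser" where
  "fmul f g = (\<lambda>m. \<Sum>a \<in> {a. \<forall>p i. a p i \<le> m p i}. f a * g (\<lambda>p i. m p i - a p i))"

definition fone :: ser where
  "fone = (\<lambda>m. if m = (\<lambda>p i. 0) then 1 else 0)"

definition fprodl :: "ser list \<Rightarrow> ser" where
  "fprodl xs = foldr fmul xs fone"

text \<open>Elementary symmetric function e_d in the p-th variable set (0 for d < 0).\<close>
definition e_ser :: "nat \<Rightarrow> int \<Rightarrow> ser" where
  "e_ser p d = (\<lambda>m. if (\<forall>q i. q \<noteq> p \<longrightarrow> m q i = 0) \<and> (\<forall>i. m p i \<le> 1)
       \<and> finite {i. m p i = 1} \<and> int (card {i. m p i = 1}) = d then 1 else 0)"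

section \<open>Partitions, Schur functions, Schur positivity\<close>

definition is_part :: "nat list \<Rightarrow> bool" where
  "is_part \<nu> \<longleftrightarrow> sorted (rev \<nu>) \<and> 0 \<notin> set \<nu>"

text \<open>i-th part (1-indexed), 0 beyond the length.\<close>
definition part :: "nat list \<Rightarrow> nat \<Rightarrow> nat" where
  "part \<nu> i = (if 1 \<le> i \<and> i \<le> length \<nu> then \<nu> ! (i - 1) else 0)"

definition cells :: "nat list \<Rightarrow> (nat \<times> nat) set" where
  "cells \<nu> = {(r, c). 1 \<le> r \<and> r \<le> length \<nu> \<and> 1 \<le> c \<and> c \<le> part \<nu> r}"

definition ssyt :: "nat list \<Rightarrow> (nat \<times> nat \<Rightarrow> nat) \<Rightarrow> bool" where
  "ssyt \<nu> T \<longleftrightarrow> (\<forall>x. x \<notin> cells \<nu> \<longrightarrow> T x = 0)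
     \<and> (\<forall>r c. (r, c) \<in> cells \<nu> \<and> (r, c + 1) \<in> cells \<nu> \<longrightarrow> T (r, c) \<le> T (r, c + 1))
     \<and> (\<forall>r c. (r, c) \<in> cells \<nu> \<and> (r + 1, c) \<in> cells \<nu> \<longrightarrow> T (r, c) < T (r + 1, c))"

text \<open>Schur function s_nu in the p-th variable set: coefficient of x^alpha is the
  number of SSYT of shape nu with content alpha.\<close>
definition schur_ser :: "nat \<Rightarrow> nat list \<Rightarrow> ser" where
  "schur_ser p \<nu> = (\<lambda>m. if (\<forall>q i. q \<noteq> p \<longrightarrow> m q i = 0)
      then int (card {T. ssyt \<nu> T \<and> (\<forall>i. card {x \<in> cells \<nu>. T x = i} = m p i)})
      else 0)"

definition deg :: "nat \<Rightarrow> mono \<Rightarrow> nat" where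
  "deg p m = (\<Sum>i \<in> {i. m p i \<noteq> 0}. m p i)"

text \<open>F (in variable sets 0..k-1) is Schur positive: F = sum over tuples of partitions
  nu of c_nu s_nu1(x^(0)) ... s_nuk(x^(k-1)) with c_nu >= 0 (coefficientwise; only
  tuples of the matching degrees contribute to a given monomial).\<close>
definition schur_positive :: "nat \<Rightarrow> ser \<Rightarrow> bool" where
  "schur_positive k F \<longleftrightarrow> (\<exists>c :: nat list list \<Rightarrow> real. (\<forall>\<nu>. c \<nu> \<ge> 0) \<and>
     (\<forall>m. finsupp m \<longrightarrow> real_of_int (F m) =
        (\<Sum>\<nu> \<in> {\<nu>. length \<nu> = k \<and> (\<forall>p<k. is_part (\<nu> ! p) \<and> sum_list (\<nu> ! p) = deg p m)}.
           c \<nu> * real_of_int (fprodl (map (\<lambda>p. schur_ser p (\<nu> ! p)) [0..<k]) m))))"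

section \<open>Temperley-Lieb algebra TL_n(2) via Kauffman diagrams\<close>

text \<open>Points: (False, i) = i-th point of the left column, (True, i) = i-th point of
  the right column, rows 1..n top to bottom. A diagram is a perfect matching given as
  a symmetric relation. Noncrossing w.r.t. the cyclic order around the rectangle.\<close>

type_synonym pt = "bool \<times> nat"
type_synonym diag = "(pt \<times> pt) set"

definition pts :: "nat \<Rightarrow> pt set" where
  "pts n = (UNIV :: bool set) \<times> {1..n}"

definition cpos :: "nat \<Rightarrow> pt \<Rightarrow> nat" where
  "cpos n x = (if fst x then 2 * n + 1 - snd x else snd x)"

definition is_diagram :: "nat \<Rightarrow> diag \<Rightarrow> bool" where
  "is_diagram n D \<longleftrightarrow> D \<subseteq> pts n \<times> pts n \<and> sym D \<and> (\<forall>x. (x, x) \<notin> D)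
     \<and> (\<forall>x \<in> pts n. \<exists>!y. (x, y) \<in> D)
     \<and> (\<forall>a b c d. (a, b) \<in> D \<and> (c, d) \<in> D \<longrightarrow>
          \<not> (cpos n a < cpos n c \<and> cpos n c < cpos n b \<and> cpos n b < cpos n d))"

definition Bn :: "nat \<Rightarrow> diag set" where
  "Bn n = {D. is_diagram n D}"

text \<open>Concatenation D1 D2: right column of D1 glued to left column of D2.
  Vertices (column, row), columns 0,1,2.\<close>
definition cedges :: "diag \<Rightarrow> diag \<Rightarrow> ((nat \<times> nat) \<times> (nat \<times> nat)) set" where
  "cedges D1 D2 =
     {((if fst x then 1 else 0, snd x), (if fst y then 1 else 0, snd y)) | x y. (x, y) \<in> D1}
   \<union> {((if fst x then 2 else 1, snd x), (if fst y then 2 else 1, snd y)) | x y. (x, y) \<in> D2}"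

definition outv :: "pt \<Rightarrow> nat \<times> nat" where
  "outv x = (if fst x then 2 else 0, snd x)"

definition dcomp :: "nat \<Rightarrow> diag \<Rightarrow> diag \<Rightarrow> diag" where
  "dcomp n D1 D2 = {(x, y). x \<in> pts n \<and> y \<in> pts n \<and> x \<noteq> y
      \<and> (outv x, outv y) \<in> (cedges D1 D2)\<^sup>*}"

text \<open>Number of closed loops: connected components consisting of middle vertices only.\<close>
definition nloops :: "nat \<Rightarrow> diag \<Rightarrow> diag \<Rightarrow> nat" where
  "nloops n D1 D2 = card ((\<lambda>v. (cedges D1 D2)\<^sup>* `` {v}) `
      {v. \<exists>i \<in> {1..n}. v = (1, i) \<and> (\<forall>x \<in> pts n. (v, outv x) \<notin> (cedges D1 D2)\<^sup>*)})"

text \<open>Elements of TL_n(2): coefficient functions on the basis Bn n.\<close>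
type_synonym tl = "diag \<Rightarrow> int"

definition tl_mul :: "nat \<Rightarrow> tl \<Rightarrow> tl \<Rightarrow> tl" where
  "tl_mul n a b = (\<lambda>\<tau>. \<Sum>\<sigma>1 \<in> Bn n. \<Sum>\<sigma>2 \<in> Bn n.
      a \<sigma>1 * b \<sigma>2 * (if dcomp n \<sigma>1 \<sigma>2 = \<tau> then 2 ^ nloops n \<sigma>1 \<sigma>2 else 0))"

definition iddiag :: "nat \<Rightarrow> diag" where
  "iddiag n = {((s, j), (\<not> s, j)) | s j. j \<in> {1..n}}"

definition tdiag :: "nat \<Rightarrow> nat \<Rightarrow> diag" where
  "tdiag n i = {((s, i), (s, i + 1)) | s. True} \<union> {((s, i + 1), (s, i)) | s. True}
     \<union> {((s, j), (\<not> s, j)) | s j. j \<in> {1..n} \<and> j \<noteq> i \<and> j \<noteq> i + 1}"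

definition tl_one :: "nat \<Rightarrow> tl" where
  "tl_one n = (\<lambda>D. if D = iddiag n then 1 else 0)"

text \<open>theta(s_i) = t_i - 1\<close>
definition tl_gen :: "nat \<Rightarrow> nat \<Rightarrow> tl" where
  "tl_gen n i = (\<lambda>D. (if D = tdiag n i then 1 else 0) - (if D = iddiag n then 1 else 0))"

fun tl_word :: "nat \<Rightarrow> nat list \<Rightarrow> tl" where
  "tl_word n [] = tl_one n"
| "tl_word n (i # is) = tl_mul n (tl_gen n i) (tl_word n is)"

definition swp :: "nat \<Rightarrow> nat \<Rightarrow> nat" where
  "swp i x = (if x = i then i + 1 else if x = i + 1 then i else x)"

text \<open>Product s_{i1} s_{i2} ... s_{ir}, composed left to right (s_{i1} applied first).\<close>
fun perm_of_word :: "nat list \<Rightarrow> nat \<Rightarrow> nat" where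
  "perm_of_word [] = id"
| "perm_of_word (i # is) = perm_of_word is \<circ> swp i"

text \<open>theta(w) computed from any word for w (well defined since theta is a homomorphism).\<close>
definition theta :: "nat \<Rightarrow> (nat \<Rightarrow> nat) \<Rightarrow> tl" where
  "theta n w = tl_word n (SOME ws. set ws \<subseteq> {1..<n} \<and> perm_of_word ws = w)"

text \<open>Temperley-Lieb immanant of an n x n matrix of series (rows/cols 1..n).\<close>
definition imm_tl :: "nat \<Rightarrow> diag \<Rightarrow> (nat \<Rightarrow> nat \<Rightarrow> ser) \<Rightarrow> ser" where
  "imm_tl n \<tau> M = (\<lambda>m. \<Sum>w \<in> {w. w permutes {1..n}}.
      theta n w \<tau> * fprodl (map (\<lambda>i. M i (w i)) [1..<n + 1]) m)"

section \<open>Hadamard product of Jacobi-Trudi matrices\<close>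

text \<open>shapes ! p = (lambda, mu) is the skew shape in the p-th variable set.\<close>
definition hjt :: "(nat list \<times> nat list) list \<Rightarrow> nat \<Rightarrow> nat \<Rightarrow> ser" where
  "hjt shapes i j = fprodl (map (\<lambda>p. e_ser p
      (int (part (fst (shapes ! p)) i) - int (part (snd (shapes ! p)) j) - int i + int j))
      [0..<length shapes])"

definition no_3x2_block :: "nat list \<Rightarrow> nat list \<Rightarrow> bool" where
  "no_3x2_block la mu \<longleftrightarrow> \<not> (\<exists>i j. {(i, j), (i, j + 1), (i + 1, j), (i + 1, j + 1),
      (i + 2, j), (i + 2, j + 1)} \<subseteq> {(r, c). 1 \<le> r \<and> part mu r < c \<and> c \<le> part la r})"

end

theory Submission
  imports Defs "HOL-Library.FuncSet"
begin

text \<open>Without a 3x2 block the matrices are upper Hessenberg: \<open>\<lambda>\<^sub>i - \<mu>\<^sub>j - i + j < 0\<close> for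
  \<open>i \<ge> j + 2\<close>. Hence only the permutations \<open>w\<^sub>S\<close> (\<open>S \<subseteq> {1..<n}\<close>), the increasing products of
  the \<open>s\<^sub>i\<close> with \<open>i \<in> S\<close>, contribute, and
  \<open>\<theta>(w\<^sub>S) = \<Sum>\<^sub>T\<^sub>\<subseteq>\<^sub>S (-1)\<^bsup>|S - T|\<^esup> t\<^sub>T\<close> where the products \<open>t\<^sub>T\<close> have nonnegative coefficients.

  For one skew shape, the monomials of the term of \<open>w\<^sub>S\<close> are tuples of columns, read as lattice paths.
  Swapping tails at first meetings, one \<open>i \<in> S\<close> after the other, turns them into tuples of columns of
  the skew shape in which the neighbours \<open>i, i + 1\<close> meet for every \<open>i \<in> S\<close>. By inclusion-exclusion
  the immanant is a nonnegative combination, over families \<open>U\<close> of subsets of \<open>{1..<n}\<close>, of products over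
  the shapes \<open>p\<close> of the generating functions of the column tuples whose set of meeting neighbours is
  exactly \<open>U\<^sub>p\<close>. Whether neighbours meet is preserved by Bender-Knuth reflections, so Stembridge's
  cancellation argument for the Littlewood-Richardson rule shows that each of these generating functions
  is Schur positive.

  That \<open>\<theta>\<close> does not depend on the chosen word is seen in a faithful representation: a diagram is
  evaluated at a two-colouring of its points by testing whether the ends of every arc get different colours.
  Faithfulness is a triangularity argument: among the noncrossing diagrams compatible with the colouring of
  openers of \<open>D\<close>, the diagram \<open>D\<close> has the smallest total arc length.\<close>

section \<open>Noncrossing diagrams and a faithful evaluation\<close>

text \<open>Path j of a shape runs from b_j = mu_j - j to a_j = lambda_j - j, and the block
  condition enters only as a_(i+2) < b_i. It acts twice. It makes all entries below the subdiagonal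
  vanish, and it keeps path i + 2 below every height that path i can have, so that a tail swap of
  paths i and i + 1 does not disturb the meetings still demanded further right.

  Why the signs disappear: fix one tuple of columns for each shape. After the tail swaps the term of
  w_S counts this family iff S lies in all its meeting sets, hence in their intersection I. Summing
  the coefficients of theta(w_S) over the subsets S of I is a Moebius inversion that leaves the
  coefficient of tau in the single product t_I, which is nonnegative. The weight of a family thus
  depends on its exact meeting sets alone. This is why the tuples are sorted by exact meeting sets
  and why the reflections have to preserve them, which dictates the way they freeze certain
  neighbouring columns.

  On the algebra side, theta(w) acts on evaluations at colourings, up to signs, by permuting the
  colours of the left points, so that a word matters only through its permutation.\<close>

lemma finite_pts: "finite (pts n)"
  by (simp add: pts_def)

lemma finite_Bn: "finite (Bn n)"
proof -
  have "Bn n \<subseteq> Pow (pts n \<times> pts n)"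
    by (auto simp: Bn_def is_diagram_def)
  then show ?thesis
    by (rule finite_subset) (simp add: finite_pts)
qed

lemma cpos_inj: "inj_on (cpos n) (pts n)"
  by (auto simp: inj_on_def cpos_def pts_def split: if_splits)

lemma cpos_eq_iff: "x \<in> pts n \<Longrightarrow> y \<in> pts n \<Longrightarrow> cpos n x = cpos n y \<longleftrightarrow> x = y"
  using cpos_inj by (auto dest: inj_onD)

definition partner :: "diag \<Rightarrow> pt \<Rightarrow> pt" where
  "partner D x = (THE y. (x, y) \<in> D)"

context
  fixes n :: nat and D :: diag
  assumes D: "D \<in> Bn n"
begin

lemma diag_pts: "(x, y) \<in> D \<Longrightarrow> x \<in> pts n \<and> y \<in> pts n"
  using D by (auto simp: Bn_def is_diagram_def)

lemma diag_neq: "(x, y) \<in> D \<Longrightarrow> x \<noteq> y"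
proof -
  have "\<forall>x. (x, x) \<notin> D"
    using D unfolding Bn_def is_diagram_def by simp
  then show "(x, y) \<in> D \<Longrightarrow> x \<noteq> y"
    by blast
qed

lemma diag_sym: "(x, y) \<in> D \<Longrightarrow> (y, x) \<in> D"
proof -
  have "sym D"
    using D unfolding Bn_def is_diagram_def by simp
  then show "(x, y) \<in> D \<Longrightarrow> (y, x) \<in> D"
    by (rule symD)
qed

lemma diag_unique: "(x, y) \<in> D \<Longrightarrow> (x, z) \<in> D \<Longrightarrow> y = z"
  using D diag_pts unfolding Bn_def is_diagram_def by blast

lemma diag_noncrossing:
  "(a, b) \<in> D \<Longrightarrow> (c, d) \<in> D \<Longrightarrow> cpos n a < cpos n c \<Longrightarrow> cpos n c < cpos n b
    \<Longrightarrow> cpos n b < cpos n d \<Longrightarrow> False"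
  using D unfolding Bn_def is_diagram_def by blast

lemma partner_iff: "x \<in> pts n \<Longrightarrow> (x, y) \<in> D \<longleftrightarrow> partner D x = y"
proof -
  assume "x \<in> pts n"
  then have "\<exists>!y. (x, y) \<in> D"
    using D unfolding Bn_def is_diagram_def by blast
  then show ?thesis
    unfolding partner_def by (metis theI')
qed

lemma partner_in: "x \<in> pts n \<Longrightarrow> (x, partner D x) \<in> D"
  using partner_iff by blast

lemma partner_pts: "x \<in> pts n \<Longrightarrow> partner D x \<in> pts n"
  using partner_in diag_pts by blast

lemma partner_partner: "x \<in> pts n \<Longrightarrow> partner D (partner D x) = x"
  using partner_in diag_sym partner_iff partner_pts by metis

lemma partner_bij: "bij_betw (partner D) (pts n) (pts n)"
  by (rule bij_betw_byWitness[where f' = "partner D"])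
    (auto simp: partner_partner partner_pts)

end

definition opener :: "nat \<Rightarrow> diag \<Rightarrow> pt \<Rightarrow> bool" where
  "opener n D x \<longleftrightarrow> (\<exists>y. (x, y) \<in> D \<and> cpos n x < cpos n y)"

lemma opener_partner:
  assumes "D \<in> Bn n" "x \<in> pts n"
  shows "opener n D x \<longleftrightarrow> cpos n x < cpos n (partner D x)"
  using partner_iff[OF assms] by (auto simp: opener_def)

text \<open>As for balanced brackets, the openers determine a noncrossing matching. Induction on the
  length of an arc of \<open>D\<close>: the points under it are matched among themselves by shorter
  arcs, which \<open>D'\<close> shares, so in \<open>D'\<close> neither end has its partner
  underneath. If \<open>D'\<close> did not join the two ends, their arcs would leave on opposite
  sides and cross.\<close>

lemma diag_subset_if_openers_eq:
  assumes D: "D \<in> Bn n" and D': "D' \<in> Bn n"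
    and op: "\<And>x. x \<in> pts n \<Longrightarrow> opener n D x = opener n D' x"
  shows "D \<subseteq> D'"
proof -
  have key: "(x, y) \<in> D \<Longrightarrow> cpos n x < cpos n y \<Longrightarrow> (x, y) \<in> D'" for x y
  proof (induction "cpos n y - cpos n x" arbitrary: x y rule: less_induct)
    case less
    note xy = less.prems
    have xp: "x \<in> pts n" and yp: "y \<in> pts n"
      using diag_pts[OF D xy(1)] by auto
    define y' where "y' = partner D' x"
    define x' where "x' = partner D' y"
    have xy': "(x, y') \<in> D'" and yx': "(y, x') \<in> D'"
      using partner_in[OF D'] xp yp by (auto simp: y'_def x'_def)
    have pp: "y' \<in> pts n" "x' \<in> pts n"
      using diag_pts[OF D' xy'] diag_pts[OF D' yx'] by auto
    have "opener n D x"
      using xy unfolding opener_def by blast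
    then have "opener n D' x"
      using op xp by blast
    then have lt1: "cpos n x < cpos n y'"
      using opener_partner[OF D' xp] by (simp add: y'_def)
    have "\<not> opener n D y"
      using partner_iff[OF D yp, of x] diag_sym[OF D xy(1)] xy(2) opener_partner[OF D yp] by simp
    then have "\<not> opener n D' y"
      using op yp by blast
    then have lt2: "cpos n x' < cpos n y"
      using opener_partner[OF D' yp] diag_neq[OF D' yx'] cpos_eq_iff[OF yp pp(2)]
      by (auto simp: x'_def)
    have inner: "partner D' z = partner D z \<and> cpos n x < cpos n (partner D z) \<and> cpos n (partner D z) < cpos n y"
      if z: "z \<in> pts n" "cpos n x < cpos n z" "cpos n z < cpos n y" for z
    proof -
      define u where "u = partner D z"
      have zu: "(z, u) \<in> D" and up: "u \<in> pts n"
        using partner_in[OF D z(1)] partner_pts[OF D z(1)] by (auto simp: u_def)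
      have "u \<noteq> x" "u \<noteq> y"
        using diag_unique[OF D xy(1), of z] diag_unique[OF D diag_sym[OF D xy(1)], of z]
          diag_sym[OF D zu] z by blast+
      then have "cpos n u \<noteq> cpos n x" "cpos n u \<noteq> cpos n y"
        using cpos_eq_iff up xp yp by blast+
      moreover have "\<not> cpos n u < cpos n x"
        using diag_noncrossing[OF D diag_sym[OF D zu] xy(1)] z by blast
      moreover have "\<not> cpos n y < cpos n u"
        using diag_noncrossing[OF D xy(1) zu] z by blast
      ultimately have u: "cpos n x < cpos n u" "cpos n u < cpos n y"
        by linarith+
      have "cpos n z \<noteq> cpos n u"
        using diag_neq[OF D zu] cpos_eq_iff z(1) up by blast
      then consider "cpos n z < cpos n u" | "cpos n u < cpos n z"
        by linarith
      then have "(z, u) \<in> D'"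
      proof cases
        case 1
        show ?thesis
          by (rule less.hyps) (use zu 1 z u in auto)
      next
        case 2
        have "(u, z) \<in> D'"
          by (rule less.hyps) (use diag_sym[OF D zu] 2 z u in auto)
        then show ?thesis
          by (rule diag_sym[OF D'])
      qed
      then show ?thesis
        using partner_iff[OF D' z(1)] u by (auto simp: u_def)
    qed
    show ?case
    proof (rule ccontr)
      assume "(x, y) \<notin> D'"
      then have ne: "y' \<noteq> y" "x' \<noteq> x"
        using xy' diag_sym[OF D' yx'] by auto
      then have ne': "cpos n y' \<noteq> cpos n y" "cpos n x' \<noteq> cpos n x"
        using cpos_eq_iff pp xp yp by blast+
      have "\<not> cpos n y' < cpos n y"
      proof
        assume "cpos n y' < cpos n y"
        from inner[OF pp(1) lt1 this]
        show False
          using partner_partner[OF D' xp] by (auto simp: y'_def[symmetric])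
      qed
      moreover have "\<not> cpos n x < cpos n x'"
      proof
        assume "cpos n x < cpos n x'"
        from inner[OF pp(2) this lt2]
        show False
          using partner_partner[OF D' yp] by (auto simp: x'_def[symmetric])
      qed
      ultimately show False
        using diag_noncrossing[OF D' diag_sym[OF D' yx'] xy'] ne' xy(2) by linarith
    qed
  qed
  show ?thesis
  proof (clarify)
    fix a b c d assume h: "((a, b), (c, d)) \<in> D"
    have "cpos n (a, b) \<noteq> cpos n (c, d)"
      using diag_neq[OF D h] diag_pts[OF D h] cpos_eq_iff by blast
    then consider "cpos n (a, b) < cpos n (c, d)" | "cpos n (c, d) < cpos n (a, b)"
      by linarith
    then show "((a, b), (c, d)) \<in> D'"
      by cases (use key h diag_sym[OF D] diag_sym[OF D'] in blast)+
  qed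
qed

section \<open>Two-colourings and total arc length\<close>

definition compat :: "diag \<Rightarrow> (pt \<Rightarrow> bool) \<Rightarrow> bool" where
  "compat D c \<longleftrightarrow> (\<forall>x y. (x, y) \<in> D \<longrightarrow> c x \<noteq> c y)"

text \<open>The signs let an arc with differently coloured ends contribute plus or minus its length
  to \<open>col_weight\<close>, with plus exactly when its earlier end has colour
  \<open>True\<close>. At \<open>opener n D\<close> the weight is therefore the total arc length of
  \<open>D\<close>.\<close>

definition signed_pos :: "nat \<Rightarrow> (pt \<Rightarrow> bool) \<Rightarrow> pt \<Rightarrow> int" where
  "signed_pos n c x = (if c x then - int (cpos n x) else int (cpos n x))"

definition col_weight :: "nat \<Rightarrow> (pt \<Rightarrow> bool) \<Rightarrow> int" where
  "col_weight n c = (\<Sum>x\<in>pts n. signed_pos n c x)"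

lemma col_weight_partner:
  assumes D: "D \<in> Bn n"
  shows "2 * col_weight n c = (\<Sum>x\<in>pts n. signed_pos n c x + signed_pos n c (partner D x))"
  using sum.reindex_bij_betw[OF partner_bij[OF D], of "signed_pos n c"]
  by (simp add: sum.distrib col_weight_def)

lemma opener_compat:
  assumes D: "D \<in> Bn n"
  shows "compat D (opener n D)"
  unfolding compat_def
proof (intro allI impI)
  fix x y assume h: "(x, y) \<in> D"
  have "cpos n x \<noteq> cpos n y"
    using diag_neq[OF D h] diag_pts[OF D h] cpos_eq_iff by blast
  moreover have "partner D x = y" "partner D y = x"
    using partner_iff[OF D] diag_pts[OF D h] h diag_sym[OF D h] by blast+
  ultimately show "opener n D x \<noteq> opener n D y"
    using opener_partner[OF D] diag_pts[OF D h] by auto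
qed

lemma col_weight_compat:
  assumes D: "D \<in> Bn n" and c: "compat D c"
  shows "col_weight n c \<le> col_weight n (opener n D)"
    and "col_weight n c = col_weight n (opener n D) \<Longrightarrow> x \<in> pts n \<Longrightarrow> c x = opener n D x"
proof -
  let ?f = "\<lambda>c x. signed_pos n c x + signed_pos n c (partner D x)"
  have le: "?f c x \<le> ?f (opener n D) x" and eq: "?f c x = ?f (opener n D) x \<Longrightarrow> c x = opener n D x"
    if x: "x \<in> pts n" for x
  proof -
    have h: "(x, partner D x) \<in> D"
      by (rule partner_in[OF D x])
    have ne: "c x \<noteq> c (partner D x)" "opener n D x \<noteq> opener n D (partner D x)"
      using c opener_compat[OF D] h unfolding compat_def by blast+
    have "cpos n x \<noteq> cpos n (partner D x)"
      using diag_neq[OF D h] diag_pts[OF D h] cpos_eq_iff by blast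
    then show "?f c x \<le> ?f (opener n D) x" "?f c x = ?f (opener n D) x \<Longrightarrow> c x = opener n D x"
      using ne opener_partner[OF D x] by (auto simp: signed_pos_def split: if_splits)
  qed
  have "2 * col_weight n c \<le> 2 * col_weight n (opener n D)"
    unfolding col_weight_partner[OF D] by (intro sum_mono le)
  then show "col_weight n c \<le> col_weight n (opener n D)"
    by simp
  assume "col_weight n c = col_weight n (opener n D)" and x: "x \<in> pts n"
  then have s: "(\<Sum>x\<in>pts n. ?f c x) = (\<Sum>x\<in>pts n. ?f (opener n D) x)"
    using col_weight_partner[OF D] by metis
  have "?f c x = ?f (opener n D) x"
  proof (rule ccontr)
    assume "?f c x \<noteq> ?f (opener n D) x"
    then have "(\<Sum>x\<in>pts n. ?f c x) < (\<Sum>x\<in>pts n. ?f (opener n D) x)"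
      using le x by (intro sum_strict_mono_ex1) (auto simp: finite_pts order.strict_iff_order)
    then show False
      using s by simp
  qed
  then show "c x = opener n D x"
    by (rule eq[OF x])
qed

text \<open>A closed loop has two proper colourings, and this is how the evaluation fits the loop
  value 2 of the algebra.\<close>

definition tl_eval :: "nat \<Rightarrow> tl \<Rightarrow> (pt \<Rightarrow> bool) \<Rightarrow> int" where
  "tl_eval n a c = (\<Sum>D\<in>Bn n. a D * of_bool (compat D c))"

lemma tl_eval_faithful:
  assumes z: "\<And>c. tl_eval n a c = 0" and D: "D \<in> Bn n"
  shows "a D = 0"
proof (rule ccontr)
  assume "a D \<noteq> 0"
  define S where "S = {D \<in> Bn n. a D \<noteq> 0}"
  have "finite S" "S \<noteq> {}"
    using D \<open>a D \<noteq> 0\<close> finite_Bn by (auto simp: S_def)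
  \<comment> \<open>A longest diagram of the support. Any diagram of the support that is compatible
    with its openers is at least as long, hence equally long, hence has the same openers and equals
    \<open>E\<close>.\<close>
  then obtain E where E: "E \<in> S" and mx: "\<And>D. D \<in> S \<Longrightarrow> col_weight n (opener n D) \<le> col_weight n (opener n E)"
    using obtains_MAX[of S "\<lambda>D. col_weight n (opener n D)"] by (metis Max_ge finite_imageI imageI)
  have EB: "E \<in> Bn n" "a E \<noteq> 0"
    using E by (auto simp: S_def)
  have other: "a D' * of_bool (compat D' (opener n E)) = 0" if D': "D' \<in> Bn n - {E}" for D'
  proof (rule ccontr)
    assume "\<not> ?thesis"
    then have D'S: "D' \<in> S" and cp: "compat D' (opener n E)"
      using D' by (auto simp: S_def)
    have DB: "D' \<in> Bn n" using D' by auto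
    have "col_weight n (opener n E) = col_weight n (opener n D')"
      using col_weight_compat(1)[OF DB cp] mx[OF D'S] by simp
    then have "opener n E x = opener n D' x" if "x \<in> pts n" for x
      using col_weight_compat(2)[OF DB cp] that by blast
    then have "E = D'"
      using diag_subset_if_openers_eq[OF EB(1) DB] diag_subset_if_openers_eq[OF DB EB(1)] by blast
    then show False
      using D' by blast
  qed
  have "tl_eval n a (opener n E) = a E * of_bool (compat E (opener n E))"
    unfolding tl_eval_def
    by (subst sum.remove[OF finite_Bn EB(1)]) (simp only: sum.neutral[OF ballI[OF other]] add_0_right)
  then show False
    using z EB opener_compat by auto
qed

section \<open>Concatenation with a cup diagram\<close>

definition btw :: "nat \<Rightarrow> nat \<Rightarrow> nat \<Rightarrow> bool" where
  "btw a b c \<longleftrightarrow> a < c \<and> c < b \<or> b < c \<and> c < a"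

definition outside :: "nat \<Rightarrow> nat \<Rightarrow> nat \<Rightarrow> bool" where
  "outside a b c \<longleftrightarrow> c < a \<and> c < b \<or> a < c \<and> b < c"

definition cross :: "nat \<Rightarrow> nat \<Rightarrow> nat \<Rightarrow> nat \<Rightarrow> bool" where
  "cross a b c d \<longleftrightarrow> btw a b c \<and> outside a b d \<or> outside a b c \<and> btw a b d"

lemma btw_iff: "a \<noteq> c \<Longrightarrow> b \<noteq> c \<Longrightarrow> btw a b c \<longleftrightarrow> (a < c) \<noteq> (b < c)"
  unfolding btw_def by auto

lemma outside_iff: "a \<noteq> c \<Longrightarrow> b \<noteq> c \<Longrightarrow> outside a b c \<longleftrightarrow> (a < c) = (b < c)"
  unfolding outside_def by auto

text \<open>For chords without common ends, crossing is a sum modulo 2 of order tests. In this form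
  chords can be added, which \<open>not_cross_reconnect\<close> exploits.\<close>

lemma cross_iff_xor:
  assumes "a \<noteq> c" "b \<noteq> c" "a \<noteq> d" "b \<noteq> d"
  shows "cross a b c d \<longleftrightarrow> ((a < c) \<noteq> (b < c)) \<noteq> ((a < d) \<noteq> (b < d))"
  unfolding cross_def by (simp add: assms btw_iff outside_iff) blast

lemma cross_commute: "cross a b c d = cross b a c d"
  by (auto simp: cross_def btw_def outside_def)

lemma cross_swap_pairs_imp: "cross a b c d \<Longrightarrow> cross c d a b"
  unfolding cross_def btw_def outside_def by linarith

lemma cross_swap_pairs: "cross a b c d = cross c d a b"
  using cross_swap_pairs_imp by blast

text \<open>The neighbours \<open>i\<close> and \<open>Suc i\<close> lie on the same side of
  \<open>c\<close> and on the same side of \<open>d\<close>. Modulo 2 the tests of the chords p-i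
  and q-(i + 1) therefore add up to the test of p-q, because the terms of \<open>i\<close> and
  \<open>Suc i\<close> cancel.\<close>

lemma not_cross_reconnect:
  assumes "\<not> cross p i c d" "\<not> cross q (Suc i) c d"
    "p \<noteq> i" "p \<noteq> Suc i" "q \<noteq> i" "q \<noteq> Suc i" "c \<noteq> i" "c \<noteq> Suc i" "d \<noteq> i" "d \<noteq> Suc i"
    "c \<noteq> p" "c \<noteq> q" "d \<noteq> p" "d \<noteq> q"
  shows "\<not> cross p q c d"
proof -
  have "(i < c) = (Suc i < c)" "(i < d) = (Suc i < d)"
    using assms(7-10) by auto
  then show ?thesis
    using assms cross_iff_xor[of p c i d] cross_iff_xor[of q c "Suc i" d] cross_iff_xor[of p c q d]
    by metis
qed

lemma diag_not_cross:
  assumes D: "D \<in> Bn n" and h: "(a, b) \<in> D" "(c, d) \<in> D"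
  shows "\<not> cross (cpos n a) (cpos n b) (cpos n c) (cpos n d)"
proof
  assume "cross (cpos n a) (cpos n b) (cpos n c) (cpos n d)"
  then show False
    using diag_noncrossing[OF D h] diag_noncrossing[OF D h(2,1)]
      diag_noncrossing[OF D diag_sym[OF D h(1)] h(2)] diag_noncrossing[OF D h(2) diag_sym[OF D h(1)]]
      diag_noncrossing[OF D h(1) diag_sym[OF D h(2)]] diag_noncrossing[OF D diag_sym[OF D h(2)] h(1)]
      diag_noncrossing[OF D diag_sym[OF D h(1)] diag_sym[OF D h(2)]]
      diag_noncrossing[OF D diag_sym[OF D h(2)] diag_sym[OF D h(1)]]
    unfolding cross_def btw_def outside_def by (elim disjE conjE; blast)
qed

definition diag_of :: "nat \<Rightarrow> (pt \<Rightarrow> pt) \<Rightarrow> diag" where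
  "diag_of n f = {(x, f x) | x. x \<in> pts n}"

lemma diag_of_iff: "(x, y) \<in> diag_of n f \<longleftrightarrow> x \<in> pts n \<and> y = f x"
  unfolding diag_of_def by blast

lemma diag_of_in_Bn:
  assumes f: "\<And>x. x \<in> pts n \<Longrightarrow> f x \<in> pts n \<and> f x \<noteq> x \<and> f (f x) = x"
    and nc: "\<And>a c. a \<in> pts n \<Longrightarrow> c \<in> pts n \<Longrightarrow> \<not> cross (cpos n a) (cpos n (f a)) (cpos n c) (cpos n (f c))"
  shows "diag_of n f \<in> Bn n"
proof -
  note iff = diag_of_iff
  have "diag_of n f \<subseteq> pts n \<times> pts n"
    using f unfolding diag_of_def by blast
  moreover have "sym (diag_of n f)"
    unfolding sym_def iff using f by metis
  moreover have "\<forall>x. (x, x) \<notin> diag_of n f"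
    unfolding iff using f by metis
  moreover have "\<forall>x\<in>pts n. \<exists>!y. (x, y) \<in> diag_of n f"
    unfolding iff by blast
  moreover have "\<forall>a b c d. (a, b) \<in> diag_of n f \<and> (c, d) \<in> diag_of n f \<longrightarrow>
          \<not> (cpos n a < cpos n c \<and> cpos n c < cpos n b \<and> cpos n b < cpos n d)"
  proof (intro allI impI notI, elim conjE)
    fix a b c d
    assume h: "(a, b) \<in> diag_of n f" "(c, d) \<in> diag_of n f"
      and lt: "cpos n a < cpos n c" "cpos n c < cpos n b" "cpos n b < cpos n d"
    then have "cross (cpos n a) (cpos n b) (cpos n c) (cpos n d)"
      by (simp add: cross_def btw_def outside_def)
    then show False
      using nc h unfolding iff by blast
  qed
  ultimately show ?thesis
    unfolding Bn_def is_diagram_def by (intro CollectI conjI)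
qed

lemma diag_of_partner: "D \<in> Bn n \<Longrightarrow> diag_of n (partner D) = D"
  by (intro set_eqI) (metis diag_of_iff diag_pts partner_iff prod.exhaust)

lemma compat_iff: "D \<in> Bn n \<Longrightarrow> compat D c \<longleftrightarrow> (\<forall>x\<in>pts n. c x \<noteq> c (partner D x))"
  unfolding compat_def using partner_iff diag_pts by metis

lemma compat_diag_of: "compat (diag_of n f) c \<longleftrightarrow> (\<forall>x\<in>pts n. c x \<noteq> c (f x))"
  unfolding compat_def diag_of_iff by blast

definition flip :: "pt \<Rightarrow> pt" where
  "flip x = (\<not> fst x, snd x)"

lemma iddiag_eq: "iddiag n = diag_of n flip"
  by (auto simp: iddiag_def diag_of_def flip_def pts_def)

lemma iddiag_in_Bn: "iddiag n \<in> Bn n"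
  unfolding iddiag_eq
proof (rule diag_of_in_Bn)
  have c: "cpos n (flip x) + cpos n x = 2 * n + 1" if "x \<in> pts n" for x
    using that by (cases x) (auto simp: flip_def cpos_def pts_def)
  fix x y assume "x \<in> pts n" "y \<in> pts n"
  then show "\<not> cross (cpos n x) (cpos n (flip x)) (cpos n y) (cpos n (flip y))"
    using c[of x] c[of y] unfolding cross_def btw_def outside_def by linarith
qed (auto simp: flip_def pts_def)

lemma partner_diag_of:
  assumes "diag_of n f \<in> Bn n" "x \<in> pts n"
  shows "partner (diag_of n f) x = f x"
  using partner_iff[OF assms, of "f x"] assms(2) diag_of_iff by blast

section \<open>Gluing two diagrams\<close>

lemma rtrancl_invariant:
  assumes "(u, v) \<in> E\<^sup>*" and "\<And>u v. (u, v) \<in> E \<Longrightarrow> g u = g v"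
  shows "g u = g v"
  using assms(1) by induction (auto simp: assms(2))

lemma sym_cedges:
  assumes "sym D1" "sym D2"
  shows "sym (cedges D1 D2)"
  using assms unfolding sym_def cedges_def by blast

definition leftv :: "pt \<Rightarrow> nat \<times> nat" where
  "leftv x = (if fst x then 1 else 0, snd x)"

definition rightv :: "pt \<Rightarrow> nat \<times> nat" where
  "rightv x = (if fst x then 2 else 1, snd x)"

lemma cedges_alt: "cedges D1 D2 = {(leftv x, leftv y) | x y. (x, y) \<in> D1}
   \<union> {(rightv x, rightv y) | x y. (x, y) \<in> D2}"
  by (simp add: cedges_def leftv_def rightv_def)

text \<open>Components of the glued graph are never computed: a path shows that \<open>x\<close> and
  \<open>f x\<close> are connected, and a function \<open>g\<close> that is constant along edges
  shows that no other boundary point belongs to them.\<close>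

lemma dcomp_eqI:
  assumes f: "\<And>x. x \<in> pts n \<Longrightarrow> f x \<in> pts n \<and> f x \<noteq> x"
    and path: "\<And>x. x \<in> pts n \<Longrightarrow> (outv x, outv (f x)) \<in> (cedges D1 D2)\<^sup>*"
    and inv: "\<And>u v. (u, v) \<in> cedges D1 D2 \<Longrightarrow> g u = g v"
    and g: "\<And>x. x \<in> pts n \<Longrightarrow> g (outv x) = {x, f x}"
  shows "dcomp n D1 D2 = diag_of n f"
proof -
  have *: "y = f x" if "x \<in> pts n" "y \<in> pts n" "x \<noteq> y" "(outv x, outv y) \<in> (cedges D1 D2)\<^sup>*" for x y
  proof -
    have "g (outv x) = g (outv y)"
      using that(4) inv by (rule rtrancl_invariant)
    then have "{x, f x} = {y, f y}"
      by (simp only: g[OF that(1)] g[OF that(2)])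
    then show ?thesis
      using that(3) unfolding doubleton_eq_iff by argo
  qed
  show ?thesis
  proof (intro set_eqI)
    fix z :: "pt \<times> pt"
    obtain x y where z: "z = (x, y)" by (cases z)
    have "z \<in> dcomp n D1 D2 \<longleftrightarrow>
        x \<in> pts n \<and> y \<in> pts n \<and> x \<noteq> y \<and> (outv x, outv y) \<in> (cedges D1 D2)\<^sup>*"
      unfolding z dcomp_def by blast
    also have "\<dots> \<longleftrightarrow> x \<in> pts n \<and> y = f x"
      using * f path by metis
    finally show "z \<in> dcomp n D1 D2 \<longleftrightarrow> z \<in> diag_of n f"
      by (simp add: z diag_of_iff)
  qed
qed

lemma dcomp_id:
  assumes D: "D \<in> Bn n"
  shows "dcomp n (iddiag n) D = D" "nloops n (iddiag n) D = 0"
proof -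
  let ?E = "cedges (iddiag n) D"
  have up: "(outv x, rightv x) \<in> ?E\<^sup>*" "(rightv x, outv x) \<in> ?E\<^sup>*" if x: "x \<in> pts n" for x
  proof -
    obtain s j where xs: "x = (s, j)" by force
    have "(outv x, rightv x) \<in> ?E\<^sup>* \<and> (rightv x, outv x) \<in> ?E\<^sup>*"
    proof (cases s)
      case True
      then show ?thesis
        by (simp add: outv_def rightv_def xs)
    next
      case False
      have "((False, j), (True, j)) \<in> iddiag n" "((True, j), (False, j)) \<in> iddiag n"
        using x xs by (auto simp: iddiag_def pts_def)
      then have "(leftv (False, j), leftv (True, j)) \<in> ?E" "(leftv (True, j), leftv (False, j)) \<in> ?E"
        unfolding cedges_alt by blast+
      then show ?thesis
        using False by (auto simp: outv_def rightv_def xs leftv_def)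
    qed
    then show "(outv x, rightv x) \<in> ?E\<^sup>*" "(rightv x, outv x) \<in> ?E\<^sup>*"
      by blast+
  qed
  define cl where "cl = (\<lambda>x. {x, partner D x})"
  \<comment> \<open>The identity diagram joins columns 0 and 1 row by row, so both are read as the
    left side of \<open>D\<close>.\<close>
  define g where "g = (\<lambda>v :: nat \<times> nat. cl (fst v = 2, snd v))"
  have cl_p: "cl x = cl y" if "(x, y) \<in> D" for x y
  proof -
    have "partner D x = y" "partner D y = x"
      using that partner_iff[OF D] diag_pts[OF D that] diag_sym[OF D that] by auto
    then show ?thesis by (auto simp: cl_def)
  qed
  have "dcomp n (iddiag n) D = diag_of n (partner D)"
  proof (rule dcomp_eqI[where g = g])
    fix x assume x: "x \<in> pts n"
    show "partner D x \<in> pts n \<and> partner D x \<noteq> x"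
      using partner_pts[OF D x] diag_neq[OF D partner_in[OF D x]] by auto
    have "(rightv x, rightv (partner D x)) \<in> ?E"
      unfolding cedges_alt using partner_in[OF D x] by blast
    then show "(outv x, outv (partner D x)) \<in> ?E\<^sup>*"
      using up(1)[OF x] up(2)[OF partner_pts[OF D x]] by (meson rtrancl.rtrancl_into_rtrancl rtrancl_trans)
    show "g (outv x) = {x, partner D x}"
      by (cases x) (auto simp: g_def outv_def cl_def)
  next
    fix u v assume "(u, v) \<in> ?E"
    then consider x y where "(x, y) \<in> iddiag n" "u = leftv x" "v = leftv y"
      | x y where "(x, y) \<in> D" "u = rightv x" "v = rightv y"
      unfolding cedges_alt by blast
    then show "g u = g v"
    proof cases
      case 1
      then show ?thesis
        by (auto simp: g_def leftv_def iddiag_def)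
    next
      case 2
      have "g (rightv z) = cl z" for z
        by (cases z) (simp add: g_def rightv_def)
      then show ?thesis
        using cl_p 2 by simp
    qed
  qed
  then show "dcomp n (iddiag n) D = D"
    by (simp add: diag_of_partner[OF D])
  have "\<exists>x\<in>pts n. ((1, j), outv x) \<in> ?E\<^sup>*" if "j \<in> {1..n}" for j
    using up(2)[of "(False, j)"] that by (intro bexI[of _ "(False, j)"]) (auto simp: rightv_def pts_def)
  then have "{v. \<exists>i\<in>{1..n}. v = (1, i) \<and> (\<forall>x\<in>pts n. (v, outv x) \<notin> ?E\<^sup>*)} = {}"
    by blast
  then show "nloops n (iddiag n) D = 0"
    by (simp add: nloops_def)
qed

text \<open>The matching underlying t_i D. The cup is tested first; if \<open>D\<close> itself joins
  the two points, the later clauses for their partners never fire, and the closed loop simply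
  disappears.\<close>

definition capped :: "nat \<Rightarrow> diag \<Rightarrow> pt \<Rightarrow> pt" where
  "capped i D x =
     (if x = (False, i) then (False, Suc i) else if x = (False, Suc i) then (False, i)
      else if x = partner D (False, i) then partner D (False, Suc i)
      else if x = partner D (False, Suc i) then partner D (False, i)
      else partner D x)"

context
  fixes n i :: nat and D :: diag
  assumes D: "D \<in> Bn n" and i: "1 \<le> i" "i < n"
begin

private abbreviation (input) "L \<equiv> (False, i)"
private abbreviation (input) "L' \<equiv> (False, Suc i)"

lemma L_pts: "L \<in> pts n" "L' \<in> pts n"
  using i by (auto simp: pts_def)

text \<open>Three kinds of arc: the new cup, the arc joining the two former partners, and the
  untouched arcs. The first two are given as unordered pairs, so that later proofs treat both
  orientations at once.\<close>

lemma capped_cases: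
  assumes x: "x \<in> pts n"
  obtains (cap) "x \<in> {L, L'}" "{x, capped i D x} = {L, L'}"
  | (joined) "partner D L \<noteq> L'" "x \<notin> {L, L'}" "x \<in> {partner D L, partner D L'}"
      "{x, capped i D x} = {partner D L, partner D L'}" "capped i D x \<notin> {L, L'}"
  | (same) "x \<notin> {L, L', partner D L, partner D L'}" "capped i D x = partner D x"
      "partner D x \<notin> {L, L', partner D L, partner D L'}"
proof -
  define p where "p = partner D L"
  define q where "q = partner D L'"
  have pq: "partner D p = L" "partner D q = L'" "p \<noteq> L" "q \<noteq> L'"
    using partner_partner[OF D L_pts(1)] partner_partner[OF D L_pts(2)]
      diag_neq[OF D partner_in[OF D L_pts(1)]] diag_neq[OF D partner_in[OF D L_pts(2)]]
    unfolding p_def q_def by metis+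
  have LL: "L \<noteq> L'" by simp
  note c = capped_def[of i D x, folded p_def q_def]
  consider "x \<in> {L, L'}" | "x \<notin> {L, L'}" "x = p" | "x \<notin> {L, L'}" "x = q" "x \<noteq> p" | "x \<notin> {L, L', p, q}"
    by blast
  then show ?thesis
  proof cases
    case 1
    show ?thesis
      by (rule cap) (use 1 LL c in auto)
  next
    case 2
    show ?thesis
      by (rule joined) (use 2 c pq in \<open>auto simp: p_def[symmetric] q_def[symmetric]\<close>)
  next
    case 3
    show ?thesis
      by (rule joined) (use 3 c pq in \<open>auto simp: p_def[symmetric] q_def[symmetric]\<close>)
  next
    case 4
    have "partner D (partner D x) = x"
      by (rule partner_partner[OF D x])
    then have "partner D x \<notin> {L, L', p, q}"
      using 4 pq p_def q_def by force
    then show ?thesis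
      using same 4 c by (auto simp: p_def[symmetric] q_def[symmetric])
  qed
qed

lemma capped_involution:
  assumes x: "x \<in> pts n"
  shows "capped i D x \<in> pts n" "capped i D x \<noteq> x" "capped i D (capped i D x) = x"
proof -
  have "capped i D x \<in> pts n \<and> capped i D x \<noteq> x \<and> capped i D (capped i D x) = x"
    using x
  proof (cases rule: capped_cases)
    case cap
    then have "x = L \<and> capped i D x = L' \<or> x = L' \<and> capped i D x = L"
      by (auto simp: doubleton_eq_iff)
    then show ?thesis
      using L_pts by (auto simp: capped_def)
  next
    case joined
    have pp: "partner D L \<in> pts n" "partner D L' \<in> pts n"
      using L_pts partner_pts[OF D] by auto
    have "partner D L \<noteq> partner D L'"
      using partner_partner[OF D L_pts(1)] partner_partner[OF D L_pts(2)] by force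
    moreover have h: "x = partner D L \<and> capped i D x = partner D L' \<or> x = partner D L' \<and> capped i D x = partner D L"
      using joined(4) by (auto simp: doubleton_eq_iff)
    moreover have "capped i D (capped i D x) = x"
      using h joined(2,5) unfolding capped_def[of i D "capped i D x"] by auto
    ultimately show ?thesis
      using pp by metis
  next
    case same
    have "capped i D (capped i D x) = partner D (partner D x)"
      unfolding same(2) capped_def[of i D "partner D x"] using same(3) by simp
    then show ?thesis
      using same(2) partner_partner[OF D x] partner_pts[OF D x] diag_neq[OF D partner_in[OF D x]] by simp
  qed
  then show "capped i D x \<in> pts n" "capped i D x \<noteq> x" "capped i D (capped i D x) = x"
    by blast+
qed

lemma capped_not_cross:
  assumes "a \<in> pts n" "c \<in> pts n"
  shows "\<not> cross (cpos n a) (cpos n (capped i D a)) (cpos n c) (cpos n (capped i D c))"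
proof -
  have cL: "cpos n L = i" "cpos n L' = Suc i"
    by (simp_all add: cpos_def)
  have cross_swap: "cross u v w z = cross v u w z" "cross u v w z = cross w z u v" for u v w z
    by (rule cross_commute, rule cross_swap_pairs)
  define p where "p = partner D L"
  define q where "q = partner D L'"
  have pq: "(p, L) \<in> D" "(q, L') \<in> D" "p \<in> pts n" "q \<in> pts n"
    using partner_in[OF D] L_pts diag_sym[OF D] partner_pts[OF D] by (auto simp: p_def q_def)
  have adj: "\<not> cross i (Suc i) u v" for u v
    by (auto simp: cross_def btw_def outside_def)
  have pos: "cpos n z \<noteq> i" "cpos n z \<noteq> Suc i" if "z \<in> pts n" "z \<noteq> L" "z \<noteq> L'" for z
    using cpos_eq_iff[OF that(1) L_pts(1)] cpos_eq_iff[OF that(1) L_pts(2)] that cL by auto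
  \<comment> \<open>The only case with content is the reconnected arc against an untouched one: the
    cup spans no point, and two untouched arcs already occur in \<open>D\<close>.\<close>
  have main: "\<not> cross (cpos n p) (cpos n q) (cpos n c) (cpos n (partner D c))"
    if c: "c \<in> pts n" "c \<noteq> L" "c \<noteq> L'" "c \<noteq> p" "c \<noteq> q" and loop: "p \<noteq> L'" for c
  proof -
    have cd: "(c, partner D c) \<in> D" "partner D c \<in> pts n"
      using partner_in[OF D c(1)] partner_pts[OF D c(1)] by auto
    have inj: "partner D c \<noteq> partner D z" if "z \<in> pts n" "c \<noteq> z" for z
      using that partner_partner[OF D] c(1) by metis
    have ne: "partner D c \<noteq> p" "partner D c \<noteq> q" "partner D c \<noteq> L" "partner D c \<noteq> L'"
      using inj[OF L_pts(1)] inj[OF L_pts(2)] inj[OF pq(3)] inj[OF pq(4)] c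
        partner_partner[OF D L_pts(1)] partner_partner[OF D L_pts(2)]
      by (auto simp: p_def[symmetric] q_def[symmetric])
    have ne2: "p \<noteq> L" "q \<noteq> L'" "q \<noteq> L"
      using diag_neq[OF D pq(1)] diag_neq[OF D pq(2)] loop
        partner_partner[OF D L_pts(2)] by (auto simp: p_def q_def)
    show ?thesis
      by (rule not_cross_reconnect[where i = i])
        (use diag_not_cross[OF D pq(1) cd(1)] diag_not_cross[OF D pq(2) cd(1)]
          cL pos[OF pq(3)] pos[OF pq(4)] pos[OF c(1)]
          pos[OF cd(2)] ne ne2 loop c cpos_eq_iff[OF c(1) pq(3)] cpos_eq_iff[OF c(1) pq(4)]
          cpos_eq_iff[OF cd(2) pq(3)] cpos_eq_iff[OF cd(2) pq(4)] in simp_all)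
  qed
  have self: "\<not> cross u v u v" "\<not> cross u v v u" for u v
    by (auto simp: cross_def btw_def outside_def)
  have case1: "\<not> cross (cpos n z) (cpos n z') u v" if "{z, z'} = {L, L'}" for z z' u v
    using that adj cL cross_swap(1) by (auto simp: doubleton_eq_iff)
  have case2: "\<not> cross (cpos n z) (cpos n (capped i D z)) (cpos n w) (cpos n (capped i D w))"
    if z: "p \<noteq> L'" "{z, capped i D z} = {p, q}" and w: "w \<in> pts n" for z w
    using w
  proof (cases rule: capped_cases)
    case cap
    show ?thesis
      by (subst cross_swap(2)) (rule case1[OF cap(2)])
  next
    case joined
    then have "{w, capped i D w} = {p, q}"
      by (simp add: p_def q_def)
    with z(2) show ?thesis
      unfolding doubleton_eq_iff by (elim disjE conjE) (simp_all add: self)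
  next
    case same
    then have "\<not> cross (cpos n p) (cpos n q) (cpos n w) (cpos n (capped i D w))"
      using main[OF w] z(1) by (simp add: p_def q_def)
    with z(2) show ?thesis
      unfolding doubleton_eq_iff by (elim disjE conjE) (simp_all add: cross_swap(1)[of "cpos n q"])
  qed
  show ?thesis
    using assms(1)
  proof (cases rule: capped_cases)
    case cap
    show ?thesis
      by (rule case1[OF cap(2)])
  next
    case joined
    show ?thesis
      by (rule case2) (use joined assms(2) in \<open>simp_all add: p_def q_def\<close>)
  next
    case a: same
    show ?thesis
      using assms(2)
    proof (cases rule: capped_cases)
      case cap
      show ?thesis
        by (subst cross_swap(2)) (rule case1[OF cap(2)])
    next
      case joined
      show ?thesis
        by (subst cross_swap(2), rule case2) (use joined assms(1) in \<open>simp_all add: p_def q_def\<close>)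
    next
      case same
      then show ?thesis
        using a diag_not_cross[OF D partner_in[OF D assms(1)] partner_in[OF D assms(2)]] by simp
    qed
  qed
qed

lemma capped_in_Bn: "diag_of n (capped i D) \<in> Bn n"
  using capped_involution capped_not_cross by (intro diag_of_in_Bn) auto

end

text \<open>With t_i written as the identity diagram with a cup put on its left, that it is
  noncrossing becomes an instance of \<open>capped_in_Bn\<close>.\<close>

lemma tdiag_eq:
  assumes "1 \<le> i" "i < n"
  shows "tdiag n i = diag_of n (capped i (iddiag n))"
proof -
  have p: "partner (iddiag n) x = flip x" if "x \<in> pts n" for x
    using that iddiag_in_Bn partner_diag_of unfolding iddiag_eq by blast
  have "(x, y) \<in> tdiag n i \<longleftrightarrow> (x, y) \<in> diag_of n (capped i (iddiag n))" for x y
  proof -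
    have "(False, i) \<in> pts n" "(False, Suc i) \<in> pts n"
      using assms by (auto simp: pts_def)
    then show ?thesis
      using assms p[of x]
      by (cases x; cases y) (auto simp: tdiag_def diag_of_def capped_def p pts_def flip_def split: if_splits)
  qed
  then show ?thesis by (intro set_eqI) (metis prod.exhaust)
qed

lemma tdiag_in_Bn: "1 \<le> i \<Longrightarrow> i < n \<Longrightarrow> tdiag n i \<in> Bn n"
  using tdiag_eq capped_in_Bn[OF iddiag_in_Bn] by simp

section \<open>Left multiplication by a generator\<close>

definition swap_left :: "nat \<Rightarrow> pt \<Rightarrow> pt" where
  "swap_left i x = (if fst x then x else (False, swp i (snd x)))"

context
  fixes n i :: nat and D :: diag
  assumes D: "D \<in> Bn n" and i: "1 \<le> i" "i < n"
begin

private abbreviation (input) "P \<equiv> (False, i)"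
private abbreviation (input) "P' \<equiv> (False, Suc i)"
private abbreviation (input) "E \<equiv> cedges (tdiag n i) D"

lemma sym_cedges_tdiag: "sym (cedges (tdiag n i) D)"
proof (rule sym_cedges)
  show "sym (tdiag n i)"
    using diag_sym[OF tdiag_in_Bn[OF i]] by (auto intro: symI)
  show "sym D"
    using diag_sym[OF D] by (auto intro: symI)
qed

lemma cedges_tdiag_sym: "(u, v) \<in> E\<^sup>* \<Longrightarrow> (v, u) \<in> E\<^sup>*"
  using sym_rtrancl[OF sym_cedges_tdiag] by (rule symD)

lemma cedges_tdiag_up: 
  assumes x: "x \<in> pts n" "x \<notin> {P, P'}"
  shows "(outv x, rightv x) \<in> E\<^sup>*"
proof (cases "fst x")
  case True
  then show ?thesis
    by (simp add: outv_def rightv_def)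
next
  case False
  then have "((False, snd x), (True, snd x)) \<in> tdiag n i"
    using x by (cases x) (auto simp: tdiag_def pts_def)
  then have "(leftv (False, snd x), leftv (True, snd x)) \<in> E"
    unfolding cedges_alt by blast
  then show ?thesis
    using False by (auto simp: outv_def rightv_def leftv_def)
qed

lemma cedges_tdiag_D: "(x, y) \<in> D \<Longrightarrow> (rightv x, rightv y) \<in> E\<^sup>*"
  unfolding cedges_alt by blast

lemma cedges_tdiag_cap:
  "(outv P, outv P') \<in> E\<^sup>*" "(rightv P, rightv P') \<in> E\<^sup>*"
proof -
  have "((s, i), (s, Suc i)) \<in> tdiag n i" for s
    by (auto simp: tdiag_def)
  then have "(leftv (s, i), leftv (s, Suc i)) \<in> E" for s
    unfolding cedges_alt by blast
  from this[of False] this[of True] show "(outv P, outv P') \<in> E\<^sup>*" "(rightv P, rightv P') \<in> E\<^sup>*"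
    by (auto simp: outv_def rightv_def leftv_def)
qed

text \<open>The invariant for \<open>dcomp_eqI\<close>: \<open>cl\<close> sends a vertex to the
  boundary arc of its component. The middle vertices in rows i and i + 1 lie on the arc joining the
  former partners or, if the two points are partners in \<open>D\<close>, on a closed loop; the
  empty value then certifies that they reach no boundary point.\<close>

private definition "mid = (if partner D P = P' then {} else {partner D P, partner D P'})"
private definition "cl v = (if v = (1, i) \<or> v = (1, Suc i) then mid
    else let x = (fst v = (2::nat), snd v) in {x, capped i D x})"

lemma cl_outv: "cl (outv x) = {x, capped i D x}"
  by (cases x) (auto simp: cl_def outv_def Let_def)

lemma cl_rightv:
  assumes "x \<notin> {P, P'}"
  shows "cl (rightv x) = {x, capped i D x}"
  using assms by (cases x) (auto simp: cl_def rightv_def Let_def)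

lemma cl_leftv:
  assumes "x \<notin> {(True, i), (True, Suc i)}"
  shows "cl (leftv x) = {(False, snd x), capped i D (False, snd x)}"
  using assms by (cases x) (auto simp: cl_def leftv_def Let_def)

lemma cl_invariant:
  assumes "(u, v) \<in> E"
  shows "cl u = cl v"
proof -
  from assms consider x y where "(x, y) \<in> tdiag n i" "u = leftv x" "v = leftv y"
    | x y where "(x, y) \<in> D" "u = rightv x" "v = rightv y"
    unfolding cedges_alt by blast
  then show ?thesis
  proof cases
    case 1
    from 1(1) consider s where "x = (s, i)" "y = (s, Suc i)" | s where "x = (s, Suc i)" "y = (s, i)"
      | s j where "x = (s, j)" "y = (\<not> s, j)" "j \<noteq> i" "j \<noteq> Suc i"
      unfolding tdiag_def by auto
    then show ?thesis
    proof cases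
      case c: 1
      have "cl (leftv (False, i)) = cl (leftv (False, Suc i))"
        by (subst (1 2) cl_leftv) (auto simp: capped_def)
      moreover have "cl (leftv (True, i)) = cl (leftv (True, Suc i))"
        by (simp add: cl_def leftv_def)
      ultimately show ?thesis
        using c 1 by (cases s) simp_all
    next
      case c: 2
      have "cl (leftv (False, i)) = cl (leftv (False, Suc i))"
        by (subst (1 2) cl_leftv) (auto simp: capped_def)
      moreover have "cl (leftv (True, i)) = cl (leftv (True, Suc i))"
        by (simp add: cl_def leftv_def)
      ultimately show ?thesis
        using c 1 by (cases s) simp_all
    next
      case c: 3
      then show ?thesis
        using 1 by (simp add: cl_leftv)
    qed
  next
    case 2
    have xp: "x \<in> pts n" "y \<in> pts n"
      using diag_pts[OF D 2(1)] by auto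
    have pxy: "partner D x = y" "partner D y = x"
      using partner_iff[OF D] xp 2(1) diag_sym[OF D 2(1)] by auto
    have LL: "partner D P' = P" if "partner D P = P'"
      using partner_partner[OF D L_pts(1)[OF D i]] that by simp
    have LL': "partner D P = P'" if "partner D P' = P"
      using partner_partner[OF D L_pts(2)[OF D i]] that by simp
    have cLL: "cl (rightv P) = mid" "cl (rightv P') = mid"
      by (simp_all add: cl_def rightv_def)
    have gen: "cl (rightv z) = {z, capped i D z}" if "z \<notin> {P, P'}" for z
      by (rule cl_rightv[OF that])
    have half: "cl (rightv P) = cl (rightv (partner D P))" "cl (rightv P') = cl (rightv (partner D P'))"
    proof -
      have ne: "partner D P \<noteq> P" "partner D P' \<noteq> P'"
        using diag_neq[OF D partner_in[OF D L_pts(1)[OF D i]]] 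
          diag_neq[OF D partner_in[OF D L_pts(2)[OF D i]]] by simp_all
      show "cl (rightv P) = cl (rightv (partner D P))"
      proof (cases "partner D P = P'")
        case False
        then have "capped i D (partner D P) = partner D P'"
          using ne by (simp add: capped_def)
        then show ?thesis
          using False ne gen[of "partner D P"] cLL by (simp add: mid_def)
      qed (simp add: cLL)
      show "cl (rightv P') = cl (rightv (partner D P'))"
      proof (cases "partner D P' = P")
        case False
        then have "partner D P \<noteq> P'" using LL by blast
        moreover have "partner D P' \<noteq> partner D P"
          using partner_partner[OF D L_pts(1)[OF D i]] partner_partner[OF D L_pts(2)[OF D i]]
          by force
        ultimately have "capped i D (partner D P') = partner D P"
          using False ne by (simp add: capped_def)
        then show ?thesis
          using False ne gen[of "partner D P'"] cLL \<open>partner D P \<noteq> P'\<close>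
          by (simp add: mid_def insert_commute)
      qed (simp add: cLL)
    qed
    consider "x = P" | "x = P'" | "y = P" | "y = P'" | "x \<notin> {P, P'}" "y \<notin> {P, P'}"
      by blast
    then have "cl (rightv x) = cl (rightv y)"
    proof cases
      case 5
      then have "partner D P \<noteq> x" "partner D P' \<noteq> x" "partner D P \<noteq> y" "partner D P' \<noteq> y"
        using partner_partner[OF D L_pts(1)[OF D i]] partner_partner[OF D L_pts(2)[OF D i]] pxy
        by auto
      then have "capped i D x = y" "capped i D y = x"
        using 5 pxy by (auto simp: capped_def)
      then show ?thesis
        using gen 5 by (simp add: insert_commute)
    qed (use half pxy in auto)
    then show ?thesis
      using 2 by simp
  qed
qed

lemma dcomp_tdiag: "dcomp n (tdiag n i) D = diag_of n (capped i D)"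
proof (rule dcomp_eqI[where g = cl])
  fix x assume x: "x \<in> pts n"
  show "capped i D x \<in> pts n \<and> capped i D x \<noteq> x"
    using capped_involution[OF D i x] by simp
  show "cl (outv x) = {x, capped i D x}"
    by (rule cl_outv)
  have tr: "(a, b) \<in> E\<^sup>* \<Longrightarrow> (b, c) \<in> E\<^sup>* \<Longrightarrow> (a, c) \<in> E\<^sup>*" for a b c
    by (rule rtrancl_trans)
  show "(outv x, outv (capped i D x)) \<in> E\<^sup>*"
    using D i x
  proof (cases rule: capped_cases)
    case cap
    then show ?thesis
      using cedges_tdiag_cap(1) cedges_tdiag_sym unfolding doubleton_eq_iff by fastforce
  next
    case joined
    have pL: "partner D P \<in> pts n" "partner D P' \<in> pts n" "partner D P' \<noteq> P"
      using partner_pts[OF D] L_pts[OF D i] partner_partner[OF D L_pts(2)[OF D i]] joined(1) by auto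
    have ne: "partner D P \<notin> {P, P'}" "partner D P' \<notin> {P, P'}"
      using diag_neq[OF D partner_in[OF D L_pts(1)[OF D i]]] joined(1) pL(3)
        diag_neq[OF D partner_in[OF D L_pts(2)[OF D i]]] by simp_all
    have "(outv (partner D P), rightv P) \<in> E\<^sup>*"
      by (rule tr[OF cedges_tdiag_up[OF pL(1) ne(1)]
        cedges_tdiag_D[OF diag_sym[OF D partner_in[OF D L_pts(1)[OF D i]]]]])
    moreover have "(rightv P', outv (partner D P')) \<in> E\<^sup>*"
      by (rule tr[OF cedges_tdiag_D[OF partner_in[OF D L_pts(2)[OF D i]]]
        cedges_tdiag_sym[OF cedges_tdiag_up[OF pL(2) ne(2)]]])
    ultimately have "(outv (partner D P), outv (partner D P')) \<in> E\<^sup>*"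
      using cedges_tdiag_cap(2) tr by blast
    then show ?thesis
      using joined(4) cedges_tdiag_sym unfolding doubleton_eq_iff by fastforce
  next
    case same
    have "(outv x, rightv x) \<in> E\<^sup>*"
      by (rule cedges_tdiag_up[OF x]) (use same in auto)
    moreover have "(rightv (partner D x), outv (partner D x)) \<in> E\<^sup>*"
      by (rule cedges_tdiag_sym[OF cedges_tdiag_up[OF partner_pts[OF D x]]]) (use same in auto)
    ultimately show ?thesis
      unfolding same(2) using cedges_tdiag_D[OF partner_in[OF D x]] tr by blast
  qed
qed (rule cl_invariant)

text \<open>Every other middle vertex is joined by \<open>tdiag n i\<close> to the left boundary, so
  a loop can only pass through rows i and i + 1, and these two vertices lie in one
  component.\<close>

lemma nloops_tdiag: "nloops n (tdiag n i) D = (if partner D P = P' then 1 else 0)"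
proof -
  define S where "S = {v. \<exists>i\<in>{1..n}. v = (1, i) \<and> (\<forall>x\<in>pts n. (v, outv x) \<notin> E\<^sup>*)}"
  have out: "(1, j) \<notin> S" if "j \<noteq> i" "j \<noteq> Suc i" for j
  proof
    assume h: "(1, j) \<in> S"
    then have "(False, j) \<in> pts n" by (auto simp: S_def pts_def)
    then have "((1, j), outv (False, j)) \<in> E\<^sup>*"
      using cedges_tdiag_sym[OF cedges_tdiag_up[of "(False, j)"]] that by (simp add: rightv_def)
    then show False
      using h \<open>(False, j) \<in> pts n\<close> unfolding S_def by blast
  qed
  have S_sub: "S \<subseteq> {(1, i), (1, Suc i)}"
  proof
    fix v assume v: "v \<in> S"
    then obtain j where "v = (1, j)" by (auto simp: S_def)
    then show "v \<in> {(1, i), (1, Suc i)}" using out v by blast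
  qed
  show ?thesis
  proof (cases "partner D P = P'")
    case True
    have "(1, j) \<in> S" if j: "j = i \<or> j = Suc i" for j
    proof -
      have "((1, j), outv x) \<notin> E\<^sup>*" for x
      proof
        assume "((1, j), outv x) \<in> E\<^sup>*"
        then have "cl (1, j) = cl (outv x)"
          using cl_invariant by (rule rtrancl_invariant)
        moreover have "cl (1, j) = {}"
          using True j by (auto simp: cl_def mid_def)
        ultimately show False
          by (simp add: cl_outv)
      qed
      then show ?thesis
        using j i by (auto simp: S_def)
    qed
    then have S: "S = {(1, i), (1, Suc i)}"
      using S_sub by blast
    have "((1, i), (1, Suc i)) \<in> E\<^sup>*"
      using cedges_tdiag_cap(2) by (simp add: rightv_def)
    then have "E\<^sup>* `` {(1, i)} = E\<^sup>* `` {(1, Suc i)}"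
      using cedges_tdiag_sym rtrancl_trans by fast
    then have "(\<lambda>v. E\<^sup>* `` {v}) ` S = {E\<^sup>* `` {(1, i)}}"
      by (simp add: S)
    then have "card ((\<lambda>v. E\<^sup>* `` {v}) ` S) = 1"
      by simp
    then show ?thesis
      using True unfolding nloops_def S_def by simp
  next
    case False
    have pL: "partner D P \<in> pts n" "partner D P \<notin> {P, P'}"
      using partner_pts[OF D] L_pts[OF D i] False
        diag_neq[OF D partner_in[OF D L_pts(1)[OF D i]]] by auto
    have h: "(rightv P, outv (partner D P)) \<in> E\<^sup>*"
      by (rule rtrancl_trans[OF cedges_tdiag_D[OF partner_in[OF D L_pts(1)[OF D i]]]
        cedges_tdiag_sym[OF cedges_tdiag_up[OF pL]]])
    then have "(rightv P', outv (partner D P)) \<in> E\<^sup>*"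
      using cedges_tdiag_sym[OF cedges_tdiag_cap(2)] rtrancl_trans by fast
    with h have "(1, i) \<notin> S" "(1, Suc i) \<notin> S"
      using pL(1) unfolding S_def by (auto simp: rightv_def)
    then have "S = {}"
      using S_sub by blast
    then have "card ((\<lambda>v. E\<^sup>* `` {v}) ` S) = 0"
      by simp
    then show ?thesis
      using False unfolding nloops_def S_def by simp
  qed
qed

text \<open>If the cup has two colours, \<open>c\<close> and its swap represent the two ways of
  colouring the hidden points in front of \<open>D\<close>. When the former partners differ in
  colour, exactly one of the two ways is proper there; on a closed loop both are proper or neither,
  which matches the factor 2.\<close>

lemma compat_tdiag:
  "2 ^ nloops n (tdiag n i) D * of_bool (compat (dcomp n (tdiag n i) D) c)
    = (if c P = c P' then 0 else of_bool (compat D c) + of_bool (compat D (c \<circ> swap_left i)) :: int)"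
proof (cases "c P = c P'")
  case True
  have "\<not> compat (diag_of n (capped i D)) c"
    unfolding compat_diag_of using L_pts(1)[OF D i] True
    by (auto simp: capped_def intro!: bexI[of _ P])
  then show ?thesis
    using True by (simp add: dcomp_tdiag)
next
  case ne: False
  define p where "p = partner D P"
  define q where "q = partner D P'"
  have pq: "p \<in> pts n" "q \<in> pts n" "partner D p = P" "partner D q = P'" "p \<noteq> P" "q \<noteq> P'"
    using L_pts[OF D i] partner_pts[OF D] partner_partner[OF D]
      diag_neq[OF D partner_in[OF D L_pts(1)[OF D i]]] 
      diag_neq[OF D partner_in[OF D L_pts(2)[OF D i]]] by (auto simp: p_def q_def)
  have sw: "swap_left i P = P'" "swap_left i P' = P" "\<And>x. x \<notin> {P, P'} \<Longrightarrow> swap_left i x = x"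
    by (auto simp: swap_left_def swp_def)
  define R where "R = pts n - {P, P', p, q}"
  have R: "capped i D x = partner D x" "partner D x \<in> R" if "x \<in> R" for x
  proof -
    have "x \<in> pts n" using that by (simp add: R_def)
    with D i show "capped i D x = partner D x"
      by (cases rule: capped_cases) (use that in \<open>auto simp: R_def p_def q_def\<close>)
    from D i \<open>x \<in> pts n\<close> show "partner D x \<in> R"
      by (cases rule: capped_cases) (use that partner_pts[OF D \<open>x \<in> pts n\<close>] in \<open>auto simp: R_def p_def q_def\<close>)
  qed
  have split: "(\<forall>x\<in>pts n. Q x) \<longleftrightarrow> Q P \<and> Q P' \<and> Q p \<and> Q q \<and> (\<forall>x\<in>R. Q x)" for Q
    using L_pts[OF D i] pq(1,2) unfolding R_def by blast
  have Rsw: "(\<forall>x\<in>R. (c \<circ> swap_left i) x \<noteq> (c \<circ> swap_left i) (partner D x)) \<longleftrightarrow> (\<forall>x\<in>R. c x \<noteq> c (partner D x))"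
  proof (rule ball_cong[OF refl])
    fix x assume "x \<in> R"
    then show "((c \<circ> swap_left i) x \<noteq> (c \<circ> swap_left i) (partner D x)) \<longleftrightarrow> (c x \<noteq> c (partner D x))"
      using sw(3)[of x] sw(3)[of "partner D x"] R(2)[of x] by (auto simp: R_def)
  qed
  have Rc: "(\<forall>x\<in>R. c x \<noteq> c (capped i D x)) \<longleftrightarrow> (\<forall>x\<in>R. c x \<noteq> c (partner D x))"
    using R(1) by (intro ball_cong) auto
  have cD: "compat D c' \<longleftrightarrow> c' P \<noteq> c' p \<and> c' P' \<noteq> c' q \<and> (\<forall>x\<in>R. c' x \<noteq> c' (partner D x))" for c'
    unfolding compat_iff[OF D] split using pq by (auto simp: p_def[symmetric] q_def[symmetric])
  show ?thesis
  proof (cases "p = P'")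
    case True
    then have q: "q = P" using pq(3) by (simp add: p_def q_def)
    have "capped i D P = P'" "capped i D P' = P"
      by (simp_all add: capped_def)
    then have "compat (diag_of n (capped i D)) c \<longleftrightarrow> compat D c"
      unfolding cD compat_diag_of split Rc using True q by auto
    moreover have "compat D (c \<circ> swap_left i) \<longleftrightarrow> compat D c"
      unfolding cD Rsw using True q sw by auto
    ultimately show ?thesis
      using ne True by (simp add: dcomp_tdiag nloops_tdiag p_def[symmetric])
  next
    case False
    then have qne: "q \<noteq> P" using pq(4) by (auto simp: p_def q_def)
    have "p \<noteq> q" using pq by force
    then have cap: "capped i D P = P'" "capped i D P' = P" "capped i D p = q" "capped i D q = p"
      using False qne pq(5,6) by (simp_all add: capped_def p_def[symmetric] q_def[symmetric])
    have "compat (diag_of n (capped i D)) c \<longleftrightarrow> c p \<noteq> c q \<and> (\<forall>x\<in>R. c x \<noteq> c (partner D x))"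
      unfolding compat_diag_of split Rc using cap ne by auto
    moreover have "compat D (c \<circ> swap_left i) \<longleftrightarrow> c P' \<noteq> c p \<and> c P \<noteq> c q \<and> (\<forall>x\<in>R. c x \<noteq> c (partner D x))"
      unfolding cD Rsw using False qne pq(5,6) sw by simp
    ultimately show ?thesis
      using ne False cD[of c] by (auto simp: dcomp_tdiag nloops_tdiag p_def[symmetric])
  qed
qed

end

section \<open>The homomorphism theta\<close>

definition tl_dmul :: "nat \<Rightarrow> diag \<Rightarrow> tl \<Rightarrow> tl" where
  "tl_dmul n E a = (\<lambda>\<tau>. \<Sum>\<sigma>\<in>Bn n. a \<sigma> * (if dcomp n E \<sigma> = \<tau> then 2 ^ nloops n E \<sigma> else 0))"

lemma tl_mul_gen:
  assumes i: "1 \<le> i" "i < n" and \<tau>: "\<tau> \<in> Bn n"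
  shows "tl_mul n (tl_gen n i) a \<tau> = tl_dmul n (tdiag n i) a \<tau> - a \<tau>"
proof -
  let ?f = "\<lambda>\<sigma>1. \<Sum>\<sigma>2\<in>Bn n. a \<sigma>2 * (if dcomp n \<sigma>1 \<sigma>2 = \<tau> then 2 ^ nloops n \<sigma>1 \<sigma>2 else 0)"
  have "tl_mul n (tl_gen n i) a \<tau> = (\<Sum>\<sigma>1\<in>Bn n. tl_gen n i \<sigma>1 * ?f \<sigma>1)"
    unfolding tl_mul_def sum_distrib_left mult.assoc ..
  also have "\<dots> = (\<Sum>\<sigma>1\<in>Bn n. (if \<sigma>1 = tdiag n i then ?f \<sigma>1 else 0) - (if \<sigma>1 = iddiag n then ?f \<sigma>1 else 0))"
    unfolding tl_gen_def by (intro sum.cong) (auto simp: algebra_simps)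
  also have "\<dots> = ?f (tdiag n i) - ?f (iddiag n)"
    using tdiag_in_Bn[OF i] iddiag_in_Bn finite_Bn by (simp add: sum_subtractf sum.delta')
  also have "?f (iddiag n) = (\<Sum>\<sigma>2\<in>Bn n. if \<sigma>2 = \<tau> then a \<sigma>2 else 0)"
    by (intro sum.cong) (auto simp: dcomp_id)
  also have "\<dots> = a \<tau>"
    using finite_Bn \<tau> by simp
  finally show ?thesis
    by (simp add: tl_dmul_def)
qed

text \<open>Of the two terms in \<open>compat_tdiag\<close>, the subtracted identity removes the one
  with the old colouring. What remains is a place permutation, apart from the sign for equal
  colours.\<close>

lemma tl_eval_gen:
  assumes i: "1 \<le> i" "i < n"
  shows "tl_eval n (tl_mul n (tl_gen n i) a) c =
    (if c (False, i) = c (False, Suc i) then - tl_eval n a c else tl_eval n a (c \<circ> swap_left i))"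
proof -
  have in_Bn: "dcomp n (tdiag n i) D \<in> Bn n" if "D \<in> Bn n" for D
    using capped_in_Bn[OF that i] dcomp_tdiag[OF that i] by simp
  have "(\<Sum>\<tau>\<in>Bn n. tl_dmul n (tdiag n i) a \<tau> * of_bool (compat \<tau> c))
    = (\<Sum>\<sigma>\<in>Bn n. \<Sum>\<tau>\<in>Bn n. if dcomp n (tdiag n i) \<sigma> = \<tau>
        then a \<sigma> * (2 ^ nloops n (tdiag n i) \<sigma> * of_bool (compat \<tau> c)) else 0)"
    unfolding tl_dmul_def sum_distrib_right by (subst sum.swap) (intro sum.cong refl, simp add: mult_ac)
  also have "\<dots> = (\<Sum>\<sigma>\<in>Bn n. a \<sigma> * (2 ^ nloops n (tdiag n i) \<sigma> * of_bool (compat (dcomp n (tdiag n i) \<sigma>) c)))"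
    using in_Bn finite_Bn by (intro sum.cong) (auto simp: sum.delta')
  also have "\<dots> = (\<Sum>\<sigma>\<in>Bn n. a \<sigma> * (if c (False, i) = c (False, Suc i) then 0
      else of_bool (compat \<sigma> c) + of_bool (compat \<sigma> (c \<circ> swap_left i))))"
    by (intro sum.cong refl arg_cong2[of _ _ _ _ "(*)"]) (rule compat_tdiag[OF _ i])
  also have "\<dots> = (if c (False, i) = c (False, Suc i) then 0
      else tl_eval n a c + tl_eval n a (c \<circ> swap_left i))"
    by (cases "c (False, i) = c (False, Suc i)")
      (simp_all only: refl if_True if_False tl_eval_def sum.distrib distrib_left mult_zero_right sum.neutral_const)
  finally have "(\<Sum>\<tau>\<in>Bn n. tl_dmul n (tdiag n i) a \<tau> * of_bool (compat \<tau> c)) = \<dots>" .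
  moreover have "tl_eval n (tl_mul n (tl_gen n i) a) c
    = (\<Sum>\<tau>\<in>Bn n. tl_dmul n (tdiag n i) a \<tau> * of_bool (compat \<tau> c)) - tl_eval n a c"
    unfolding tl_eval_def sum_subtractf[symmetric]
    by (intro sum.cong refl) (simp only: tl_mul_gen[OF i] left_diff_distrib)
  ultimately show ?thesis
    by simp
qed

text \<open>Multiplying evaluations by this sign turns the action of \<open>tl_gen\<close> into minus a place
  permutation: a transposition of unequal colours changes the position sum by one.\<close>

definition colour_sign :: "nat \<Rightarrow> (pt \<Rightarrow> bool) \<Rightarrow> int" where
  "colour_sign n c = (-1) ^ (\<Sum>j = 1..n. of_bool (c (False, j)) * j)"

definition left_act :: "(nat \<Rightarrow> nat) \<Rightarrow> pt \<Rightarrow> pt" where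
  "left_act w x = (if fst x then x else (False, w (snd x)))"

lemma swap_left_eq: "swap_left i = left_act (swp i)"
  by (auto simp: swap_left_def left_act_def fun_eq_iff)

lemma left_act_comp: "left_act v \<circ> left_act w = left_act (v \<circ> w)"
  by (auto simp: left_act_def fun_eq_iff)

lemma left_act_id: "left_act id = id"
  by (auto simp: left_act_def fun_eq_iff)

lemma colour_sign_swap:
  assumes i: "1 \<le> i" "i < n"
  shows "colour_sign n (c \<circ> swap_left i) =
    (if c (False, i) = c (False, Suc i) then colour_sign n c else - colour_sign n c)"
proof -
  let ?f = "\<lambda>c j. of_bool (c (False, j)) * j"
  have split: "(\<Sum>j = 1..n. ?f c j) = ?f c i + (?f c (Suc i) + (\<Sum>j\<in>{1..n} - {i} - {Suc i}. ?f c j))" for c :: "pt \<Rightarrow> bool"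
    using i by (subst sum.remove[of _ i], simp, simp, subst sum.remove[of _ "Suc i"]) simp_all
  have rest: "(\<Sum>j\<in>{1..n} - {i} - {Suc i}. ?f (c \<circ> swap_left i) j) = (\<Sum>j\<in>{1..n} - {i} - {Suc i}. ?f c j)"
    by (intro sum.cong) (auto simp: swap_left_def swp_def)
  show ?thesis
    unfolding colour_sign_def split rest
    by (cases "c (False, i)"; cases "c (False, Suc i)") (auto simp: swap_left_def swp_def power_add)
qed

lemma signed_eval_gen:
  assumes "1 \<le> i" "i < n"
  shows "colour_sign n c * tl_eval n (tl_mul n (tl_gen n i) a) c =
    - (colour_sign n (c \<circ> swap_left i) * tl_eval n a (c \<circ> swap_left i))"
proof (cases "c (False, i) = c (False, Suc i)")
  case True
  have "c \<circ> swap_left i = c"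
    using True by (auto simp: fun_eq_iff swap_left_def swp_def)
  then show ?thesis
    using True by (simp add: tl_eval_gen[OF assms])
next
  case False
  then show ?thesis
    by (simp add: tl_eval_gen[OF assms] colour_sign_swap[OF assms])
qed

section \<open>Words and their permutations\<close>

lemma perm_of_word_append: "perm_of_word (xs @ ys) = perm_of_word ys \<circ> perm_of_word xs"
  by (induction xs) (auto simp: fun_eq_iff)

lemma swp_swp: "swp i (swp i x) = x"
  by (simp add: swp_def)

lemma perm_of_word_rev: "perm_of_word ws \<circ> perm_of_word (rev ws) = id"
proof -
  have "perm_of_word ws (perm_of_word (rev ws) x) = x" for x
    by (induction ws arbitrary: x) (simp_all add: perm_of_word_append swp_swp)
  then show ?thesis
    by (simp add: fun_eq_iff)
qed

lemma perm_of_word_rev': "perm_of_word (rev ws) \<circ> perm_of_word ws = id"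
  using perm_of_word_rev[of "rev ws"] by simp

lemma perm_of_word_rev_cong:
  assumes "perm_of_word ws = perm_of_word ws'"
  shows "perm_of_word (rev ws) = perm_of_word (rev ws')"
  by (metis assms comp_assoc comp_id id_comp perm_of_word_rev perm_of_word_rev')

lemma swp_transpose: "swp i = Transposition.transpose i (Suc i)"
  by (auto simp: fun_eq_iff swp_def Transposition.transpose_def)

lemma sign_perm_of_word:
  "permutation (perm_of_word ws) \<and> sign (perm_of_word ws) = (-1) ^ length ws"
proof (induction ws)
  case Nil
  then show ?case using permutation_id by (simp add: id_def)
next
  case (Cons i ws)
  have "permutation (swp i)" "sign (swp i) = -1"
    by (simp_all add: swp_transpose permutation_swap_id sign_swap_id)
  then show ?case
    using Cons unfolding perm_of_word.simps by (simp add: permutation_compose sign_compose del: comp_apply)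
qed

text \<open>Letters are peeled off from the front, and each one precomposes the colouring with its
  swap; this composes the swaps in the order of the reversed word.\<close>

lemma signed_eval_word:
  assumes "set ws \<subseteq> {1..<n}"
  shows "colour_sign n c * tl_eval n (tl_word n ws) c = (-1) ^ length ws *
    (colour_sign n (c \<circ> left_act (perm_of_word (rev ws))) *
      tl_eval n (tl_one n) (c \<circ> left_act (perm_of_word (rev ws))))"
  using assms
proof (induction ws arbitrary: c)
  case Nil
  then show ?case by (simp only: rev.simps perm_of_word.simps left_act_id comp_id tl_word.simps list.size power_0 mult_1)
next
  case (Cons i ws)
  have "(c \<circ> swap_left i) \<circ> left_act (perm_of_word (rev ws)) = c \<circ> left_act (perm_of_word (rev (i # ws)))"
    by (simp add: swap_left_eq comp_assoc left_act_comp perm_of_word_append)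
  then have "colour_sign n (c \<circ> swap_left i) * tl_eval n (tl_word n ws) (c \<circ> swap_left i)
    = (-1) ^ length ws * (colour_sign n (c \<circ> left_act (perm_of_word (rev (i # ws)))) *
      tl_eval n (tl_one n) (c \<circ> left_act (perm_of_word (rev (i # ws)))))"
    using Cons.IH[of "c \<circ> swap_left i"] Cons.prems
    by (simp only: list.set insert_subset)
  moreover have "1 \<le> i" "i < n"
    using Cons.prems by auto
  ultimately show ?case
    by (simp only: tl_word.simps signed_eval_gen list.size add_Suc_right add_0_right power_Suc mult_minus1 mult_minus_left)
qed

text \<open>By \<open>signed_eval_word\<close> a word enters only through its permutation and the
  parity of its length, and the parity is the sign of the permutation. Faithfulness carries the
  equality from evaluations to coefficients.\<close>

lemma tl_word_cong:
  assumes ws: "set ws \<subseteq> {1..<n}" "set ws' \<subseteq> {1..<n}" "perm_of_word ws = perm_of_word ws'"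
    and \<tau>: "\<tau> \<in> Bn n"
  shows "tl_word n ws \<tau> = tl_word n ws' \<tau>"
proof -
  have len: "(-1 :: int) ^ length ws = (-1) ^ length ws'"
    using sign_perm_of_word[of ws] sign_perm_of_word[of ws'] ws(3) by simp
  have "colour_sign n c * tl_eval n (tl_word n ws) c = colour_sign n c * tl_eval n (tl_word n ws') c" for c
    by (simp only: signed_eval_word[OF ws(1)] signed_eval_word[OF ws(2)] len perm_of_word_rev_cong[OF ws(3)])
  then have "tl_eval n (tl_word n ws) c = tl_eval n (tl_word n ws') c" for c
    by (simp add: colour_sign_def)
  then have "tl_eval n (\<lambda>D. tl_word n ws D - tl_word n ws' D) c = 0" for c
    by (simp only: tl_eval_def left_diff_distrib sum_subtractf diff_self)
  from tl_eval_faithful[OF this \<tau>] show ?thesis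
    by simp
qed

lemma theta_perm_of_word:
  assumes "set ws \<subseteq> {1..<n}" "\<tau> \<in> Bn n"
  shows "theta n (perm_of_word ws) \<tau> = tl_word n ws \<tau>"
proof -
  let ?P = "\<lambda>us. set us \<subseteq> {1..<n} \<and> perm_of_word us = perm_of_word ws"
  have "?P (SOME us. ?P us)"
    by (rule someI[where x = ws]) (use assms in simp)
  then show ?thesis
    unfolding theta_def using assms by (intro tl_word_cong) auto
qed

section \<open>Expansion in products of cup diagrams\<close>

fun tl_cup_word :: "nat \<Rightarrow> nat list \<Rightarrow> tl" where
  "tl_cup_word n [] = tl_one n"
| "tl_cup_word n (i # is) = tl_dmul n (tdiag n i) (tl_cup_word n is)"

lemma tl_cup_word_nonneg: "tl_cup_word n ws \<tau> \<ge> 0"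
  by (induction ws arbitrary: \<tau>) (auto simp: tl_one_def tl_dmul_def intro!: sum_nonneg)

text \<open>The subset \<open>T\<close> selects the factors t_i - 1 from which t_i is taken; since
  the letters are distinct, selections are the same as subsets. The induction splits them by whether
  they contain the first letter.\<close>

lemma tl_word_expand:
  assumes "set ws \<subseteq> {1..<n}" "distinct ws" "\<tau> \<in> Bn n"
  shows "tl_word n ws \<tau> = (\<Sum>T\<in>Pow (set ws). (-1) ^ card (set ws - T) * tl_cup_word n (filter (\<lambda>i. i \<in> T) ws) \<tau>)"
  using assms
proof (induction ws arbitrary: \<tau>)
  case Nil
  then show ?case by simp
next
  case (Cons i ws)
  let ?S = "set ws"
  have i: "1 \<le> i" "i < n" "i \<notin> ?S" "finite ?S"
    using Cons.prems by auto
  let ?g = "\<lambda>T. tl_cup_word n (filter (\<lambda>i. i \<in> T) (i # ws)) \<tau>"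
  have "tl_dmul n (tdiag n i) (tl_word n ws) \<tau>
    = tl_dmul n (tdiag n i) (\<lambda>\<sigma>. \<Sum>T\<in>Pow ?S. (-1) ^ card (?S - T) * tl_cup_word n (filter (\<lambda>i. i \<in> T) ws) \<sigma>) \<tau>"
    unfolding tl_dmul_def
    by (rule sum.cong[OF refl], subst Cons.IH) (use Cons.prems in auto)
  also have "\<dots> = (\<Sum>T\<in>Pow ?S. (-1) ^ card (?S - T) * tl_dmul n (tdiag n i) (tl_cup_word n (filter (\<lambda>i. i \<in> T) ws)) \<tau>)"
    unfolding tl_dmul_def sum_distrib_left sum_distrib_right by (subst sum.swap) (simp add: mult_ac)
  also have "\<dots> = (\<Sum>T\<in>Pow ?S. (-1) ^ card (set (i # ws) - insert i T) * ?g (insert i T))"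
  proof (rule sum.cong[OF refl])
    fix T assume "T \<in> Pow ?S"
    then have "set (i # ws) - insert i T = ?S - T" using i by auto
    moreover have "filter (\<lambda>j. j \<in> insert i T) ws = filter (\<lambda>i. i \<in> T) ws"
      using i by (intro filter_cong) auto
    ultimately show "(-1) ^ card (?S - T) * tl_dmul n (tdiag n i) (tl_cup_word n (filter (\<lambda>i. i \<in> T) ws)) \<tau>
      = (-1) ^ card (set (i # ws) - insert i T) * ?g (insert i T)"
      by simp
  qed
  finally have 1: "tl_dmul n (tdiag n i) (tl_word n ws) \<tau> = \<dots>" .
  have 2: "- tl_word n ws \<tau> = (\<Sum>T\<in>Pow ?S. (-1) ^ card (set (i # ws) - T) * ?g T)"
  proof -
    have "(-1) ^ card (set (i # ws) - T) * ?g T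
      = - ((-1) ^ card (?S - T) * tl_cup_word n (filter (\<lambda>i. i \<in> T) ws) \<tau>)" if "T \<in> Pow ?S" for T
    proof -
      have "set (i # ws) - T = insert i (?S - T)" "i \<notin> T" using i that by auto
      then show ?thesis using i by simp
    qed
    then have "(\<Sum>T\<in>Pow ?S. (-1) ^ card (set (i # ws) - T) * ?g T)
        = (\<Sum>T\<in>Pow ?S. - ((-1) ^ card (?S - T) * tl_cup_word n (filter (\<lambda>i. i \<in> T) ws) \<tau>))"
      by (rule sum.cong[OF refl])
    also have "\<dots> = - tl_word n ws \<tau>"
      using Cons.IH[of \<tau>] Cons.prems by (simp add: sum_negf)
    finally show ?thesis ..
  qed
  have "(\<Sum>T\<in>Pow (set (i # ws)). (-1) ^ card (set (i # ws) - T) * ?g T)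
    = (\<Sum>T\<in>Pow ?S. (-1) ^ card (set (i # ws) - T) * ?g T)
      + (\<Sum>T\<in>insert i ` Pow ?S. (-1) ^ card (set (i # ws) - T) * ?g T)"
    using i unfolding list.set(2) Pow_insert by (intro sum.union_disjoint) auto
  also have "(\<Sum>T\<in>insert i ` Pow ?S. (-1) ^ card (set (i # ws) - T) * ?g T)
    = (\<Sum>T\<in>Pow ?S. (-1) ^ card (set (i # ws) - insert i T) * ?g (insert i T))"
    using i by (intro sum.reindex_cong[of "insert i"]) (auto simp: inj_on_def)
  finally show ?case
    using 1 2 tl_mul_gen[OF i(1,2) Cons.prems(3), of "tl_word n ws"] by simp
qed

section \<open>Hessenberg permutations\<close>

definition hess_perm :: "nat set \<Rightarrow> nat \<Rightarrow> nat" where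
  "hess_perm S = perm_of_word (sorted_list_of_set S)"

definition hess_inv :: "nat set \<Rightarrow> nat \<Rightarrow> nat" where
  "hess_inv S = perm_of_word (rev (sorted_list_of_set S))"

lemma sorted_list_of_set_insert_max:
  fixes S :: "nat set"
  assumes "finite S" "\<And>s. s \<in> S \<Longrightarrow> s < b"
  shows "sorted_list_of_set (insert b S) = sorted_list_of_set S @ [b]"
proof -
  have "S - {b} = S" using assms(2) by blast
  then show ?thesis
    using assms by (simp add: sorted_insort_is_snoc less_imp_le)
qed

lemma hess_perm_empty [simp]: "hess_perm {} = id"
  by (simp add: hess_perm_def)

lemma hess_inv_empty [simp]: "hess_inv {} = id"
  by (simp add: hess_inv_def)

lemma hess_perm_insert:
  assumes "finite S" "\<And>s. s \<in> S \<Longrightarrow> s < b"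
  shows "hess_perm (insert b S) = swp b \<circ> hess_perm S"
proof -
  have "sorted_list_of_set (insert b S) = sorted_list_of_set S @ [b]"
    by (rule sorted_list_of_set_insert_max) (use assms in auto)
  then show ?thesis
    unfolding hess_perm_def by (simp add: perm_of_word_append fun_eq_iff)
qed

lemma hess_inv_insert:
  assumes "finite S" "\<And>s. s \<in> S \<Longrightarrow> s < b"
  shows "hess_inv (insert b S) = hess_inv S \<circ> swp b"
proof -
  have "sorted_list_of_set (insert b S) = sorted_list_of_set S @ [b]"
    by (rule sorted_list_of_set_insert_max) (use assms in auto)
  then show ?thesis
    unfolding hess_inv_def by (simp add: fun_eq_iff)
qed

lemma hess_inv_inverse: "hess_perm S \<circ> hess_inv S = id" "hess_inv S \<circ> hess_perm S = id"
  unfolding hess_perm_def hess_inv_def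
  using perm_of_word_rev[of "sorted_list_of_set S"] perm_of_word_rev[of "rev (sorted_list_of_set S)"]
  by simp_all

lemma swp_permutes: "1 \<le> i \<Longrightarrow> i < n \<Longrightarrow> swp i permutes {1..n}"
proof -
  assume "1 \<le> i" "i < n"
  have "swp i = Transposition.transpose i (Suc i)"
    by (auto simp: fun_eq_iff swp_def Transposition.transpose_def)
  then show ?thesis
    using \<open>1 \<le> i\<close> \<open>i < n\<close> by (simp add: permutes_swap_id)
qed

lemma perm_of_word_permutes: "set ws \<subseteq> {1..<n} \<Longrightarrow> perm_of_word ws permutes {1..n}"
proof (induction ws)
  case Nil
  then show ?case by (simp only: perm_of_word.simps permutes_id)
next
  case (Cons i ws)
  then show ?case
    unfolding perm_of_word.simps by (intro permutes_compose swp_permutes) auto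
qed

lemma hess_perm_permutes: "S \<subseteq> {1..<n} \<Longrightarrow> hess_perm S permutes {1..n}"
  unfolding hess_perm_def
  by (intro perm_of_word_permutes) (simp add: finite_subset)

lemma hess_inv_permutes: "S \<subseteq> {1..<n} \<Longrightarrow> hess_inv S permutes {1..n}"
  unfolding hess_inv_def
  by (intro perm_of_word_permutes) (simp add: finite_subset)

definition hess_perms :: "nat \<Rightarrow> (nat \<Rightarrow> nat) set" where
  "hess_perms n = {w. w permutes {1..n} \<and> (\<forall>i. i \<le> Suc (w i))}"

text \<open>The largest point n + 1 can only go to n + 1 or to n; in the second case a final
  \<open>swp n\<close> makes it a fixed point.\<close>

lemma hess_perms_Suc:
  assumes "n \<ge> 1"
  shows "hess_perms (Suc n) = hess_perms n \<union> (\<lambda>w. swp n \<circ> w) ` hess_perms n"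
proof (intro set_eqI iffI)
  fix w assume w: "w \<in> hess_perms (Suc n)"
  then have wp: "w permutes {1..Suc n}" and wh: "\<And>i. i \<le> Suc (w i)"
    by (auto simp: hess_perms_def)
  have last: "u permutes {1..n}" if u: "u permutes {1..Suc n}" "u (Suc n) = Suc n" for u :: "nat \<Rightarrow> nat"
  proof (rule permutes_superset[OF u(1)])
    fix x assume "x \<in> {1..Suc n} - {1..n}"
    then have "x = Suc n" by auto
    then show "u x = x" using u(2) by simp
  qed
  have "w (Suc n) \<in> {1..Suc n}" "n \<le> w (Suc n)"
    using permutes_in_image[OF wp, of "Suc n"] wh[of "Suc n"] by auto
  then consider "w (Suc n) = Suc n" | "w (Suc n) = n"
    by fastforce
  then show "w \<in> hess_perms n \<union> (\<lambda>w. swp n \<circ> w) ` hess_perms n"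
  proof cases
    case 1
    then show ?thesis using last[OF wp] wh by (simp add: hess_perms_def)
  next
    case 2
    define u where "u = swp n \<circ> w"
    have "u permutes {1..Suc n}"
      unfolding u_def using assms by (intro permutes_compose[OF wp] swp_permutes) auto
    moreover have "u (Suc n) = Suc n"
      by (simp add: u_def 2 swp_def)
    ultimately have "u permutes {1..n}" by (rule last)
    moreover have "i \<le> Suc (u i)" for i
    proof (cases "i = Suc n")
      case False
      have "w i \<noteq> n"
        using False 2 permutes_inj[OF wp] by (metis injD)
      then show ?thesis
        using wh[of i] permutes_in_image[OF wp, of i] by (auto simp: u_def swp_def)
    qed (simp add: u_def 2 swp_def)
    moreover have "w = swp n \<circ> u"
      by (simp add: u_def fun_eq_iff swp_swp)
    ultimately show ?thesis by (auto simp: hess_perms_def)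
  qed
next
  fix w assume "w \<in> hess_perms n \<union> (\<lambda>w. swp n \<circ> w) ` hess_perms n"
  then consider "w \<in> hess_perms n" | u where "u \<in> hess_perms n" "w = swp n \<circ> u"
    by blast
  then show "w \<in> hess_perms (Suc n)"
  proof cases
    case 1
    then show ?thesis
      unfolding hess_perms_def using permutes_subset[of w "{1..n}" "{1..Suc n}"] by auto
  next
    case 2
    then have up: "u permutes {1..n}" and uh: "\<And>i. i \<le> Suc (u i)"
      by (auto simp: hess_perms_def)
    have "w permutes {1..Suc n}"
      unfolding 2 using assms by (intro permutes_compose swp_permutes permutes_subset[OF up]) auto
    moreover have "i \<le> Suc (w i)" for i
    proof (cases "u i = Suc n")
      case True
      then have "i = Suc n"
        using permutes_in_image[OF up, of i] permutes_not_in[OF up, of i] by fastforce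
      then show ?thesis using True by (simp add: 2 swp_def)
    next
      case False
      then show ?thesis using uh[of i] by (simp add: 2 swp_def)
    qed
    ultimately show ?thesis by (simp add: hess_perms_def)
  qed
qed

text \<open>From n = 1 on, each step doubles both sides: the new largest letter is used or not, and
  accordingly the point \<open>Suc n\<close> is moved or fixed.\<close>

lemma hess_perm_bij: "bij_betw hess_perm (Pow {1..<n}) (hess_perms n)"
proof (induction n)
  case 0
  have "hess_perms 0 = {id}"
    by (auto simp: hess_perms_def)
  then show ?case
    by (auto simp: bij_betw_def)
next
  case (Suc n)
  show ?case
  proof (cases "n = 0")
    case True
    have "hess_perms (Suc 0) = {id}"
      by (auto simp: hess_perms_def)
    then show ?thesis
      using True by (auto simp: bij_betw_def)
  next
    case False
    then have n: "{1..<Suc n} = insert n {1..<n}" and n1: "n \<ge> 1" by auto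
    have lt: "finite S \<and> (\<forall>s\<in>S. s < n)" if "S \<in> Pow {1..<n}" for S
      using that by (auto simp: finite_subset)
    have inj_ins: "inj_on (insert n) (Pow {1..<n})"
    proof (rule inj_onI)
      fix S T assume "S \<in> Pow {1..<n}" "T \<in> Pow {1..<n}" "insert n S = insert n T"
      moreover from this have "n \<notin> S" "n \<notin> T" by auto
      ultimately show "S = T"
        using insert_ident by metis
    qed
    have "bij_betw ((\<circ>) (swp n)) (hess_perms n) ((\<lambda>w. swp n \<circ> w) ` hess_perms n)"
      by (rule inj_on_imp_bij_betw, rule inj_onI) (metis fun_eq_iff comp_apply swp_swp)
    then have "bij_betw ((\<circ>) (swp n) \<circ> hess_perm) (Pow {1..<n}) ((\<lambda>w. swp n \<circ> w) ` hess_perms n)"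
      by (rule bij_betw_trans[OF Suc.IH])
    moreover have "hess_perm (insert n S) = swp n \<circ> hess_perm S" if "S \<in> Pow {1..<n}" for S
      using lt[OF that] by (intro hess_perm_insert) auto
    ultimately have "bij_betw (\<lambda>S. hess_perm (insert n S)) (Pow {1..<n}) ((\<lambda>w. swp n \<circ> w) ` hess_perms n)"
      by (subst bij_betw_cong[where g = "(\<circ>) (swp n) \<circ> hess_perm"]) auto
    then have "bij_betw hess_perm (insert n ` Pow {1..<n}) ((\<lambda>w. swp n \<circ> w) ` hess_perms n)"
      using bij_betw_comp_iff[OF inj_on_imp_bij_betw[OF inj_ins], of hess_perm] by (simp add: comp_def)
    moreover have "hess_perms n \<inter> (\<lambda>w. swp n \<circ> w) ` hess_perms n = {}"
    proof -
      have *: "w (Suc n) = Suc n" if "w \<in> hess_perms n" for w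
        using that permutes_not_in[of w "{1..n}" "Suc n"] by (auto simp: hess_perms_def)
      have "swp n (w (Suc n)) = n" if "w \<in> hess_perms n" for w
        unfolding *[OF that] by (simp add: swp_def)
      with * show ?thesis by fastforce
    qed
    ultimately show ?thesis
      unfolding n Pow_insert hess_perms_Suc[OF n1]
      by (intro bij_betw_combine Suc.IH) 
  qed
qed

section \<open>Columns as lattice paths\<close>

text \<open>Column \<open>j\<close> of a tuple \<open>C\<close> is read as a lattice path: starting at height \<open>b j\<close>, it makes an up
  step at each time that belongs to \<open>C j\<close>. Two neighbouring columns form a skew semistandard
  tableau iff the two paths do not meet.\<close>

definition height :: "(nat \<Rightarrow> int) \<Rightarrow> (nat \<Rightarrow> nat set) \<Rightarrow> nat \<Rightarrow> nat \<Rightarrow> int" where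
  "height b C j x = b j + int (card (C j \<inter> {..<x}))"

definition meets :: "(nat \<Rightarrow> int) \<Rightarrow> (nat \<Rightarrow> nat set) \<Rightarrow> nat \<Rightarrow> bool" where
  "meets b C j \<longleftrightarrow> (\<exists>x. height b C j x \<le> height b C (Suc j) x)"

definition content :: "nat \<Rightarrow> (nat \<Rightarrow> nat set) \<Rightarrow> nat \<Rightarrow> nat" where
  "content n C x = card {j \<in> {1..n}. x \<in> C j}"

text \<open>The prescribed sizes are integers: a negative one leaves no tuple at all, in accordance
  with e_d = 0 for d < 0.\<close>

definition columns :: "nat \<Rightarrow> (nat \<Rightarrow> int) \<Rightarrow> (nat \<Rightarrow> nat set) set" where
  "columns n d = {C. (\<forall>j. j \<notin> {1..n} \<longrightarrow> C j = {}) \<and> (\<forall>j\<in>{1..n}. finite (C j) \<and> int (card (C j)) = d j)}"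

definition first_meet :: "(nat \<Rightarrow> int) \<Rightarrow> (nat \<Rightarrow> nat set) \<Rightarrow> nat \<Rightarrow> nat" where
  "first_meet b C j = (LEAST x. height b C j x \<le> height b C (Suc j) x)"

definition tail_swap :: "(nat \<Rightarrow> int) \<Rightarrow> nat \<Rightarrow> (nat \<Rightarrow> nat set) \<Rightarrow> nat \<Rightarrow> nat set" where
  "tail_swap b j C = (let t = first_meet b C j in
     C(j := C j \<inter> {..<t} \<union> C (Suc j) \<inter> {t..}, Suc j := C (Suc j) \<inter> {..<t} \<union> C j \<inter> {t..}))"

lemma height_0: "height b C j 0 = b j"
  by (simp add: height_def)

lemma height_Suc: "height b C j (Suc x) = height b C j x + of_bool (x \<in> C j)"
proof -
  have "C j \<inter> {..<Suc x} = (if x \<in> C j then insert x (C j \<inter> {..<x}) else C j \<inter> {..<x})"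
    by (auto simp: less_Suc_eq)
  then show ?thesis
    by (simp add: height_def)
qed

lemma height_mono: "x \<le> y \<Longrightarrow> height b C j x \<le> height b C j y"
  by (auto simp: height_def intro!: card_mono)

lemma height_ge: "b j \<le> height b C j x"
  by (simp add: height_def)

lemma height_le: "finite (C j) \<Longrightarrow> height b C j x \<le> b j + int (card (C j))"
  by (auto simp: height_def intro!: card_mono)

lemma height_cong: "C j \<inter> {..<x} = C' j \<inter> {..<x} \<Longrightarrow> height b C j x = height b C' j x"
  by (simp add: height_def)

lemma height_eventually:
  assumes "finite (C j)"
  shows "\<exists>N. \<forall>x\<ge>N. height b C j x = b j + int (card (C j))"
proof -
  obtain N where "C j \<subseteq> {..<N}"
    using assms finite_nat_set_iff_bounded by (metis lessThan_iff subsetI)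
  then have "C j \<inter> {..<x} = C j" if "x \<ge> N" for x
    using that by auto
  then show ?thesis
    unfolding height_def by (intro exI[of _ N]) simp
qed

text \<open>The gap between the two paths starts positive and changes by at most one in each step,
  so it cannot jump over 0. Hence the inequality in \<open>meets\<close> is an equality when it
  first holds.\<close>

lemma first_meet:
  assumes lt: "b (Suc j) < b j" and m: "meets b C j"
  shows "height b C j (first_meet b C j) = height b C (Suc j) (first_meet b C j)"
    and "x < first_meet b C j \<Longrightarrow> height b C (Suc j) x < height b C j x"
proof -
  let ?P = "\<lambda>x. height b C j x \<le> height b C (Suc j) x"
  have P: "?P (first_meet b C j)"
    using m unfolding meets_def first_meet_def by (rule LeastI_ex)
  have below: "x < first_meet b C j \<Longrightarrow> height b C (Suc j) x < height b C j x" for x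
    unfolding first_meet_def by (drule not_less_Least) simp
  then show "x < first_meet b C j \<Longrightarrow> height b C (Suc j) x < height b C j x" .
  show "height b C j (first_meet b C j) = height b C (Suc j) (first_meet b C j)"
  proof (cases "first_meet b C j")
    case 0
    then show ?thesis using P lt by (simp add: height_0)
  next
    case (Suc y)
    then show ?thesis
      using P below[of y] by (cases "y \<in> C j"; cases "y \<in> C (Suc j)") (simp_all add: height_Suc)
  qed
qed

lemma first_meet_eqI:
  assumes "height b C j t = height b C (Suc j) t" "\<And>x. x < t \<Longrightarrow> height b C (Suc j) x < height b C j x"
  shows "first_meet b C j = t" "meets b C j"
proof -
  show "first_meet b C j = t"
    unfolding first_meet_def
    by (rule Least_equality) (use assms in \<open>auto simp: not_less[symmetric]\<close>)
  show "meets b C j"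
    unfolding meets_def using assms(1) by (metis order_refl)
qed

section \<open>Tail swaps at a first meeting\<close>

context
  fixes b :: "nat \<Rightarrow> int" and C :: "nat \<Rightarrow> nat set" and j :: nat
  assumes lt: "b (Suc j) < b j" and m: "meets b C j"
begin

lemma tail_swap_nth:
  "tail_swap b j C j = C j \<inter> {..<first_meet b C j} \<union> C (Suc j) \<inter> {first_meet b C j..}"
  "tail_swap b j C (Suc j) = C (Suc j) \<inter> {..<first_meet b C j} \<union> C j \<inter> {first_meet b C j..}"
  "k \<noteq> j \<Longrightarrow> k \<noteq> Suc j \<Longrightarrow> tail_swap b j C k = C k"
  by (simp_all add: tail_swap_def Let_def)

lemma height_tail_swap_le:
  "x \<le> first_meet b C j \<Longrightarrow> height b (tail_swap b j C) k x = height b C k x"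
  by (rule height_cong) (auto simp: tail_swap_def Let_def)

text \<open>Nothing changes up to the first meeting, so it is found again at the same time. This is
  what makes \<open>tail_swap\<close> an involution.\<close>

lemma first_meet_tail_swap: "first_meet b (tail_swap b j C) j = first_meet b C j" "meets b (tail_swap b j C) j"
proof -
  have "height b (tail_swap b j C) j (first_meet b C j) = height b (tail_swap b j C) (Suc j) (first_meet b C j)"
    using first_meet(1)[of b j C] lt m by (simp add: height_tail_swap_le)
  moreover have "x < first_meet b C j \<Longrightarrow> height b (tail_swap b j C) (Suc j) x < height b (tail_swap b j C) j x" for x
    using first_meet(2)[of b j C, OF lt m] by (simp add: height_tail_swap_le)
  ultimately show "first_meet b (tail_swap b j C) j = first_meet b C j" "meets b (tail_swap b j C) j"
    using first_meet_eqI by blast+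
qed

lemma tail_swap_tail_swap: "tail_swap b j (tail_swap b j C) = C"
  unfolding tail_swap_def[of b j "tail_swap b j C"] first_meet_tail_swap Let_def
  by (rule ext) (auto simp: tail_swap_nth not_le)

lemma mem_tail_swap: "of_bool (x \<in> tail_swap b j C j) + of_bool (x \<in> tail_swap b j C (Suc j))
    = (of_bool (x \<in> C j) + of_bool (x \<in> C (Suc j)) :: nat)"
  by (cases "x < first_meet b C j") (auto simp: tail_swap_nth)

lemma card_tail_swap:
  assumes "finite (C j)" "finite (C (Suc j))"
  shows "b j + int (card (tail_swap b j C j)) = b (Suc j) + int (card (C (Suc j)))"
    "b (Suc j) + int (card (tail_swap b j C (Suc j))) = b j + int (card (C j))"
    "finite (tail_swap b j C j)" "finite (tail_swap b j C (Suc j))"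
proof -
  let ?t = "first_meet b C j"
  have split: "card A = card (A \<inter> {..<?t}) + card (A \<inter> {?t..})" if "finite A" for A :: "nat set"
  proof -
    have "A = (A \<inter> {..<?t}) \<union> (A \<inter> {?t..})" by auto
    then have "card A = card ((A \<inter> {..<?t}) \<union> (A \<inter> {?t..}))" by simp
    also have "\<dots> = card (A \<inter> {..<?t}) + card (A \<inter> {?t..})"
      using that by (intro card_Un_disjoint) auto
    finally show ?thesis .
  qed
  have un: "card (A \<inter> {..<?t} \<union> B \<inter> {?t..}) = card (A \<inter> {..<?t}) + card (B \<inter> {?t..})"
    if "finite A" "finite B" for A B :: "nat set"
    using that by (intro card_Un_disjoint) auto
  have "b j + int (card (C j \<inter> {..<?t})) = b (Suc j) + int (card (C (Suc j) \<inter> {..<?t}))"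
    using first_meet(1)[of b j C] lt m by (simp add: height_def)
  then show "b j + int (card (tail_swap b j C j)) = b (Suc j) + int (card (C (Suc j)))"
    "b (Suc j) + int (card (tail_swap b j C (Suc j))) = b j + int (card (C j))"
    using assms split[OF assms(1)] split[OF assms(2)] by (simp_all add: tail_swap_nth un)
  show "finite (tail_swap b j C j)" "finite (tail_swap b j C (Suc j))"
    using assms by (auto simp: tail_swap_nth)
qed

lemma content_tail_swap:
  assumes "1 \<le> j" "j < n"
  shows "content n (tail_swap b j C) = content n C"
proof
  fix x
  have c: "content n C x = of_bool (x \<in> C j) + of_bool (x \<in> C (Suc j)) + card {k \<in> {1..n} - {j, Suc j}. x \<in> C k}"
    for C :: "nat \<Rightarrow> nat set"
  proof -
    have "{k \<in> {1..n}. x \<in> C k} = {k. k = j \<and> x \<in> C j} \<union> {k. k = Suc j \<and> x \<in> C (Suc j)} \<union> {k \<in> {1..n} - {j, Suc j}. x \<in> C k}"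
      using assms by auto
    then have "content n C x = card ({k. k = j \<and> x \<in> C j} \<union> {k. k = Suc j \<and> x \<in> C (Suc j)} \<union> {k \<in> {1..n} - {j, Suc j}. x \<in> C k})"
      by (simp only: content_def)
    also have "\<dots> = card {k. k = j \<and> x \<in> C j} + card {k. k = Suc j \<and> x \<in> C (Suc j)} + card {k \<in> {1..n} - {j, Suc j}. x \<in> C k}"
      by (subst card_Un_disjoint, simp, simp, blast, subst card_Un_disjoint) auto
    finally show ?thesis by auto
  qed
  have "{k \<in> {1..n} - {j, Suc j}. x \<in> tail_swap b j C k} = {k \<in> {1..n} - {j, Suc j}. x \<in> C k}"
    by (auto simp: tail_swap_nth)
  then show "content n (tail_swap b j C) x = content n C x"
    unfolding c using mem_tail_swap[of x] by simp
qed

lemma meets_tail_swap_far: "k \<noteq> j \<Longrightarrow> Suc k \<noteq> j \<Longrightarrow> k \<noteq> Suc j \<Longrightarrow> meets b (tail_swap b j C) k = meets b C k"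
  by (simp add: meets_def height_def tail_swap_nth)

text \<open>Path \<open>j + 2\<close> stays below the start of path \<open>j\<close>, so paths \<open>j + 1\<close> and \<open>j + 2\<close> can
  only meet before paths \<open>j\<close> and \<open>j + 1\<close> do.\<close>

lemma meets_tail_swap_Suc:
  assumes fin: "finite (C (Suc (Suc j)))" and top: "b (Suc (Suc j)) + int (card (C (Suc (Suc j)))) < b j"
  shows "meets b (tail_swap b j C) (Suc j) = meets b C (Suc j)"
proof -
  let ?t = "first_meet b C j" and ?T = "tail_swap b j C"
  have above: "height b C' (Suc (Suc j)) x < height b C' (Suc j) x"
    if "?t \<le> x" "C' (Suc (Suc j)) = C (Suc (Suc j))" "height b C' (Suc j) ?t = height b C (Suc j) ?t" for C' x
  proof -
    have "height b C' (Suc (Suc j)) x < b j"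
      using height_le[of C' "Suc (Suc j)" b x] fin top that(2) by simp
    also have "b j \<le> height b C j ?t" by (rule height_ge)
    also have "\<dots> = height b C' (Suc j) ?t" using first_meet(1)[of b j C] lt m that(3) by simp
    also have "\<dots> \<le> height b C' (Suc j) x" by (rule height_mono[OF that(1)])
    finally show ?thesis .
  qed
  have "height b ?T (Suc j) x \<le> height b ?T (Suc (Suc j)) x \<longleftrightarrow> height b C (Suc j) x \<le> height b C (Suc (Suc j)) x" for x
  proof (cases "x \<le> ?t")
    case True
    then show ?thesis by (simp add: height_tail_swap_le)
  next
    case False
    then show ?thesis
      using above[of x ?T] above[of x C] by (simp add: height_tail_swap_le tail_swap_nth)
  qed
  then show ?thesis by (simp add: meets_def)
qed

end

text \<open>Tuples are indexed by their starts: path j leads from \<open>b j\<close> to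
  \<open>a (v j)\<close>, so \<open>v\<close> records the assignment of the ends. \<open>U\<close>
  lists the meetings that are still demanded.\<close>

definition path_tuples :: "nat \<Rightarrow> (nat \<Rightarrow> int) \<Rightarrow> (nat \<Rightarrow> int) \<Rightarrow> (nat \<Rightarrow> nat) \<Rightarrow> nat set \<Rightarrow> (nat \<Rightarrow> nat) \<Rightarrow> (nat \<Rightarrow> nat set) set" where
  "path_tuples n a b v U c =
    {C \<in> columns n (\<lambda>j. a (v j) - b j). (\<forall>j\<in>U. meets b C j) \<and> content n C = c}"

text \<open>The demand that paths i and i + 1 meet is traded for an exchange of their ends. As 1 <=
  v i <= i, the end \<open>a (v i)\<close> is higher than \<open>a (Suc i)\<close>, so that a
  meeting is automatic on the target side and the swap can be undone. Demands further right survive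
  by \<open>meets_tail_swap_Suc\<close> and \<open>meets_tail_swap_far\<close>.\<close>

lemma tail_swap_bij:
  assumes a: "\<And>i. 1 \<le> i \<Longrightarrow> i < k \<Longrightarrow> a k < a i" and b: "b (Suc i) < b i"
    and ab: "Suc (Suc i) \<le> n \<Longrightarrow> a (Suc (Suc i)) < b i"
    and i: "1 \<le> i" "i < n" "k = Suc i"
    and v: "v (Suc i) = Suc i" "v (Suc (Suc i)) = Suc (Suc i)" "1 \<le> v i" "v i \<le> i"
    and U: "\<And>u. u \<in> U \<Longrightarrow> i < u \<and> u < n"
  shows "bij_betw (tail_swap b i) (path_tuples n a b v (insert i U) c) (path_tuples n a b (v \<circ> swp i) U c)"
proof -
  have fwd: "tail_swap b i C \<in> columns n (\<lambda>j. a ((v \<circ> swp i) j) - b j)"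
    if C: "C \<in> columns n (\<lambda>j. a (v j) - b j)" and m: "meets b C i" for C v
  proof -
    have f: "finite (C i)" "finite (C (Suc i))" "int (card (C i)) = a (v i) - b i"
      "int (card (C (Suc i))) = a (v (Suc i)) - b (Suc i)"
      using C i by (auto simp: columns_def)
    show ?thesis
      unfolding columns_def
    proof (intro CollectI conjI allI impI ballI)
      fix j assume "j \<notin> {1..n}"
      then show "tail_swap b i C j = {}"
        using C i by (auto simp: tail_swap_nth(3)[OF b m] columns_def)
    next
      fix j assume j: "j \<in> {1..n}"
      consider "j = i" | "j = Suc i" | "j \<noteq> i" "j \<noteq> Suc i" by blast
      then show "finite (tail_swap b i C j)" "int (card (tail_swap b i C j)) = a ((v \<circ> swp i) j) - b j"
        using card_tail_swap[OF b m f(1,2)] f j C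
        by (cases, auto simp: swp_def tail_swap_nth(3)[OF b m] columns_def)+
    qed
  qed
  have U': "(\<forall>u\<in>U. meets b (tail_swap b i C) u) \<longleftrightarrow> (\<forall>u\<in>U. meets b C u)"
    if C: "C \<in> columns n (\<lambda>j. a (w j) - b j)" and m: "meets b C i" and w: "w (Suc (Suc i)) = Suc (Suc i)" for C w
  proof (rule ball_cong[OF refl])
    fix u assume u: "u \<in> U"
    show "meets b (tail_swap b i C) u = meets b C u"
    proof (cases "u = Suc i")
      case True
      then have "Suc (Suc i) \<in> {1..n}" using U[OF u] by auto
      then have "finite (C (Suc (Suc i)))" "b (Suc (Suc i)) + int (card (C (Suc (Suc i)))) < b i"
        using C w ab unfolding columns_def by auto
      then show ?thesis
        using meets_tail_swap_Suc[OF b m] True by blast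
    next
      case False
      then show ?thesis
        using U[OF u] by (intro meets_tail_swap_far[OF b m]) auto
    qed
  qed
  \<comment> \<open>With exchanged ends, path i starts above path i + 1 and finishes below
    it.\<close>
  have meet: "meets b C i" if C: "C \<in> columns n (\<lambda>j. a ((v \<circ> swp i) j) - b j)" for C
  proof -
    have f: "finite (C i)" "finite (C (Suc i))" "b i + int (card (C i)) = a (Suc i)"
      "b (Suc i) + int (card (C (Suc i))) = a (v i)"
      using C i v by (auto simp: columns_def swp_def)
    obtain N M where "\<forall>x\<ge>N. height b C i x = a (Suc i)" "\<forall>x\<ge>M. height b C (Suc i) x = a (v i)"
      using height_eventually[of C i b] height_eventually[of C "Suc i" b] f by auto
    then have "height b C i (max N M) = a (Suc i)" "height b C (Suc i) (max N M) = a (v i)"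
      by auto
    moreover have "a (Suc i) < a (v i)"
      using a[of "v i"] v i by simp
    ultimately show ?thesis
      unfolding meets_def by (metis less_imp_le)
  qed
  have sw: "v \<circ> swp i \<circ> swp i = v"
    by (simp add: fun_eq_iff swp_def)
  have w2: "(v \<circ> swp i) (Suc (Suc i)) = Suc (Suc i)"
    using v by (simp add: swp_def)
  show ?thesis
  proof (rule bij_betw_byWitness[where f' = "tail_swap b i"])
    show "\<forall>C\<in>path_tuples n a b v (insert i U) c. tail_swap b i (tail_swap b i C) = C"
      by (auto simp: path_tuples_def tail_swap_tail_swap[OF b])
    show "\<forall>C\<in>path_tuples n a b (v \<circ> swp i) U c. tail_swap b i (tail_swap b i C) = C"
      using meet by (auto simp: path_tuples_def tail_swap_tail_swap[OF b])
    show "tail_swap b i ` path_tuples n a b v (insert i U) c \<subseteq> path_tuples n a b (v \<circ> swp i) U c"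
    proof (rule image_subsetI)
      fix C assume C: "C \<in> path_tuples n a b v (insert i U) c"
      then have m: "meets b C i" and Cc: "C \<in> columns n (\<lambda>j. a (v j) - b j)"
        by (auto simp: path_tuples_def)
      show "tail_swap b i C \<in> path_tuples n a b (v \<circ> swp i) U c"
        using fwd[OF Cc m] U'[OF Cc m v(2)] C content_tail_swap[OF b m i(1,2)]
        by (simp add: path_tuples_def)
    qed
    show "tail_swap b i ` path_tuples n a b (v \<circ> swp i) U c \<subseteq> path_tuples n a b v (insert i U) c"
    proof (rule image_subsetI)
      fix C assume C: "C \<in> path_tuples n a b (v \<circ> swp i) U c"
      then have m: "meets b C i" using meet by (simp add: path_tuples_def)
      have Cc: "C \<in> columns n (\<lambda>j. a ((v \<circ> swp i) j) - b j)"
        using C by (simp add: path_tuples_def)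
      show "tail_swap b i C \<in> path_tuples n a b v (insert i U) c"
        using fwd[OF Cc m] U'[OF Cc m w2] C first_meet_tail_swap(2)[OF b m] content_tail_swap[OF b m i(1,2)]
        unfolding sw by (simp add: path_tuples_def)
    qed
  qed
qed


text \<open>Induction on the maximum \<open>i\<close> of \<open>S\<close>: while the smaller
  elements are traded for transpositions, \<open>i\<close> waits in \<open>U\<close>, and it is
  traded last. So at each swap all pending demands lie to the right, where they are
  preserved.\<close>

lemma hess_path_tuples_card:
  assumes a: "\<And>i j. 1 \<le> i \<Longrightarrow> i < j \<Longrightarrow> j \<le> n \<Longrightarrow> a j < a i"
    and b: "\<And>i. 1 \<le> i \<Longrightarrow> i < n \<Longrightarrow> b (Suc i) < b i"
    and ab: "\<And>i. 1 \<le> i \<Longrightarrow> Suc (Suc i) \<le> n \<Longrightarrow> a (Suc (Suc i)) < b i"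
    and S: "S \<subseteq> {1..<n}" and U: "U \<subseteq> {1..<n}" "\<And>s u. s \<in> S \<Longrightarrow> u \<in> U \<Longrightarrow> s < u"
  shows "card (path_tuples n a b id (S \<union> U) c) = card (path_tuples n a b (hess_inv S) U c)"
proof -
  have "finite S" using S finite_subset by blast
  then show ?thesis using S U
  proof (induction S arbitrary: U rule: finite_linorder_max_induct)
    case empty
    then show ?case by simp
  next
    case (insert i A)
    let ?v = "hess_inv A"
    have i: "1 \<le> i" "i < n" using insert.prems by auto
    have "A \<subseteq> {1..<i}" using insert.hyps insert.prems by auto
    then have v: "?v permutes {1..i}" by (rule hess_inv_permutes)
    have "bij_betw (tail_swap b i) (path_tuples n a b ?v (insert i U) c) (path_tuples n a b (?v \<circ> swp i) U c)"
      by (rule tail_swap_bij[where k = "Suc i"])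
        (use i a b ab insert.prems permutes_in_image[OF v, of i] permutes_not_in[OF v] in auto)
    then have "card (path_tuples n a b ?v (insert i U) c) = card (path_tuples n a b (?v \<circ> swp i) U c)"
      by (rule bij_betw_same_card)
    moreover have "card (path_tuples n a b id (A \<union> insert i U) c) = card (path_tuples n a b ?v (insert i U) c)"
      by (rule insert.IH) (use insert.prems insert.hyps in auto)
    moreover have "hess_inv (insert i A) = ?v \<circ> swp i"
      using insert.hyps by (intro hess_inv_insert) auto
    ultimately show ?case by (simp only: Un_insert_left Un_insert_right)
  qed
qed

section \<open>Bender--Knuth reflections\<close>

text \<open>\<open>Some False\<close> stands for a column with k but not k + 1,
  \<open>Some True\<close> for the converse, \<open>None\<close> for both or neither. The arguments
  \<open>u\<close> and \<open>d\<close> hold a pending run of \<open>u\<close> letters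
  \<open>Some False\<close> followed by \<open>d\<close> letters \<open>Some True\<close>, which is
  emitted with the two lengths exchanged. A run ends at \<open>None\<close> or at a descent, that is
  \<open>Some True\<close> directly followed by \<open>Some False\<close>. The two letters of a
  descent are frozen, because only there can a meeting depend on the order of k and k + 1.\<close>

fun bk :: "nat \<Rightarrow> nat \<Rightarrow> bool option list \<Rightarrow> bool option list" where
  "bk u d [] = replicate d (Some False) @ replicate u (Some True)"
| "bk u d (None # xs) = replicate d (Some False) @ replicate u (Some True) @ None # bk 0 0 xs"
| "bk u d (Some True # xs) = bk u (Suc d) xs"
| "bk u 0 (Some False # xs) = bk (Suc u) 0 xs"
| "bk u (Suc d) (Some False # xs) =
    replicate d (Some False) @ replicate u (Some True) @ Some True # Some False # bk 0 0 xs"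

lemma length_bk: "length (bk u d xs) = u + d + length xs"
  by (induction u d xs rule: bk.induct) auto

lemma bk_run_False: "bk u 0 (replicate e (Some False) @ xs) = bk (u + e) 0 xs"
  by (induction e arbitrary: u) auto

lemma bk_run_True: "bk u d (replicate e (Some True) @ xs) = bk u (d + e) xs"
  by (induction e arbitrary: d) auto

lemma bk_run: "bk 0 0 (replicate u (Some False) @ replicate d (Some True) @ xs) = bk u d xs"
  by (simp add: bk_run_False bk_run_True)

lemma bk_bk: "bk 0 0 (bk u d xs) = replicate u (Some False) @ replicate d (Some True) @ xs"
proof (induction u d xs rule: bk.induct)
  case (1 u d)
  show ?case using bk_run[of d u "[]"] by simp
next
  case (2 u d xs)
  then show ?case by (simp add: bk_run)
next
  case (3 u d xs)
  then show ?case by (simp add: replicate_app_Cons_same)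
next
  case (4 u xs)
  then show ?case by (simp add: replicate_app_Cons_same)
next
  case (5 u d xs)
  have "bk 0 0 (bk u (Suc d) (Some False # xs)) = bk d u (Some True # Some False # bk 0 0 xs)"
    by (subst bk.simps(5)) (rule bk_run)
  then show ?case using 5 by (simp add: replicate_app_Cons_same)
qed

lemma count_bk:
  "count_list (bk u d xs) (Some False) = d + count_list xs (Some True)"
  "count_list (bk u d xs) (Some True) = u + count_list xs (Some False)"
proof -
  have r: "count_list (replicate a x) y = (if x = y then a else 0)" for a and x y :: "bool option"
    by (induction a) auto
  show "count_list (bk u d xs) (Some False) = d + count_list xs (Some True)"
    "count_list (bk u d xs) (Some True) = u + count_list xs (Some False)"
    by (induction u d xs rule: bk.induct) (auto simp: r)
qed

lemma None_bk: "map (\<lambda>x. x = None) (bk u d xs) = replicate (u + d) False @ map (\<lambda>x. x = None) xs"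
  by (induction u d xs rule: bk.induct) (auto simp: replicate_add[symmetric] replicate_app_Cons_same add_ac)

fun adjacent_pairs :: "bool option list \<Rightarrow> bool list" where
  "adjacent_pairs (x # y # zs) = (x = Some True \<and> y = Some False) # adjacent_pairs (y # zs)"
| "adjacent_pairs _ = []"

lemma adjacent_pairs_nth:
  "Suc i < length xs \<Longrightarrow> adjacent_pairs xs ! i \<longleftrightarrow> xs ! i = Some True \<and> xs ! Suc i = Some False"
proof (induction xs arbitrary: i rule: adjacent_pairs.induct)
  case (1 x y zs)
  then show ?case by (cases i) auto
qed auto

lemma adjacent_pairs_Cons:
  "xs \<noteq> [] \<Longrightarrow> adjacent_pairs (x # xs) = (x = Some True \<and> hd xs = Some False) # adjacent_pairs xs"
  by (cases xs) auto

lemma adjacent_pairs_run: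
  assumes "xs \<noteq> []" "hd xs \<noteq> Some False"
  shows "adjacent_pairs (replicate a (Some False) @ replicate b (Some True) @ xs) = replicate (a + b) False @ adjacent_pairs xs"
proof -
  have "adjacent_pairs (replicate b (Some True) @ xs) = replicate b False @ adjacent_pairs xs
    \<and> (replicate b (Some True) @ xs) \<noteq> []"
  proof (induction b)
    case (Suc b)
    moreover have "hd (replicate b (Some True) @ xs) \<noteq> Some False"
      using assms by (cases b) auto
    ultimately show ?case by (simp add: adjacent_pairs_Cons)
  qed (use assms in simp)
  then show ?thesis
    by (induction a) (auto simp: adjacent_pairs_Cons)
qed

lemma adjacent_pairs_run_Nil:
  "adjacent_pairs (replicate a (Some False) @ replicate b (Some True)) = replicate (a + b - 1) False"
proof (cases b)
  case 0
  show ?thesis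
  proof (induction a)
    case (Suc a)
    then show ?case by (cases a) (auto simp: 0)
  qed (simp add: 0)
next
  case (Suc c)
  have "replicate b (Some True) = replicate c (Some True) @ [Some True]"
    by (simp add: Suc replicate_append_same)
  then show ?thesis
    using adjacent_pairs_run[of "[Some True]" a c] by (simp add: Suc)
qed

lemma adjacent_pairs_bk:
  "adjacent_pairs (bk u d xs) = adjacent_pairs (replicate u (Some False) @ replicate d (Some True) @ xs)"
proof (induction u d xs rule: bk.induct)
  case (1 u d)
  then show ?case by (simp add: adjacent_pairs_run_Nil add.commute)
next
  case (2 u d xs)
  have "bk 0 0 xs = [] \<longleftrightarrow> xs = []"
    using length_bk[of 0 0 xs] by (metis add_0 length_0_conv)
  then have "adjacent_pairs (None # bk 0 0 xs) = adjacent_pairs (None # xs)"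
    using 2 by (cases "xs = []") (auto simp: adjacent_pairs_Cons)
  then show ?case by (simp add: adjacent_pairs_run add.commute)
next
  case (3 u d xs)
  then show ?case by (simp add: replicate_app_Cons_same)
next
  case (4 u xs)
  then show ?case by (simp add: replicate_app_Cons_same)
next
  case (5 u d xs)
  have e: "bk 0 0 xs = [] \<longleftrightarrow> xs = []"
    using length_bk[of 0 0 xs] by (metis add_0 length_0_conv)
  then have "adjacent_pairs (Some False # bk 0 0 xs) = adjacent_pairs (Some False # xs)"
    using 5 by (cases "xs = []") (auto simp: adjacent_pairs_Cons)
  then have "adjacent_pairs (Some True # Some False # bk 0 0 xs) = adjacent_pairs (Some True # Some False # xs)"
    by simp
  then have "adjacent_pairs (bk u (Suc d) (Some False # xs))
    = adjacent_pairs (replicate u (Some False) @ replicate d (Some True) @ Some True # Some False # xs)"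
    by (simp add: adjacent_pairs_run add.commute)
  then show ?case by (simp add: replicate_app_Cons_same)
qed

section \<open>Reflections of column tuples\<close>

definition letter :: "nat \<Rightarrow> nat set \<Rightarrow> bool option" where
  "letter k A = (if (k \<in> A) = (Suc k \<in> A) then None else Some (Suc k \<in> A))"

definition set_letter :: "nat \<Rightarrow> bool option \<Rightarrow> nat set \<Rightarrow> nat set" where
  "set_letter k l A = (case l of None \<Rightarrow> A | Some False \<Rightarrow> insert k (A - {Suc k}) | Some True \<Rightarrow> insert (Suc k) (A - {k}))"

lemma letter_set_letter: "(l = None) = (letter k A = None) \<Longrightarrow> letter k (set_letter k l A) = l"
  by (auto simp: letter_def set_letter_def split: option.splits bool.splits if_splits)

lemma set_letter_undo: "(l = None) = (letter k A = None) \<Longrightarrow> set_letter k (letter k A) (set_letter k l A) = A"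
  by (auto simp: letter_def set_letter_def split: option.splits bool.splits if_splits)

lemma set_letter_outside: "x \<noteq> k \<Longrightarrow> x \<noteq> Suc k \<Longrightarrow> x \<in> set_letter k l A \<longleftrightarrow> x \<in> A"
  by (auto simp: set_letter_def split: option.splits bool.splits)

lemma finite_set_letter: "finite A \<Longrightarrow> finite (set_letter k l A)"
  by (auto simp: set_letter_def split: option.splits bool.splits)

lemma card_set_letter:
  assumes "finite A" "(l = None) = (letter k A = None)"
  shows "card (set_letter k l A) = card A"
proof (cases l)
  case (Some s)
  then have "(k \<in> A) \<noteq> (Suc k \<in> A)" using assms(2) by (auto simp: letter_def split: if_splits)
  moreover have "card (insert y (A - {x})) = card A" if "x \<in> A" "y \<notin> A" for x y
    using that assms(1) card_Suc_Diff1[OF assms(1) that(1)] by simp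
  moreover have "A - {x} = A" if "x \<notin> A" for x
    using that by blast
  ultimately show ?thesis
    using Some by (cases s; cases "k \<in> A") (auto simp: set_letter_def insert_absorb)
qed (simp add: set_letter_def)

definition letters :: "nat \<Rightarrow> nat \<Rightarrow> (nat \<Rightarrow> nat set) \<Rightarrow> bool option list" where
  "letters k j C = map (\<lambda>i. letter k (C i)) [1..<j]"

text \<open>Only the columns to the left of \<open>j\<close> are reflected. The value j = n + 1
  serves the symmetry of the generating functions, smaller values serve the cancellation.\<close>

definition bk_columns :: "nat \<Rightarrow> nat \<Rightarrow> (nat \<Rightarrow> nat set) \<Rightarrow> nat \<Rightarrow> nat set" where
  "bk_columns k j C i = (if i \<in> {1..<j} then set_letter k (bk 0 0 (letters k j C) ! (i - 1)) (C i) else C i)"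

lemma letters_nth: "i \<in> {1..<j} \<Longrightarrow> letters k j C ! (i - 1) = letter k (C i)"
  by (auto simp: letters_def nth_map nth_upt)

lemma bk_letters_None:
  assumes "i \<in> {1..<j}"
  shows "(bk 0 0 (letters k j C) ! (i - 1) = None) = (letter k (C i) = None)"
proof -
  have "i - 1 < length (letters k j C)" using assms by (auto simp: letters_def)
  then show ?thesis
    using arg_cong[OF None_bk[of 0 0 "letters k j C"], of "\<lambda>xs. xs ! (i - 1)"] letters_nth[OF assms, of k C]
    by (simp add: length_bk)
qed

lemma letter_bk_columns:
  "i \<in> {1..<j} \<Longrightarrow> letter k (bk_columns k j C i) = bk 0 0 (letters k j C) ! (i - 1)"
  using bk_letters_None[of i j k C] by (simp add: bk_columns_def letter_set_letter)

lemma letters_bk_columns: "letters k j (bk_columns k j C) = bk 0 0 (letters k j C)"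
proof (rule nth_equalityI)
  show "length (letters k j (bk_columns k j C)) = length (bk 0 0 (letters k j C))"
    by (simp add: length_bk letters_def)
  fix i assume "i < length (letters k j (bk_columns k j C))"
  then have "Suc i \<in> {1..<j}" by (auto simp: letters_def)
  then show "letters k j (bk_columns k j C) ! i = bk 0 0 (letters k j C) ! i"
    using letters_nth[of "Suc i" j k "bk_columns k j C"] letter_bk_columns[of "Suc i" j k C] by simp
qed

lemma bk_columns_bk_columns: "bk_columns k j (bk_columns k j C) = C"
proof
  fix i
  show "bk_columns k j (bk_columns k j C) i = C i"
  proof (cases "i \<in> {1..<j}")
    case True
    have "bk 0 0 (letters k j (bk_columns k j C)) = letters k j C"
      using bk_bk[of 0 0] by (simp add: letters_bk_columns)
    then have "bk_columns k j (bk_columns k j C) i = set_letter k (letter k (C i)) (bk_columns k j C i)"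
      using True letters_nth[OF True] by (simp add: bk_columns_def[of k j "bk_columns k j C"])
    then show ?thesis
      using True set_letter_undo[OF bk_letters_None[OF True]] by (simp add: bk_columns_def)
  next
    case False
    then show ?thesis by (auto simp: bk_columns_def)
  qed
qed

lemma bk_columns_ge: "j \<le> i \<Longrightarrow> bk_columns k j C i = C i"
  by (simp add: bk_columns_def)

lemma bk_columns_outside: "x \<noteq> k \<Longrightarrow> x \<noteq> Suc k \<Longrightarrow> x \<in> bk_columns k j C i \<longleftrightarrow> x \<in> C i"
  by (simp add: bk_columns_def set_letter_outside)

lemma finite_bk_columns: "finite (C i) \<Longrightarrow> finite (bk_columns k j C i)"
  by (simp add: bk_columns_def finite_set_letter)

lemma card_bk_columns: "finite (C i) \<Longrightarrow> card (bk_columns k j C i) = card (C i)"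
  using card_set_letter[OF _ bk_letters_None[of i j k C]] by (simp add: bk_columns_def)

lemma bk_columns_in_columns: "C \<in> columns n d \<Longrightarrow> j \<le> Suc n \<Longrightarrow> bk_columns k j C \<in> columns n d"
  by (auto simp: columns_def finite_bk_columns card_bk_columns) (auto simp: bk_columns_def)

lemma card_letters: "card {i \<in> {1..<j}. letter k (C i) = l} = count_list (letters k j C) l"
proof (induction j)
  case (Suc j)
  show ?case
  proof (cases "j = 0")
    case False
    then have "{i \<in> {1..<Suc j}. letter k (C i) = l}
      = (if letter k (C j) = l then insert j {i \<in> {1..<j}. letter k (C i) = l} else {i \<in> {1..<j}. letter k (C i) = l})"
      by (auto simp: less_Suc_eq)
    then show ?thesis
      using Suc False by (simp add: letters_def)
  qed (simp add: letters_def)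
qed (simp add: letters_def)

definition prefix_content :: "nat \<Rightarrow> (nat \<Rightarrow> nat set) \<Rightarrow> nat \<Rightarrow> nat" where
  "prefix_content j C x = card {i \<in> {1..<j}. x \<in> C i}"

lemma prefix_content_letters:
  "prefix_content j C k = card {i \<in> {1..<j}. k \<in> C i \<and> Suc k \<in> C i} + count_list (letters k j C) (Some False)"
  "prefix_content j C (Suc k) = card {i \<in> {1..<j}. k \<in> C i \<and> Suc k \<in> C i} + count_list (letters k j C) (Some True)"
proof -
  have 1: "{i \<in> {1..<j}. k \<in> C i} = {i \<in> {1..<j}. k \<in> C i \<and> Suc k \<in> C i} \<union> {i \<in> {1..<j}. letter k (C i) = Some False}"
    and 2: "{i \<in> {1..<j}. Suc k \<in> C i} = {i \<in> {1..<j}. k \<in> C i \<and> Suc k \<in> C i} \<union> {i \<in> {1..<j}. letter k (C i) = Some True}"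
    by (auto simp: letter_def)
  show "prefix_content j C k = card {i \<in> {1..<j}. k \<in> C i \<and> Suc k \<in> C i} + count_list (letters k j C) (Some False)"
    unfolding prefix_content_def 1 card_letters[symmetric]
    by (rule card_Un_disjoint) (auto simp: letter_def)
  show "prefix_content j C (Suc k) = card {i \<in> {1..<j}. k \<in> C i \<and> Suc k \<in> C i} + count_list (letters k j C) (Some True)"
    unfolding prefix_content_def 2 card_letters[symmetric]
    by (rule card_Un_disjoint) (auto simp: letter_def)
qed

lemma prefix_content_bk_columns:
  "prefix_content j (bk_columns k j C) x = prefix_content j C (Transposition.transpose k (Suc k) x)"
proof -
  have both: "{i \<in> {1..<j}. k \<in> bk_columns k j C i \<and> Suc k \<in> bk_columns k j C i}
    = {i \<in> {1..<j}. k \<in> C i \<and> Suc k \<in> C i}"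
  proof (rule Collect_cong, rule conj_cong[OF refl])
    fix i assume i: "i \<in> {1..<j}"
    show "(k \<in> bk_columns k j C i \<and> Suc k \<in> bk_columns k j C i) = (k \<in> C i \<and> Suc k \<in> C i)"
      using bk_letters_None[OF i, of k C] i unfolding bk_columns_def
      by (auto simp: set_letter_def letter_def split: option.splits bool.splits if_splits)
  qed
  consider "x = k" | "x = Suc k" | "x \<noteq> k" "x \<noteq> Suc k" by blast
  then show ?thesis
  proof cases
    case 1
    then show ?thesis
      using prefix_content_letters[of j C k] prefix_content_letters[of j "bk_columns k j C" k]
      unfolding both by (simp add: letters_bk_columns count_bk)
  next
    case 2
    then show ?thesis
      using prefix_content_letters[of j C k] prefix_content_letters[of j "bk_columns k j C" k]
      unfolding both by (simp add: letters_bk_columns count_bk)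
  next
    case 3
    then show ?thesis
      by (simp add: prefix_content_def bk_columns_outside)
  qed
qed

text \<open>The gap can be positive at times k and k + 2 but not at k + 1 only if it drops at k and
  rises at k + 1. This puts k into the right column alone and k + 1 into the left column alone,
  which is a descent.\<close>

lemma meets_off_middle:
  assumes "letter k (C i) \<noteq> Some True \<or> letter k (C (Suc i)) \<noteq> Some False"
  shows "meets b C i \<longleftrightarrow> (\<exists>x. x \<noteq> Suc k \<and> height b C i x \<le> height b C (Suc i) x)"
proof
  assume "meets b C i"
  then obtain x where x: "height b C i x \<le> height b C (Suc i) x"
    by (auto simp: meets_def)
  show "\<exists>x. x \<noteq> Suc k \<and> height b C i x \<le> height b C (Suc i) x"
  proof (cases "x = Suc k")
    case True
    have "height b C i k \<le> height b C (Suc i) k \<or> height b C i (Suc (Suc k)) \<le> height b C (Suc i) (Suc (Suc k))"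
      using x assms unfolding True height_Suc
      by (cases "k \<in> C i"; cases "k \<in> C (Suc i)"; cases "Suc k \<in> C i"; cases "Suc k \<in> C (Suc i)")
        (auto simp: letter_def)
    then show ?thesis
      by (elim disjE) (auto intro: exI[of _ k] exI[of _ "Suc (Suc k)"])
  qed (use x in blast)
qed (auto simp: meets_def)

lemma height_bk_columns:
  assumes "finite (C i)" "x \<noteq> Suc k"
  shows "height b (bk_columns k j C) i x = height b C i x"
proof -
  have "card (bk_columns k j C i \<inter> {..<x}) = card (C i \<inter> {..<x})"
  proof (cases "x \<le> k")
    case True
    then have "bk_columns k j C i \<inter> {..<x} = C i \<inter> {..<x}"
      by (auto simp: bk_columns_outside)
    then show ?thesis by simp
  next
    case False
    then have x: "Suc (Suc k) \<le> x" using assms(2) by simp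
    have split: "card A = card (A \<inter> {..<x}) + card (A - {..<x})" if "finite A" for A :: "nat set"
      using that by (metis Int_Diff_Un Int_Diff_disjoint card_Un_disjoint finite_Diff finite_Int)
    have "bk_columns k j C i - {..<x} = C i - {..<x}"
      using x by (auto simp: bk_columns_outside)
    then show ?thesis
      using split[OF assms(1)] split[OF finite_bk_columns[of C i k j]]
        card_bk_columns[of C i k j] assms(1) by simp
  qed
  then show ?thesis by (simp add: height_def)
qed

text \<open>If neither the old nor the new letters have a descent at i, meetings can be tested away
  from time k + 1, where the heights are unchanged. If one of them has a descent, both have it and
  the two columns are frozen. At the border, \<open>bd\<close> prevents column \<open>j\<close> from
  being the right half of a descent.\<close>

lemma meets_bk_columns:
  assumes fin: "finite (C i)" "finite (C (Suc i))" and i: "1 \<le> i"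
    and bd: "Suc i = j \<Longrightarrow> letter k (C j) = Some True"
  shows "meets b (bk_columns k j C) i = meets b C i"
proof (cases "letter k (C i) = Some True \<and> letter k (C (Suc i)) = Some False
    \<or> letter k (bk_columns k j C i) = Some True \<and> letter k (bk_columns k j C (Suc i)) = Some False")
  case False
  then have "meets b (bk_columns k j C) i \<longleftrightarrow> (\<exists>x. x \<noteq> Suc k \<and> height b (bk_columns k j C) i x \<le> height b (bk_columns k j C) (Suc i) x)"
    "meets b C i \<longleftrightarrow> (\<exists>x. x \<noteq> Suc k \<and> height b C i x \<le> height b C (Suc i) x)"
    by (intro meets_off_middle; blast)+
  then show ?thesis
    using height_bk_columns fin by metis
next
  case True
  have "bk_columns k j C i = C i \<and> bk_columns k j C (Suc i) = C (Suc i)"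
  proof (cases "Suc i < j")
    case lt: True
    have m: "i \<in> {1..<j}" "Suc i \<in> {1..<j}" using i lt by auto
    have "Suc (i - 1) < length (letters k j C)" "Suc (i - 1) < length (bk 0 0 (letters k j C))"
      using i lt by (auto simp: letters_def length_bk)
    then have "bk 0 0 (letters k j C) ! (i - 1) = Some True \<and> bk 0 0 (letters k j C) ! (Suc i - 1) = Some False
      \<longleftrightarrow> letters k j C ! (i - 1) = Some True \<and> letters k j C ! (Suc i - 1) = Some False"
      using adjacent_pairs_nth[of "i - 1" "letters k j C"] adjacent_pairs_bk[of 0 0 "letters k j C"] i
        adjacent_pairs_nth[of "i - 1" "bk 0 0 (letters k j C)"] by simp
    then have "letter k (C i) = Some True \<and> letter k (C (Suc i)) = Some False
      \<and> bk 0 0 (letters k j C) ! (i - 1) = Some True \<and> bk 0 0 (letters k j C) ! (Suc i - 1) = Some False"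
      using True letter_bk_columns[OF m(1), of k C] letter_bk_columns[OF m(2), of k C]
        letters_nth[OF m(1), of k C] letters_nth[OF m(2), of k C] by metis
    then show ?thesis
      using m by (auto simp: bk_columns_def set_letter_def letter_def split: if_splits)
  next
    case False
    then have "Suc i \<noteq> j" using True bd by (auto simp: bk_columns_ge)
    then show ?thesis using False by (simp add: bk_columns_ge)
  qed
  then show ?thesis by (simp add: meets_def height_def)
qed

section \<open>Ballot condition and cancellation\<close>

text \<open>The two kinds of reflection used below: of all columns, and of the columns to the left
  of a column with letter \<open>Some True\<close>, as it occurs where the ballot condition
  fails.\<close>

definition bk_closed :: "nat \<Rightarrow> (nat \<Rightarrow> nat set) set \<Rightarrow> bool" where
  "bk_closed n X \<longleftrightarrow> (\<forall>C\<in>X. \<forall>k j. 1 \<le> j \<longrightarrow> j \<le> Suc n \<longrightarrow>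
     (j = Suc n \<or> letter k (C j) = Some True) \<longrightarrow> bk_columns k j C \<in> X)"

lemma bk_closedD:
  "bk_closed n X \<Longrightarrow> C \<in> X \<Longrightarrow> 1 \<le> j \<Longrightarrow> j \<le> Suc n \<Longrightarrow> j = Suc n \<or> letter k (C j) = Some True
    \<Longrightarrow> bk_columns k j C \<in> X"
  unfolding bk_closed_def by blast

lemma bk_closed_meets:
  "bk_closed n {C \<in> columns n d. {i \<in> {1..<n}. meets b C i} = U}"
  unfolding bk_closed_def
proof (intro ballI allI impI)
  fix C k j
  assume C: "C \<in> {C \<in> columns n d. {i \<in> {1..<n}. meets b C i} = U}" and j: "1 \<le> j" "j \<le> Suc n"
    "j = Suc n \<or> letter k (C j) = Some True"
  have "meets b (bk_columns k j C) i = meets b C i" if "i \<in> {1..<n}" for i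
    by (rule meets_bk_columns) (use C that j in \<open>auto simp: columns_def\<close>)
  then have "{i \<in> {1..<n}. meets b (bk_columns k j C) i} = {i \<in> {1..<n}. meets b C i}"
    by blast
  then show "bk_columns k j C \<in> {C \<in> columns n d. {i \<in> {1..<n}. meets b C i} = U}"
    using C j by (simp add: bk_columns_in_columns)
qed

definition suffix_content :: "nat \<Rightarrow> nat \<Rightarrow> (nat \<Rightarrow> nat set) \<Rightarrow> nat \<Rightarrow> nat" where
  "suffix_content n j C x = card {i \<in> {j..n}. x \<in> C i}"

lemma content_split:
  assumes "1 \<le> j" "j \<le> Suc n"
  shows "content n C x = prefix_content j C x + suffix_content n j C x"
proof -
  have "{i \<in> {1..n}. x \<in> C i} = {i \<in> {1..<j}. x \<in> C i} \<union> {i \<in> {j..n}. x \<in> C i}"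
    using assms by auto
  then show ?thesis
    unfolding content_def prefix_content_def suffix_content_def
    by (subst card_Un_disjoint[symmetric]) auto
qed

lemma suffix_content_Suc:
  assumes "j \<le> n"
  shows "suffix_content n j C x = of_bool (x \<in> C j) + suffix_content n (Suc j) C x"
proof -
  have "{i \<in> {j..n}. x \<in> C i} = (if x \<in> C j then insert j {i \<in> {Suc j..n}. x \<in> C i} else {i \<in> {Suc j..n}. x \<in> C i})"
    using assms by (auto simp: Suc_le_eq le_eq_less_or_eq)
  then show ?thesis
    by (simp add: suffix_content_def)
qed

text \<open>The Yamanouchi condition for reading the columns from right to left.\<close>

definition highest :: "nat \<Rightarrow> (nat \<Rightarrow> nat set) \<Rightarrow> bool" where
  "highest n C \<longleftrightarrow> (\<forall>j k. 1 \<le> j \<longrightarrow> j \<le> n \<longrightarrow> suffix_content n j C (Suc k) \<le> suffix_content n j C k)"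

definition bad_at :: "nat \<Rightarrow> (nat \<Rightarrow> nat set) \<Rightarrow> nat \<Rightarrow> nat \<Rightarrow> bool" where
  "bad_at n C j k \<longleftrightarrow> 1 \<le> j \<and> j \<le> n \<and> suffix_content n j C k < suffix_content n j C (Suc k)"

definition bad_col :: "nat \<Rightarrow> (nat \<Rightarrow> nat set) \<Rightarrow> nat" where
  "bad_col n C = (GREATEST j. \<exists>k. bad_at n C j k)"

definition bad_val :: "nat \<Rightarrow> (nat \<Rightarrow> nat set) \<Rightarrow> nat" where
  "bad_val n C = (LEAST k. bad_at n C (bad_col n C) k)"

lemma bad_exists:
  assumes "\<not> highest n C"
  shows "bad_at n C (bad_col n C) (bad_val n C)"
    and "bad_col n C < j \<Longrightarrow> \<not> bad_at n C j k"
proof -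
  have ex: "\<exists>j k. bad_at n C j k"
    using assms by (auto simp: highest_def bad_at_def not_le)
  have bnd: "\<And>j. \<exists>k. bad_at n C j k \<Longrightarrow> j \<le> n"
    by (auto simp: bad_at_def)
  have "\<exists>k. bad_at n C (bad_col n C) k"
    unfolding bad_col_def using ex bnd by (rule GreatestI_ex_nat)
  then show "bad_at n C (bad_col n C) (bad_val n C)"
    unfolding bad_val_def by (rule LeastI_ex)
  show "bad_col n C < j \<Longrightarrow> \<not> bad_at n C j k"
    using Greatest_le_nat[of "\<lambda>j. \<exists>k. bad_at n C j k" j n] bnd unfolding bad_col_def by fastforce
qed

text \<open>The next column does not fail, and one column changes the difference of two counts by at
  most one. So at the last failing column the excess is exactly 1, and this column contains k + 1
  but not k.\<close>

lemma bad_letter: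
  assumes "\<not> highest n C"
  defines "j \<equiv> bad_col n C" and "k \<equiv> bad_val n C"
  shows "1 \<le> j" "j \<le> n" "letter k (C j) = Some True"
    "suffix_content n j C (Suc k) = Suc (suffix_content n j C k)"
proof -
  have b: "bad_at n C j k" and nb: "\<not> bad_at n C (Suc j) k"
    using bad_exists[OF assms(1)] by (auto simp: j_def k_def)
  show j: "1 \<le> j" "j \<le> n" using b by (auto simp: bad_at_def)
  have "suffix_content n (Suc j) C (Suc k) \<le> suffix_content n (Suc j) C k"
  proof (cases "Suc j \<le> n")
    case True
    then show ?thesis using nb by (simp add: bad_at_def)
  qed (simp add: suffix_content_def)
  then have "k \<notin> C j \<and> Suc k \<in> C j \<and> suffix_content n j C (Suc k) = Suc (suffix_content n j C k)"
    using b suffix_content_Suc[OF j(2), of C k] suffix_content_Suc[OF j(2), of C "Suc k"]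
    by (cases "k \<in> C j"; cases "Suc k \<in> C j") (auto simp: bad_at_def)
  then show "letter k (C j) = Some True" "suffix_content n j C (Suc k) = Suc (suffix_content n j C k)"
    by (auto simp: letter_def)
qed

definition reflect :: "nat \<Rightarrow> (nat \<Rightarrow> nat set) \<Rightarrow> nat \<Rightarrow> nat set" where
  "reflect n C = bk_columns (bad_val n C) (bad_col n C) C"

lemma suffix_content_reflect: "bad_col n C \<le> j \<Longrightarrow> suffix_content n j (reflect n C) = suffix_content n j C"
  unfolding suffix_content_def reflect_def
  by (intro ext arg_cong[of _ _ card] Collect_cong conj_cong) (auto simp: bk_columns_ge)

text \<open>The failure is located from the right, and the columns from the bad one on are left
  alone, so it is found again at the same place.\<close>

lemma reflect_bad:
  assumes "\<not> highest n C"
  shows "bad_col n (reflect n C) = bad_col n C" "bad_val n (reflect n C) = bad_val n C" "\<not> highest n (reflect n C)"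
proof -
  have same: "bad_at n (reflect n C) j k = bad_at n C j k" if "bad_col n C \<le> j" for j k
    using suffix_content_reflect[OF that] by (simp add: bad_at_def)
  have b: "bad_at n (reflect n C) (bad_col n C) (bad_val n C)"
    using same bad_exists(1)[OF assms] by simp
  then show nh: "\<not> highest n (reflect n C)"
    by (auto simp: highest_def bad_at_def not_le)
  have "\<not> bad_col n (reflect n C) < bad_col n C"
    using bad_exists(2)[OF nh] b by blast
  moreover have "\<not> bad_col n C < bad_col n (reflect n C)"
    using bad_exists(1)[OF nh] bad_exists(2)[OF assms] same by (meson less_imp_le)
  ultimately show c: "bad_col n (reflect n C) = bad_col n C"
    by simp
  show "bad_val n (reflect n C) = bad_val n C"
  proof -
    have "bad_at n (reflect n C) (bad_col n C) = bad_at n C (bad_col n C)"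
      by (intro ext same order_refl)
    then show ?thesis
      by (simp add: bad_val_def c)
  qed
qed

lemma reflect_reflect: "\<not> highest n C \<Longrightarrow> reflect n (reflect n C) = C"
  unfolding reflect_def[of n "reflect n C"] using reflect_bad
  by (simp add: reflect_def bk_columns_bk_columns)

lemma reflect_in:
  assumes "bk_closed n X" "C \<in> X" "\<not> highest n C"
  shows "reflect n C \<in> X"
  unfolding reflect_def using bad_letter[OF assms(3)]
  by (intro bk_closedD[OF assms(1,2)]) auto

text \<open>In the fixed suffix, k + 1 is ahead of k by exactly one. This one turns the exchange of
  the prefix contents of k and k + 1 into an exchange of the values content x - x, in accordance
  with \<open>shifted\<close>.\<close>

lemma content_reflect:
  assumes "\<not> highest n C"
  defines "k \<equiv> bad_val n C"
  shows "int (content n (reflect n C) x) - int x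
    = int (content n C (Transposition.transpose k (Suc k) x)) - int (Transposition.transpose k (Suc k) x)"
proof -
  let ?j = "bad_col n C"
  note b = bad_letter[OF assms(1), folded k_def]
  have j: "1 \<le> ?j" "?j \<le> Suc n" using b by auto
  have c: "content n (reflect n C) x = prefix_content ?j C (Transposition.transpose k (Suc k) x) + suffix_content n ?j C x" for x
    using content_split[OF j, of "reflect n C" x] suffix_content_reflect[of n C ?j]
      prefix_content_bk_columns[of ?j k C x] by (simp add: reflect_def k_def)
  consider "x = k" | "x = Suc k" | "x \<noteq> k" "x \<noteq> Suc k" by blast
  then show ?thesis
    unfolding c content_split[OF j, of C] using b(4) by cases auto
qed

lemma finite_with_content:
  assumes "X \<subseteq> columns n d"
  shows "finite {C \<in> X. \<forall>x. int (content n C x) = \<alpha> x}"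
proof (cases "{C \<in> X. \<forall>x. int (content n C x) = \<alpha> x} = {}")
  case False
  \<comment> \<open>The weight determines which entries occur, so the entries of a single tuple
    bound those of all others.\<close>
  then obtain C0 where C0: "C0 \<in> X" "\<And>x. int (content n C0 x) = \<alpha> x" by blast
  define F where "F = (\<Union>i\<in>{1..n}. C0 i)"
  have "finite F" using C0 assms by (auto simp: F_def columns_def)
  have "C \<in> {C. \<forall>i. (i \<in> {1..n} \<longrightarrow> C i \<in> Pow F) \<and> (i \<notin> {1..n} \<longrightarrow> C i = {})}"
    if C: "C \<in> {C \<in> X. \<forall>x. int (content n C x) = \<alpha> x}" for C
  proof -
    have "x \<in> F" if "x \<in> C i" "i \<in> {1..n}" for x i
    proof -
      have "content n C x = content n C0 x" using C C0 by (metis (mono_tags, lifting) mem_Collect_eq of_nat_eq_iff)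
      moreover have "content n C x > 0" using that by (auto simp: content_def card_gt_0_iff)
      ultimately show ?thesis by (auto simp: content_def card_gt_0_iff F_def)
    qed
    then show ?thesis using C assms by (auto simp: columns_def)
  qed
  then show ?thesis
    by (intro finite_subset[OF _ finite_set_of_finite_funs[of "{1..n}" "Pow F" "{}"]]) (auto simp: \<open>finite F\<close>)
next
  case True
  show ?thesis
    unfolding True by simp
qed

text \<open>A Kostka-type number, the coefficient of a monomial. Weights are integer valued because
  shifted weights may be negative; they then count nothing.\<close>

definition kcount :: "nat \<Rightarrow> (nat \<Rightarrow> nat set) set \<Rightarrow> (nat \<Rightarrow> int) \<Rightarrow> int" where
  "kcount n X \<alpha> = int (card {C \<in> X. \<forall>x. int (content n C x) = \<alpha> x})"

text \<open>The dot action \<pi>(\<nu> + \<rho>) - \<rho> with \<rho>(x) = -x.\<close>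

definition shifted :: "(nat \<Rightarrow> int) \<Rightarrow> (nat \<Rightarrow> nat) \<Rightarrow> nat \<Rightarrow> int" where
  "shifted \<nu> \<pi> x = \<nu> (\<pi> x) - int (\<pi> x) + int x"

lemma strict_mono_permutes_id:
  fixes \<pi> :: "nat \<Rightarrow> nat"
  assumes p: "\<pi> permutes S" and m: "strict_mono \<pi>"
  shows "\<pi> = id"
proof -
  have "x \<le> \<pi> x" for x
    using m by (rule strict_mono_imp_increasing)
  moreover have "strict_mono (inv \<pi>)"
    using m permutes_surj[OF p] by (metis strict_mono_inv_on_range strict_mono_on_def strict_mono_def surj_def UNIV_I strict_mono_less inv_f_f surj_f_inv_f)
  then have "x \<le> inv \<pi> x" for x
    by (rule strict_mono_imp_increasing)
  then have "\<pi> x \<le> x" for x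
    using permutes_inverses(2)[OF p, of x] by metis
  ultimately show ?thesis by (auto simp: fun_eq_iff intro: antisym)
qed

text \<open>Stembridge's cancellation: the non-highest tuples cancel in pairs by reflecting the columns
  to the left of the last column at which the ballot condition fails.\<close>

lemma signed_kcount:
  assumes X: "bk_closed n X" "X \<subseteq> columns n d"
    and anti: "\<And>x. \<nu> (Suc x) \<le> \<nu> x" and supp: "\<And>x. x \<ge> N \<Longrightarrow> \<nu> x = 0"
  shows "(\<Sum>\<pi> | \<pi> permutes {..<N}. sign \<pi> * kcount n X (shifted \<nu> \<pi>))
    = int (card {C \<in> X. highest n C \<and> (\<forall>x. int (content n C x) = \<nu> x)})"
proof -
  define Perms where "Perms = {\<pi> :: nat \<Rightarrow> nat. \<pi> permutes {..<N}}"
  define F where "F = (\<lambda>\<pi>. {C \<in> X. \<forall>x. int (content n C x) = shifted \<nu> \<pi> x})"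
  define bad where "bad = {p \<in> Sigma Perms F. \<not> highest n (snd p)}"
  define good where "good = {p \<in> Sigma Perms F. highest n (snd p)}"
  have fin: "finite Perms" "\<And>\<pi>. finite (F \<pi>)"
    unfolding Perms_def F_def using finite_with_content[OF X(2)] by (auto intro: finite_permutations)
  then have finS: "finite (Sigma Perms F)" by auto
  have "(\<Sum>\<pi> | \<pi> permutes {..<N}. sign \<pi> * kcount n X (shifted \<nu> \<pi>)) = (\<Sum>\<pi>\<in>Perms. \<Sum>C\<in>F \<pi>. sign \<pi>)"
    by (intro sum.cong) (auto simp: Perms_def F_def kcount_def)
  also have "\<dots> = (\<Sum>p\<in>Sigma Perms F. sign (fst p))"
    using fin by (subst sum.Sigma) (auto intro: sum.cong)
  also have "\<dots> = (\<Sum>p\<in>good \<union> bad. sign (fst p))"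
    by (intro sum.cong) (auto simp: good_def bad_def)
  also have "\<dots> = (\<Sum>p\<in>good. sign (fst p)) + (\<Sum>p\<in>bad. sign (fst p))"
    using finS by (intro sum.union_disjoint) (auto simp: good_def bad_def)
  also have "(\<Sum>p\<in>bad. sign (fst p)) = 0"
  proof -
    \<comment> \<open>The transposition is composed on the right of \<pi> since this is the effect
      of the reflection on the content according to \<open>content_reflect\<close>.\<close>
    define f where "f = (\<lambda>p :: (nat \<Rightarrow> nat) \<times> (nat \<Rightarrow> nat set).
      (fst p \<circ> Transposition.transpose (bad_val n (snd p)) (Suc (bad_val n (snd p))), reflect n (snd p)))"
    have in_bad: "f p \<in> bad" and sgn: "sign (fst (f p)) = - sign (fst p)" and inv: "f (f p) = p"
      if p: "p \<in> bad" for p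
    proof -
      obtain \<pi> C where pC: "p = (\<pi>, C)" by (cases p)
      let ?k = "bad_val n C"
      let ?t = "Transposition.transpose ?k (Suc ?k)"
      have \<pi>: "\<pi> permutes {..<N}" and C: "C \<in> X" and cont: "\<And>x. int (content n C x) = shifted \<nu> \<pi> x" and nh: "\<not> highest n C"
        using p by (auto simp: bad_def Perms_def F_def pC)
      \<comment> \<open>The entry k + 1 occurs in the bad column, while the content vanishes from N
        on; so the transposition stays within {..<N}.\<close>
      have "Suc ?k < N"
      proof (rule ccontr)
        assume ge: "\<not> Suc ?k < N"
        then have "shifted \<nu> \<pi> (Suc ?k) = 0"
          using permutes_not_in[OF \<pi>, of "Suc ?k"] supp[of "Suc ?k"] by (simp add: shifted_def)
        then have "content n C (Suc ?k) = 0" using cont[of "Suc ?k"] by simp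
        moreover have "bad_col n C \<in> {1..n}" "Suc ?k \<in> C (bad_col n C)"
          using bad_letter[OF nh] by (auto simp: letter_def split: if_splits)
        ultimately show False by (auto simp: content_def)
      qed
      then have t: "?t permutes {..<N}" by (intro permutes_swap_id) auto
      have "int (content n (reflect n C) x) = shifted \<nu> (\<pi> \<circ> ?t) x" for x
        using content_reflect[OF nh, of x] cont[of "?t x"] by (simp add: shifted_def)
      then show "f p \<in> bad"
        using permutes_compose[OF t \<pi>] reflect_in[OF X(1) C nh] reflect_bad[OF nh]
        by (simp add: bad_def f_def pC Perms_def F_def)
      have "permutation \<pi>"
        by (rule permutes_imp_permutation[OF _ \<pi>]) simp
      then show "sign (fst (f p)) = - sign (fst p)"
        by (simp add: f_def pC sign_compose permutation_swap_id sign_swap_id del: comp_apply)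
      show "f (f p) = p"
        by (simp add: f_def pC reflect_bad[OF nh] reflect_reflect[OF nh] fun_eq_iff)
    qed
    have "(\<Sum>p\<in>bad. sign (fst p)) = (\<Sum>p\<in>bad. sign (fst (f p)))"
      by (rule sum.reindex_bij_witness[of _ f f]) (use in_bad inv in auto)
    also have "\<dots> = - (\<Sum>p\<in>bad. sign (fst p))"
      using sgn by (simp add: sum_negf)
    finally show ?thesis by simp
  qed
  also have "good = {id} \<times> {C \<in> X. highest n C \<and> (\<forall>x. int (content n C x) = \<nu> x)}"
  proof -
    have "\<pi> = id" if "(\<pi>, C) \<in> good" for \<pi> C
    proof -
      have \<pi>: "\<pi> permutes {..<N}" and cont: "\<And>x. int (content n C x) = shifted \<nu> \<pi> x" and h: "highest n C"
        using that by (auto simp: good_def Perms_def F_def)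
      have cs: "content n C (Suc x) \<le> content n C x" for x
      proof (cases "n = 0")
        case False
        have "prefix_content 1 C = (\<lambda>_. 0)" by (auto simp: prefix_content_def)
        then have "content n C = suffix_content n 1 C"
          using content_split[of 1 n C] by auto
        then show ?thesis using h False by (simp add: highest_def)
      qed (simp add: content_def)
      \<comment> \<open>This is -(\<nu> + \<rho>), which is strictly increasing. The content x - g
        (\<pi> x) of a highest tuple is antitone, so \<open>g\<close> strictly increases along
        \<pi>, and \<pi> itself is increasing.\<close>
      define g where "g = (\<lambda>y. int y - \<nu> y)"
      have g: "strict_mono g"
        unfolding strict_mono_Suc_iff g_def using anti by (smt (verit) of_nat_Suc)
      have "g (\<pi> x) < g (\<pi> (Suc x))" for x
        using cont[of x] cont[of "Suc x"] cs[of x] unfolding g_def shifted_def by simp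
      then have "strict_mono \<pi>"
        unfolding strict_mono_Suc_iff using strict_mono_less[OF g] by blast
      then show "\<pi> = id" by (rule strict_mono_permutes_id[OF \<pi>])
    qed
    moreover have "shifted \<nu> id = \<nu>" by (auto simp: shifted_def)
    ultimately show ?thesis
      using permutes_id[of "{..<N}"] by (force simp: good_def Perms_def F_def)
  qed
  also have "(\<Sum>p\<in>{id} \<times> {C \<in> X. highest n C \<and> (\<forall>x. int (content n C x) = \<nu> x)}. sign (fst p))
      = int (card {C \<in> X. highest n C \<and> (\<forall>x. int (content n C x) = \<nu> x)})"
    by (subst sum.cong[OF refl, of _ _ "\<lambda>_. 1"]) (auto simp: card_cartesian_product_singleton)
  finally show ?thesis by simp
qed

text \<open>Reflecting all columns leaves no fixed suffix, and the contents of k and k + 1 are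
  exchanged outright.\<close>

lemma kcount_swap:
  assumes X: "bk_closed n X" "X \<subseteq> columns n d"
  shows "kcount n X (\<alpha> \<circ> Transposition.transpose k (Suc k)) = kcount n X \<alpha>"
proof -
  let ?t = "Transposition.transpose k (Suc k)"
  have c: "content n (bk_columns k (Suc n) C) x = content n C (?t x)" for C x
    using content_split[of "Suc n" n] prefix_content_bk_columns[of "Suc n" k C x]
    by (simp add: suffix_content_def)
  have "bij_betw (bk_columns k (Suc n)) {C \<in> X. \<forall>x. int (content n C x) = \<alpha> x} {C \<in> X. \<forall>x. int (content n C x) = (\<alpha> \<circ> ?t) x}"
    by (rule bij_betw_byWitness[where f' = "bk_columns k (Suc n)"])
      (use bk_closedD[OF X(1)] in \<open>auto simp: c bk_columns_bk_columns\<close>)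
  then show ?thesis
    unfolding kcount_def by (simp add: bij_betw_same_card)
qed

section \<open>Expansion in straight shapes\<close>

lemma shifted_sum:
  assumes "\<pi> permutes {..<N}"
  shows "(\<Sum>x<N. shifted \<nu> \<pi> x) = (\<Sum>x<N. \<nu> x)"
  unfolding shifted_def sum.distrib sum_subtractf
  using sum.permute[OF assms, of \<nu>] sum.permute[OF assms, of int] by (simp add: comp_def)

text \<open>The partial sums \<open>S\<close> of an antitone sequence are concave, hence
  \<open>\<nu> y * (x - y) \<ge> S x - S y\<close>; summing over \<open>y = \<pi> x\<close> shows that the shift increases the
  sum of squares.\<close>

lemma shifted_sum_squares:
  assumes p: "\<pi> permutes {..<N}" and ne: "\<pi> \<noteq> id" and anti: "\<And>x. \<nu> (Suc x) \<le> (\<nu> x :: int)"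
  shows "(\<Sum>x<N. \<nu> x * \<nu> x) < (\<Sum>x<N. shifted \<nu> \<pi> x * shifted \<nu> \<pi> x)"
proof -
  have mono: "x \<le> y \<Longrightarrow> \<nu> y \<le> \<nu> x" for x y
    using anti by (rule lift_Suc_antimono_le)
  define S where "S = (\<lambda>x. \<Sum>z<x. \<nu> z)"
  have conc: "S x - S y \<le> \<nu> y * (int x - int y)" for x y
  proof (cases "y \<le> x")
    case True
    have "S x - S y = (\<Sum>z=y..<x. \<nu> z)"
      unfolding S_def using True sum.atLeastLessThan_concat[of 0 y x \<nu>] by (simp add: lessThan_atLeast0)
    also have "\<dots> \<le> (\<Sum>z=y..<x. \<nu> y)"
      by (intro sum_mono mono) auto
    finally show ?thesis using True by (simp add: of_nat_diff mult.commute)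
  next
    case False
    then have le: "x \<le> y" by simp
    have "S y - S x = (\<Sum>z=x..<y. \<nu> z)"
      unfolding S_def using le sum.atLeastLessThan_concat[of 0 x y \<nu>] by (simp add: lessThan_atLeast0)
    moreover have "(\<Sum>z=x..<y. \<nu> y) \<le> (\<Sum>z=x..<y. \<nu> z)"
      by (intro sum_mono mono) auto
    ultimately show ?thesis using le by (simp add: of_nat_diff algebra_simps)
  qed
  have "0 = (\<Sum>x<N. S x - S (\<pi> x))"
    unfolding sum_subtractf using sum.permute[OF p, of S] by (simp add: comp_def)
  also have "\<dots> \<le> (\<Sum>x<N. \<nu> (\<pi> x) * (int x - int (\<pi> x)))"
    by (intro sum_mono conc)
  finally have 1: "0 \<le> (\<Sum>x<N. \<nu> (\<pi> x) * (int x - int (\<pi> x)))" .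
  obtain x where "\<pi> x \<noteq> x" using ne by (auto simp: fun_eq_iff)
  then have "x < N" using permutes_not_in[OF p, of x] by auto
  then have "0 < (\<Sum>x<N. (int x - int (\<pi> x)) * (int x - int (\<pi> x)))"
    using \<open>\<pi> x \<noteq> x\<close> by (intro sum_pos2[of _ x]) (auto simp: zero_less_mult_iff)
  moreover have "(\<Sum>x<N. \<nu> x * \<nu> x) = (\<Sum>x<N. \<nu> (\<pi> x) * \<nu> (\<pi> x))"
    using sum.permute[OF p, of "\<lambda>x. \<nu> x * \<nu> x"] by (simp add: comp_def)
  moreover have "(\<Sum>x<N. shifted \<nu> \<pi> x * shifted \<nu> \<pi> x) = (\<Sum>x<N. \<nu> (\<pi> x) * \<nu> (\<pi> x))
    + (\<Sum>x<N. (int x - int (\<pi> x)) * (int x - int (\<pi> x))) + 2 * (\<Sum>x<N. \<nu> (\<pi> x) * (int x - int (\<pi> x)))"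
    unfolding sum_distrib_left sum.distrib[symmetric]
    by (intro sum.cong) (auto simp: shifted_def algebra_simps)
  ultimately show ?thesis using 1 by linarith
qed

lemma sum_squares_le:
  assumes "\<And>x. 0 \<le> (\<beta> x :: int)"
  shows "(\<Sum>x<(N::nat). \<beta> x * \<beta> x) \<le> (\<Sum>x<N. \<beta> x) * (\<Sum>x<N. \<beta> x)"
proof -
  have "\<beta> x * \<beta> x \<le> \<beta> x * (\<Sum>x<N. \<beta> x)" if "x < N" for x
    using assms that by (intro mult_left_mono member_le_sum) auto
  then show ?thesis
    unfolding sum_distrib_right by (intro sum_mono) auto
qed

text \<open>For antitone \<alpha> the alternating sum expresses \<open>G \<alpha>\<close> through
  values of \<open>G\<close> at weights with a larger sum of squares, by
  \<open>shifted_sum_squares\<close>. Any other \<alpha> is sorted by adjacent transpositions, under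
  which \<open>G\<close> is invariant. Nonnegative weights of sum s have a sum of squares of at most
  \<open>s * s\<close>, so the recursion ends.\<close>

lemma kernel_unique:
  fixes G :: "(nat \<Rightarrow> int) \<Rightarrow> int"
  assumes sym: "\<And>\<alpha> k. G (\<alpha> \<circ> Transposition.transpose k (Suc k)) = G \<alpha>"
    and neg: "\<And>\<alpha> x. \<alpha> x < 0 \<Longrightarrow> G \<alpha> = 0"
    and D: "\<And>\<nu>. (\<And>x. \<nu> (Suc x) \<le> \<nu> x) \<Longrightarrow> (\<And>x. x \<ge> N \<Longrightarrow> \<nu> x = 0) \<Longrightarrow> (\<Sum>x<N. \<nu> x) = s
      \<Longrightarrow> (\<Sum>\<pi> | \<pi> permutes {..<N}. sign \<pi> * G (shifted \<nu> \<pi>)) = 0"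
  shows "(\<And>x. x \<ge> N \<Longrightarrow> \<alpha> x = 0) \<Longrightarrow> (\<Sum>x<N. \<alpha> x) = s \<Longrightarrow> G \<alpha> = 0"
\<comment> \<open>The first measure is the room left for the sum of squares. Sorting an ascent keeps
  it and lowers the second measure.\<close>
proof (induction \<alpha> rule: wf_induct_rule[OF wf_measures[of
    "[\<lambda>\<alpha>. nat (s * s - (\<Sum>x<N. \<alpha> x * \<alpha> x)), \<lambda>\<alpha>. nat (\<Sum>x<N. int x * \<alpha> x)]"]])
  case (1 \<alpha>)
  show ?case
  proof (cases "\<exists>x. \<alpha> x < 0")
    case True
    then show ?thesis using neg by blast
  next
    case False
    then have nn: "\<And>x. 0 \<le> \<alpha> x" by (simp add: not_less)
    show ?thesis
    proof (cases "\<forall>x. \<alpha> (Suc x) \<le> \<alpha> x")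
      case True
      have z: "sign \<pi> * G (shifted \<alpha> \<pi>) = 0" if p: "\<pi> \<in> {\<pi>. \<pi> permutes {..<N}} - {id}" for \<pi>
      proof (cases "\<exists>x. shifted \<alpha> \<pi> x < 0")
        case True
        then show ?thesis using neg by auto
      next
        case False
        let ?\<beta> = "shifted \<alpha> \<pi>"
        have \<pi>: "\<pi> permutes {..<N}" "\<pi> \<noteq> id" using p by auto
        have sm: "(\<Sum>x<N. ?\<beta> x) = s"
          using shifted_sum[OF \<pi>(1)] 1 by simp
        have "(\<Sum>x<N. \<alpha> x * \<alpha> x) < (\<Sum>x<N. ?\<beta> x * ?\<beta> x)"
          using shifted_sum_squares[OF \<pi>] True by blast
        moreover have "(\<Sum>x<N. ?\<beta> x * ?\<beta> x) \<le> s * s"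
          using sum_squares_le[of ?\<beta> N] False sm by (simp add: not_less)
        ultimately have "nat (s * s - (\<Sum>x<N. ?\<beta> x * ?\<beta> x)) < nat (s * s - (\<Sum>x<N. \<alpha> x * \<alpha> x))"
          by linarith
        moreover have "?\<beta> x = 0" if "x \<ge> N" for x
          using permutes_not_in[OF \<pi>(1), of x] 1(2)[OF that] that by (simp add: shifted_def)
        ultimately have "G ?\<beta> = 0"
          using sm by (intro 1(1)) (auto simp: in_measures)
        then show ?thesis by simp
      qed
      have "(\<Sum>\<pi>\<in>{\<pi>. \<pi> permutes {..<N}} - {id}. sign \<pi> * G (shifted \<alpha> \<pi>)) = 0"
        by (rule sum.neutral) (use z in blast)
      moreover have "(\<Sum>\<pi> | \<pi> permutes {..<N}. sign \<pi> * G (shifted \<alpha> \<pi>)) = sign (id :: nat \<Rightarrow> nat) * G (shifted \<alpha> id)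
          + (\<Sum>\<pi>\<in>{\<pi>. \<pi> permutes {..<N}} - {id}. sign \<pi> * G (shifted \<alpha> \<pi>))"
        by (rule sum.remove) (auto intro: finite_permutations permutes_id)
      moreover have "shifted \<alpha> id = \<alpha>" by (auto simp: shifted_def)
      moreover have "(\<Sum>\<pi> | \<pi> permutes {..<N}. sign \<pi> * G (shifted \<alpha> \<pi>)) = 0"
        using True 1 by (intro D) auto
      ultimately show ?thesis
        by (simp only: sign_id mult_1 add_0_right)
    next
      case False
      then obtain k where k: "\<alpha> k < \<alpha> (Suc k)" by (auto simp: not_le)
      let ?t = "Transposition.transpose k (Suc k)"
      have kN: "Suc k < N"
        using 1(2)[of "Suc k"] k nn[of k] by (cases "Suc k < N") auto
      then have t: "?t permutes {..<N}" by (intro permutes_swap_id) auto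
      have "(\<Sum>x<N. int x * \<alpha> x) - (\<Sum>x<N. int x * (\<alpha> \<circ> ?t) x) = (\<Sum>x<N. (int x - int (?t x)) * \<alpha> x)"
        using sum.permute[OF t, of "\<lambda>x. int x * (\<alpha> \<circ> ?t) x"] by (simp add: sum_subtractf algebra_simps comp_def)
      also have "\<dots> = (\<Sum>x\<in>{k, Suc k}. (int x - int (?t x)) * \<alpha> x)"
        using kN by (intro sum.mono_neutral_right) auto
      also have "\<dots> = \<alpha> (Suc k) - \<alpha> k" by simp
      finally have "(\<Sum>x<N. int x * (\<alpha> \<circ> ?t) x) < (\<Sum>x<N. int x * \<alpha> x)" using k by simp
      moreover have "0 \<le> (\<Sum>x<N. int x * (\<alpha> \<circ> ?t) x)"
        using nn by (intro sum_nonneg) auto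
      ultimately have L: "nat (\<Sum>x<N. int x * (\<alpha> \<circ> ?t) x) < nat (\<Sum>x<N. int x * \<alpha> x)" by linarith
      have Q: "(\<Sum>x<N. (\<alpha> \<circ> ?t) x * (\<alpha> \<circ> ?t) x) = (\<Sum>x<N. \<alpha> x * \<alpha> x)"
        using sum.permute[OF t, of "\<lambda>x. \<alpha> x * \<alpha> x"] by (simp add: comp_def)
      have sm: "(\<Sum>x<N. (\<alpha> \<circ> ?t) x) = s"
        using sum.permute[OF t, of \<alpha>] 1(3) by simp
      have "(\<alpha> \<circ> ?t) x = 0" if "x \<ge> N" for x
        using permutes_not_in[OF t, of x] 1(2)[OF that] that by simp
      then have "G (\<alpha> \<circ> ?t) = 0"
        using L Q sm by (intro 1(1)) (simp_all only: in_measures refl simp_thms)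
      then show ?thesis by (simp only: sym)
    qed
  qed
qed

section \<open>Straight shapes and their only highest tuple\<close>

definition col_len :: "nat list \<Rightarrow> nat \<Rightarrow> nat" where
  "col_len \<nu> j = card {x. j \<le> part \<nu> (Suc x)}"

text \<open>The case of empty mu: the starts are -j, and the columns, whose lengths form the
  conjugate partition, make up a semistandard tableau of shape \<nu>.\<close>

definition straight :: "nat list \<Rightarrow> (nat \<Rightarrow> nat set) set" where
  "straight \<nu> = {C \<in> columns (part \<nu> 1) (\<lambda>j. int (col_len \<nu> j)).
     {i \<in> {1..<part \<nu> 1}. meets (\<lambda>j. - int j) C i} = {}}"

lemma part_antimono:
  assumes "is_part \<nu>" "1 \<le> r" "r \<le> r'"
  shows "part \<nu> r' \<le> part \<nu> r"
proof (cases "r' \<le> length \<nu>")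
  case True
  have "sorted_wrt (\<ge>) \<nu>"
    using assms(1) by (simp add: is_part_def sorted_wrt_rev)
  then have "\<nu> ! (r' - 1) \<le> \<nu> ! (r - 1)"
    using sorted_wrt_nth_less[of "(\<ge>)" \<nu> "r - 1" "r' - 1"] True assms(2,3) by (cases "r = r'") auto
  then show ?thesis
    using True assms by (simp add: part_def)
qed (simp add: part_def)

lemma part_beyond: "length \<nu> < r \<Longrightarrow> part \<nu> r = 0"
  by (simp add: part_def)

lemma part_pos: "is_part \<nu> \<Longrightarrow> 0 < part \<nu> (Suc x) \<longleftrightarrow> x < length \<nu>"
  by (auto simp: part_def is_part_def gr0_conv_Suc in_set_conv_nth)

lemma down_closed_eq_lessThan:
  assumes "finite D" "\<And>x. Suc x \<in> D \<Longrightarrow> x \<in> D"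
  shows "D = {..<card D}"
proof -
  have down: "x \<in> D" if "y \<in> D" "x \<le> y" for x y
    using that(2,1) by (induction rule: inc_induct) (auto intro: assms(2))
  have "D = {..<m}" if "m = (LEAST m. m \<notin> D)" for m
  proof -
    have "\<exists>m. m \<notin> D" using assms(1) by (meson ex_new_if_finite infinite_UNIV_nat)
    then have "m \<notin> D" unfolding that by (rule LeastI_ex)
    moreover have "x \<in> D" if "x < m" for x
      using not_less_Least[of x "\<lambda>m. m \<notin> D"] that \<open>m = _\<close> by blast
    ultimately show ?thesis
      using down by (auto simp: not_less[symmetric])
  qed
  then show ?thesis by (metis card_lessThan)
qed

lemma less_col_len:
  assumes "is_part \<nu>" "1 \<le> j"
  shows "x < col_len \<nu> j \<longleftrightarrow> j \<le> part \<nu> (Suc x)"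
proof -
  let ?D = "{x. j \<le> part \<nu> (Suc x)}"
  have "?D \<subseteq> {..<length \<nu>}"
    using part_beyond[of \<nu>] assms(2) by (auto simp: not_less[symmetric]) (metis Suc_leI le_zero_eq less_Suc_eq_le not_less_eq not_one_le_zero)
  then have "?D = {..<col_len \<nu> j}"
    unfolding col_len_def
    using part_antimono[OF assms(1)]
    by (intro down_closed_eq_lessThan) (auto intro: finite_subset, metis le_Suc_eq le_trans One_nat_def Suc_le_mono zero_le)
  then show ?thesis by blast
qed

lemma col_len_antimono:
  assumes "is_part \<nu>" "1 \<le> j" "j \<le> j'"
  shows "col_len \<nu> j' \<le> col_len \<nu> j"
proof (rule ccontr)
  assume "\<not> ?thesis"
  then have "col_len \<nu> j < col_len \<nu> j'" by simp
  then show False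
    using less_col_len[OF assms(1), of j' "col_len \<nu> j"] less_col_len[OF assms(1), of j "col_len \<nu> j"] assms by auto
qed

text \<open>The superstandard tableau: row r is filled with r - 1, since variables are numbered from
  0.\<close>

definition top_columns :: "nat list \<Rightarrow> nat \<Rightarrow> nat set" where
  "top_columns \<nu> j = (if j \<in> {1..part \<nu> 1} then {..<col_len \<nu> j} else {})"

lemma content_top_columns:
  assumes "is_part \<nu>"
  shows "content (part \<nu> 1) (top_columns \<nu>) x = part \<nu> (Suc x)"
proof -
  have "{j \<in> {1..part \<nu> 1}. x \<in> top_columns \<nu> j} = {1..part \<nu> (Suc x)}"
    using less_col_len[OF assms] part_antimono[OF assms, of 1 "Suc x"]
    by (auto simp: top_columns_def)
  then show ?thesis by (simp add: content_def)
qed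

lemma top_columns_straight:
  assumes "is_part \<nu>"
  shows "top_columns \<nu> \<in> straight \<nu>"
proof -
  have "\<not> meets (\<lambda>j. - int j) (top_columns \<nu>) i" if "i \<in> {1..<part \<nu> 1}" for i
  proof -
    have int: "{..<a} \<inter> {..<x} = {..<min a x}" for a x :: nat by auto
    show ?thesis
      using that col_len_antimono[OF assms, of i "Suc i"]
      by (auto simp: meets_def height_def top_columns_def int not_le)
  qed
  then show ?thesis
    by (auto simp: straight_def columns_def top_columns_def)
qed

lemma top_columns_highest:
  assumes "is_part \<nu>"
  shows "highest (part \<nu> 1) (top_columns \<nu>)"
  unfolding highest_def suffix_content_def
  by (auto intro!: card_mono simp: top_columns_def)

text \<open>Columns are determined from right to left. If column j + 1 is {..<c}, not meeting it
  forces all entries below c into column j. From c on, the ballot condition admits x + 1 only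
  together with x, because nothing further right reaches c. So column j is an initial segment, and
  its length is prescribed.\<close>

lemma highest_straight_unique:
  assumes \<nu>: "is_part \<nu>" and C: "C \<in> straight \<nu>" and h: "highest (part \<nu> 1) C"
  shows "C = top_columns \<nu>"
proof -
  let ?n = "part \<nu> 1"
  have col: "finite (C j)" "card (C j) = col_len \<nu> j" if "j \<in> {1..?n}" for j
    using C that by (auto simp: straight_def columns_def)
  have zero: "col_len \<nu> (Suc ?n) = 0"
    using less_col_len[OF \<nu>, of "Suc ?n" 0] by simp
  have "\<forall>i. 1 \<le> i \<longrightarrow> j \<le> i \<longrightarrow> i \<le> ?n \<longrightarrow> C i = {..<col_len \<nu> i}" if "j \<le> Suc ?n" for j
    using that
  proof (induction rule: inc_induct)
    case base
    then show ?case by simp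
  next
    case (step j)
    have "C j = {..<col_len \<nu> j}" if j: "1 \<le> j"
    proof -
      let ?c = "col_len \<nu> (Suc j)"
      have jn: "j \<in> {1..?n}" using step j by auto
      \<comment> \<open>At time c column j + 1 has used up all its c entries; the lead of one in the
        starts then demands c entries below c in column j.\<close>
      have low: "x \<in> C j" if "x < ?c" for x
      proof -
        have "j \<noteq> ?n" using zero that by auto
        then have jn': "j \<in> {1..<?n}" using jn by auto
        then have "\<not> meets (\<lambda>j. - int j) C j"
          using C by (auto simp: straight_def)
        then have "height (\<lambda>j. - int j) C (Suc j) ?c < height (\<lambda>j. - int j) C j ?c"
          by (auto simp: meets_def not_le)
        moreover have "C (Suc j) = {..<?c}" using step.IH jn' by auto
        ultimately have "?c \<le> card (C j \<inter> {..<?c})" by (simp add: height_def)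
        then have "C j \<inter> {..<?c} = {..<?c}" by (intro card_seteq) auto
        then show ?thesis using that by blast
      qed
      have high: "x \<in> C j" if "Suc x \<in> C j" "?c \<le> x" for x
      proof -
        have nz: "suffix_content ?n (Suc j) C y = 0" if "y \<ge> ?c" for y
        proof -
          have "y \<notin> C i" if "i \<in> {Suc j..?n}" for i
            using step.IH col_len_antimono[OF \<nu>, of "Suc j" i] that \<open>y \<ge> ?c\<close> by fastforce
          then show ?thesis by (auto simp: suffix_content_def)
        qed
        have "suffix_content ?n j C (Suc x) \<le> suffix_content ?n j C x"
          using h jn by (simp add: highest_def)
        then show ?thesis
          using that nz[of x] nz[of "Suc x"] suffix_content_Suc[of j ?n C] jn by (cases "x \<in> C j") auto
      qed
      have "C j = {..<card (C j)}"
        using low high col(1)[OF jn] by (intro down_closed_eq_lessThan) (meson not_le)+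
      then show ?thesis using col(2)[OF jn] by simp
    qed
    then show ?case using step.IH by (metis Suc_leI le_neq_implies_less)
  qed
  from this[of 1] have "C i = {..<col_len \<nu> i}" if "i \<in> {1..?n}" for i
    using that by auto
  moreover have "C i = {}" if "i \<notin> {1..?n}" for i
    using C that by (simp add: straight_def columns_def)
  ultimately show ?thesis
    by (auto simp: top_columns_def fun_eq_iff)
qed

lemma straight_highest_count:
  assumes "is_part \<nu>"
  shows "card {C \<in> straight \<nu>. highest (part \<nu> 1) C \<and> (\<forall>x. int (content (part \<nu> 1) C x) = \<alpha> x)}
    = of_bool (\<alpha> = (\<lambda>x. int (part \<nu> (Suc x))))"
proof -
  have "{C \<in> straight \<nu>. highest (part \<nu> 1) C \<and> (\<forall>x. int (content (part \<nu> 1) C x) = \<alpha> x)}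
    = (if \<alpha> = (\<lambda>x. int (part \<nu> (Suc x))) then {top_columns \<nu>} else {})"
    (is "?S = _")
  proof -
    have "C = top_columns \<nu> \<and> \<alpha> = (\<lambda>x. int (part \<nu> (Suc x)))" if "C \<in> ?S" for C
    proof -
      have C: "C = top_columns \<nu>" "\<And>x. int (content (part \<nu> 1) C x) = \<alpha> x"
        using highest_straight_unique[OF assms] that by blast+
      then have "\<alpha> x = int (part \<nu> (Suc x))" for x
        using content_top_columns[OF assms, of x] by metis
      with C(1) show ?thesis by blast
    qed
    moreover have "top_columns \<nu> \<in> ?S" if "\<alpha> = (\<lambda>x. int (part \<nu> (Suc x)))"
      using that top_columns_straight[OF assms] top_columns_highest[OF assms] content_top_columns[OF assms]
      by simp
    ultimately show ?thesis
    proof -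
      fix S assume 1: "\<And>C. C \<in> S \<Longrightarrow> C = top_columns \<nu> \<and> \<alpha> = (\<lambda>x. int (part \<nu> (Suc x)))"
        and 2: "\<alpha> = (\<lambda>x. int (part \<nu> (Suc x))) \<Longrightarrow> top_columns \<nu> \<in> S"
      show "S = (if \<alpha> = (\<lambda>x. int (part \<nu> (Suc x))) then {top_columns \<nu>} else {})"
      proof (cases "\<alpha> = (\<lambda>x. int (part \<nu> (Suc x)))")
        case True
        then have "S = {top_columns \<nu>}" using 1 2 by blast
        then show ?thesis using True by simp
      next
        case False
        then have "S = {}" using 1 by blast
        then show ?thesis using False by simp
      qed
    qed
  qed
  then show ?thesis by simp
qed

lemma straight_bk_closed: "bk_closed (part \<nu> 1) (straight \<nu>)"
  unfolding straight_def by (rule bk_closed_meets)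

section \<open>The Schur expansion of a reflection-closed class\<close>

definition partitions :: "nat \<Rightarrow> nat list set" where
  "partitions s = {\<nu>. is_part \<nu> \<and> sum_list \<nu> = s}"

lemma finite_partitions: "finite (partitions s)"
proof -
  have "length \<nu> \<le> sum_list \<nu>" if "0 \<notin> set \<nu>" for \<nu> :: "nat list"
    using that by (induction \<nu>) auto
  moreover have "x \<le> sum_list \<nu>" if "x \<in> set \<nu>" for \<nu> :: "nat list" and x
    using that by (induction \<nu>) auto
  ultimately have "partitions s \<subseteq> {\<nu>. set \<nu> \<subseteq> {..s} \<and> length \<nu> \<le> s}"
    by (auto simp: partitions_def is_part_def)
  then show ?thesis
    by (rule finite_subset) (simp add: finite_lists_length_le)
qed

lemma part_inj:
  assumes "is_part \<nu>" "is_part \<nu>'" "\<And>x. part \<nu> (Suc x) = part \<nu>' (Suc x)"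
  shows "\<nu> = \<nu>'"
proof (rule nth_equalityI)
  have "x < length \<nu> \<longleftrightarrow> x < length \<nu>'" for x
    using part_pos[OF assms(1)] part_pos[OF assms(2)] assms(3) by metis
  then show "length \<nu> = length \<nu>'" by (metis linorder_neqE_nat order_less_irrefl)
  fix i assume "i < length \<nu>"
  then show "\<nu> ! i = \<nu>' ! i"
    using assms(3)[of i] \<open>length \<nu> = length \<nu>'\<close> by (simp add: part_def)
qed

lemma antitone_is_part:
  fixes \<nu> :: "nat \<Rightarrow> int"
  assumes anti: "\<And>x. \<nu> (Suc x) \<le> \<nu> x" and supp: "\<And>x. x \<ge> N \<Longrightarrow> \<nu> x = 0" and s: "(\<Sum>x<N. \<nu> x) = int s"
  obtains \<kappa> where "\<kappa> \<in> partitions s" "\<And>x. \<nu> x = int (part \<kappa> (Suc x))"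
proof -
  have mono: "x \<le> y \<Longrightarrow> \<nu> y \<le> \<nu> x" for x y
    using anti by (rule lift_Suc_antimono_le)
  have nn: "0 \<le> \<nu> x" for x
    using mono[of x "max x N"] supp[of "max x N"] by simp
  define D where "D = {x. \<nu> x \<noteq> 0}"
  have "D \<subseteq> {..<N}" using supp by (auto simp: D_def not_less[symmetric])
  then have finD: "finite D" by (rule finite_subset) simp
  define l where "l = card D"
  have Dl: "D = {..<l}"
    unfolding l_def using finD anti nn by (intro down_closed_eq_lessThan) (auto simp: D_def, metis antisym)
  define \<kappa> where "\<kappa> = map (\<lambda>x. nat (\<nu> x)) [0..<l]"
  have "sorted_wrt (\<ge>) \<kappa>"
    unfolding sorted_wrt_iff_nth_less \<kappa>_def using mono by (auto intro: nat_mono)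
  then have "is_part \<kappa>"
    using Dl nn by (auto simp: is_part_def sorted_wrt_rev \<kappa>_def D_def) (metis antisym lessThan_iff mem_Collect_eq nat_le_0 order_refl)
  moreover have "sum_list \<kappa> = s"
  proof -
    have "int (sum_list \<kappa>) = (\<Sum>x<l. \<nu> x)"
      unfolding \<kappa>_def using nn by (simp add: interv_sum_list_conv_sum_set_nat lessThan_atLeast0)
    also have "\<dots> = (\<Sum>x<N. \<nu> x)"
      using \<open>D \<subseteq> {..<N}\<close> unfolding Dl[symmetric] by (intro sum.mono_neutral_left) (auto simp: D_def)
    finally show ?thesis using s by simp
  qed
  moreover have "\<nu> x = int (part \<kappa> (Suc x))" for x
  proof (cases "x < l")
    case True
    then show ?thesis using nn by (simp add: part_def \<kappa>_def)
  next
    case False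
    then have "x \<notin> D" by (simp add: Dl)
    then show ?thesis using False by (simp add: part_def \<kappa>_def D_def)
  qed
  ultimately show ?thesis
    using that by (simp add: partitions_def)
qed

text \<open>The Littlewood-Richardson coefficient of the class \<open>X\<close>.\<close>

definition highest_count :: "nat \<Rightarrow> (nat \<Rightarrow> nat set) set \<Rightarrow> nat list \<Rightarrow> nat" where
  "highest_count n X \<nu> = card {C \<in> X. highest n C \<and> (\<forall>x. int (content n C x) = int (part \<nu> (Suc x)))}"

text \<open>Both sides are symmetric and have equal alternating sums: \<open>signed_kcount\<close>
  yields \<open>highest_count\<close> on the left, and on the right each straight shape contributes
  at its own partition alone, by \<open>straight_highest_count\<close>. So
  \<open>kernel_unique\<close> applies to the difference \<open>G\<close>.\<close>

theorem kcount_expansion: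
  assumes X: "bk_closed n X" "X \<subseteq> columns n d"
    and supp: "\<And>x. x \<ge> N \<Longrightarrow> m x = 0" and s: "(\<Sum>x<N. m x) = s"
  shows "kcount n X (\<lambda>x. int (m x))
    = (\<Sum>\<nu>\<in>partitions s. int (highest_count n X \<nu>) * kcount (part \<nu> 1) (straight \<nu>) (\<lambda>x. int (m x)))"
proof -
  define G where "G = (\<lambda>\<alpha>. kcount n X \<alpha>
    - (\<Sum>\<nu>\<in>partitions s. int (highest_count n X \<nu>) * kcount (part \<nu> 1) (straight \<nu>) \<alpha>))"
  have sub: "straight \<nu> \<subseteq> columns (part \<nu> 1) (\<lambda>j. int (col_len \<nu> j))" for \<nu>
    by (auto simp: straight_def)
  have "G (\<lambda>x. int (m x)) = 0"
  proof (rule kernel_unique[where N = N and s = "int s" and G = G])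
    show "G (\<alpha> \<circ> Transposition.transpose k (Suc k)) = G \<alpha>" for \<alpha> k
      unfolding G_def by (simp only: kcount_swap[OF X] kcount_swap[OF straight_bk_closed sub])
    have kneg: "kcount n X \<alpha> = 0" if "\<alpha> x < 0" for \<alpha> n X x
    proof -
      have e: "{C \<in> X. \<forall>x. int (content n C x) = \<alpha> x} = {}"
        using that by (auto intro!: exI[of _ x])
      show ?thesis unfolding kcount_def e by simp
    qed
    then show "G \<alpha> = 0" if "\<alpha> x < 0" for \<alpha> x
      using that by (auto simp: G_def intro!: sum.neutral)
    show "(\<Sum>\<pi> | \<pi> permutes {..<N}. sign \<pi> * G (shifted \<nu> \<pi>)) = 0"
      if \<nu>: "\<And>x. \<nu> (Suc x) \<le> \<nu> x" "\<And>x. x \<ge> N \<Longrightarrow> \<nu> x = 0" "(\<Sum>x<N. \<nu> x) = int s" for \<nu>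
    proof -
      obtain \<kappa> where \<kappa>: "\<kappa> \<in> partitions s" "\<And>x. \<nu> x = int (part \<kappa> (Suc x))"
        using antitone_is_part[OF \<nu>] by blast
      let ?P = "{\<pi>. \<pi> permutes {..<N}}"
      have "(\<Sum>\<pi>\<in>?P. sign \<pi> * G (shifted \<nu> \<pi>))
        = (\<Sum>\<pi>\<in>?P. sign \<pi> * kcount n X (shifted \<nu> \<pi>))
          - (\<Sum>\<kappa>\<in>partitions s. int (highest_count n X \<kappa>) * (\<Sum>\<pi>\<in>?P. sign \<pi> * kcount (part \<kappa> 1) (straight \<kappa>) (shifted \<nu> \<pi>)))"
        unfolding G_def right_diff_distrib sum_subtractf sum_distrib_left
        by (subst sum.swap) (simp add: mult_ac)
      also have "(\<Sum>\<pi>\<in>?P. sign \<pi> * kcount n X (shifted \<nu> \<pi>)) = int (highest_count n X \<kappa>)"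
        unfolding highest_count_def \<kappa>(2)[symmetric] by (rule signed_kcount[OF X]) (fact \<nu>)+
      also have "(\<Sum>\<kappa>'\<in>partitions s. int (highest_count n X \<kappa>') * (\<Sum>\<pi>\<in>?P. sign \<pi> * kcount (part \<kappa>' 1) (straight \<kappa>') (shifted \<nu> \<pi>)))
        = (\<Sum>\<kappa>'\<in>partitions s. if \<kappa>' = \<kappa> then int (highest_count n X \<kappa>) else 0)"
      proof (rule sum.cong[OF refl])
        fix \<kappa>' assume k': "\<kappa>' \<in> partitions s"
        have "(\<Sum>\<pi>\<in>?P. sign \<pi> * kcount (part \<kappa>' 1) (straight \<kappa>') (shifted \<nu> \<pi>))
          = int (card {C \<in> straight \<kappa>'. highest (part \<kappa>' 1) C \<and> (\<forall>x. int (content (part \<kappa>' 1) C x) = \<nu> x)})"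
          by (rule signed_kcount[OF straight_bk_closed sub]) (fact \<nu>)+
        also have "\<dots> = of_bool (\<nu> = (\<lambda>x. int (part \<kappa>' (Suc x))))"
          using straight_highest_count[of \<kappa>' \<nu>] k' by (simp add: partitions_def)
        finally have "(\<Sum>\<pi>\<in>?P. sign \<pi> * kcount (part \<kappa>' 1) (straight \<kappa>') (shifted \<nu> \<pi>))
          = of_bool (\<nu> = (\<lambda>x. int (part \<kappa>' (Suc x))))" .
        moreover have "\<nu> = (\<lambda>x. int (part \<kappa>' (Suc x))) \<longleftrightarrow> \<kappa>' = \<kappa>"
        proof
          assume e: "\<nu> = (\<lambda>x. int (part \<kappa>' (Suc x)))"
          have "part \<kappa>' (Suc x) = part \<kappa> (Suc x)" for x
            using fun_cong[OF e, of x] \<kappa>(2)[of x] by simp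
          then show "\<kappa>' = \<kappa>"
            using part_inj[of \<kappa>' \<kappa>] k' \<kappa>(1) unfolding partitions_def by blast
        next
          assume "\<kappa>' = \<kappa>"
          then show "\<nu> = (\<lambda>x. int (part \<kappa>' (Suc x)))"
            using \<kappa>(2) by (intro ext) simp
        qed
        ultimately show "int (highest_count n X \<kappa>') * (\<Sum>\<pi>\<in>?P. sign \<pi> * kcount (part \<kappa>' 1) (straight \<kappa>') (shifted \<nu> \<pi>))
          = (if \<kappa>' = \<kappa> then int (highest_count n X \<kappa>) else 0)"
          by simp
      qed
      also have "\<dots> = int (highest_count n X \<kappa>)"
        using \<kappa>(1) finite_partitions by simp
      finally show ?thesis by simp
    qed
    show "x \<ge> N \<Longrightarrow> int (m x) = 0" for x
      using supp by simp
    show "(\<Sum>x<N. int (m x)) = int s"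
      using s by (simp flip: of_nat_sum)
  qed
  then show ?thesis by (simp add: G_def)
qed

section \<open>Tableaux and columns\<close>

lemma cells_iff:
  assumes "is_part \<nu>"
  shows "(r, j) \<in> cells \<nu> \<longleftrightarrow> 1 \<le> j \<and> 1 \<le> r \<and> r \<le> col_len \<nu> j"
proof (cases "1 \<le> j \<and> 1 \<le> r")
  case True
  then obtain x where r: "r = Suc x" by (cases r) auto
  show ?thesis
    using less_col_len[OF assms, of j x] True unfolding r
    by (auto simp: cells_def part_def split: if_splits)
qed (auto simp: cells_def)

lemma cells_col_le:
  assumes "is_part \<nu>" "(r, j) \<in> cells \<nu>"
  shows "j \<in> {1..part \<nu> 1}"
  using assms part_antimono[OF assms(1), of 1 r] by (auto simp: cells_def)

lemma ssyt_column_strict: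
  assumes \<nu>: "is_part \<nu>" and T: "ssyt \<nu> T" and r: "1 \<le> r"
  shows "r < r' \<Longrightarrow> (r', j) \<in> cells \<nu> \<Longrightarrow> T (r, j) < T (r', j)"
proof (induction r')
  case (Suc r')
  have c: "(r', j) \<in> cells \<nu>"
    using Suc.prems r unfolding cells_iff[OF \<nu>] by auto
  then have "T (r', j) < T (Suc r', j)"
    using T Suc.prems by (auto simp: ssyt_def)
  then show ?case
    using Suc c by (cases "r = r'") auto
qed simp

definition columns_of :: "nat list \<Rightarrow> (nat \<times> nat \<Rightarrow> nat) \<Rightarrow> nat \<Rightarrow> nat set" where
  "columns_of \<nu> T j = (if j \<in> {1..part \<nu> 1} then (\<lambda>r. T (r, j)) ` {1..col_len \<nu> j} else {})"

definition tableau_of :: "nat list \<Rightarrow> (nat \<Rightarrow> nat set) \<Rightarrow> nat \<times> nat \<Rightarrow> nat" where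
  "tableau_of \<nu> C x = (if x \<in> cells \<nu> then sorted_list_of_set (C (snd x)) ! (fst x - 1) else 0)"

context
  fixes \<nu> :: "nat list" and T :: "nat \<times> nat \<Rightarrow> nat" and j :: nat
  assumes \<nu>: "is_part \<nu>" and strict: "\<And>r r'. 1 \<le> r \<Longrightarrow> r < r' \<Longrightarrow> r' \<le> col_len \<nu> j \<Longrightarrow> T (r, j) < T (r', j)"
    and j: "j \<in> {1..part \<nu> 1}"
begin

lemma column_inj: "inj_on (\<lambda>r. T (r, j)) {1..col_len \<nu> j}"
proof (rule linorder_inj_onI)
  fix r r' assume "r < r'" "r \<in> {1..col_len \<nu> j}" "r' \<in> {1..col_len \<nu> j}"
  then show "T (r, j) \<noteq> T (r', j)" using strict[of r r'] by auto
qed auto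

lemma card_columns_of: "card (columns_of \<nu> T j) = col_len \<nu> j"
  using j column_inj by (simp add: columns_of_def card_image)

lemma card_columns_of_below:
  "card (columns_of \<nu> T j \<inter> {..<x}) = card {r \<in> {1..col_len \<nu> j}. T (r, j) < x}"
proof -
  have "columns_of \<nu> T j \<inter> {..<x} = (\<lambda>r. T (r, j)) ` {r \<in> {1..col_len \<nu> j}. T (r, j) < x}"
    using j by (auto simp: columns_of_def)
  also have "card \<dots> = card {r \<in> {1..col_len \<nu> j}. T (r, j) < x}"
    by (intro card_image inj_on_subset[OF column_inj]) auto
  finally show ?thesis .
qed

lemma sorted_list_columns_of: "sorted_list_of_set (columns_of \<nu> T j) = map (\<lambda>r. T (r, j)) [1..<Suc (col_len \<nu> j)]"
proof (rule sorted_distinct_set_unique)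
  have "sorted_wrt (\<lambda>r r'. T (r, j) \<le> T (r', j)) [1..<Suc (col_len \<nu> j)]"
    by (rule sorted_wrt_mono_rel[OF _ sorted_wrt_upt]) (auto intro: less_imp_le[OF strict])
  then show "sorted (map (\<lambda>r. T (r, j)) [1..<Suc (col_len \<nu> j)])"
    by (simp add: sorted_wrt_map)
  show "distinct (map (\<lambda>r. T (r, j)) [1..<Suc (col_len \<nu> j)])"
    using column_inj by (auto simp: distinct_map atLeastLessThanSuc_atLeastAtMost simp del: upt_Suc)
  show "set (sorted_list_of_set (columns_of \<nu> T j)) = set (map (\<lambda>r. T (r, j)) [1..<Suc (col_len \<nu> j)])"
    using j by (auto simp: columns_of_def atLeastLessThanSuc_atLeastAtMost simp del: upt_Suc)
qed auto

end

text \<open>Weakly increasing rows mean that below any x column i has at least as many entries as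
  column i + 1. The starts -i and -(i + 1) turn this into path i running strictly above path i +
  1.\<close>

lemma columns_of_straight:
  assumes \<nu>: "is_part \<nu>" and T: "ssyt \<nu> T"
  shows "columns_of \<nu> T \<in> straight \<nu>"
proof -
  have strict: "T (r, j) < T (r', j)" if "1 \<le> r" "r < r'" "r' \<le> col_len \<nu> j" "j \<in> {1..part \<nu> 1}" for r r' j
    using ssyt_column_strict[OF \<nu> T that(1,2)] that by (simp add: cells_iff[OF \<nu>])
  have "\<not> meets (\<lambda>j. - int j) (columns_of \<nu> T) i" if i: "i \<in> {1..<part \<nu> 1}" for i
  proof -
    have ii: "i \<in> {1..part \<nu> 1}" "Suc i \<in> {1..part \<nu> 1}" using i by auto
    have le: "card (columns_of \<nu> T (Suc i) \<inter> {..<x}) \<le> card (columns_of \<nu> T i \<inter> {..<x})" for x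
    proof -
      have "T (r, i) \<le> T (r, Suc i)" if "r \<in> {1..col_len \<nu> (Suc i)}" for r
        using T that ii col_len_antimono[OF \<nu>, of i "Suc i"] by (auto simp: ssyt_def cells_iff[OF \<nu>])
      then have "{r \<in> {1..col_len \<nu> (Suc i)}. T (r, Suc i) < x} \<subseteq> {r \<in> {1..col_len \<nu> i}. T (r, i) < x}"
        using col_len_antimono[OF \<nu>, of i "Suc i"] ii by fastforce
      then have "card {r \<in> {1..col_len \<nu> (Suc i)}. T (r, Suc i) < x} \<le> card {r \<in> {1..col_len \<nu> i}. T (r, i) < x}"
        by (intro card_mono) auto
      then show ?thesis
        using card_columns_of_below[of \<nu> i T x] card_columns_of_below[of \<nu> "Suc i" T x] \<nu> strict ii by simp
    qed
    show ?thesis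
    proof
      assume "meets (\<lambda>j. - int j) (columns_of \<nu> T) i"
      then obtain x where "height (\<lambda>j. - int j) (columns_of \<nu> T) i x \<le> height (\<lambda>j. - int j) (columns_of \<nu> T) (Suc i) x"
        unfolding meets_def ..
      then show False
        using le[of x] unfolding height_def by linarith
    qed
  qed
  moreover have "columns_of \<nu> T \<in> columns (part \<nu> 1) (\<lambda>j. int (col_len \<nu> j))"
  proof -
    have "card (columns_of \<nu> T j) = col_len \<nu> j" if "j \<in> {1..part \<nu> 1}" for j
      by (rule card_columns_of) (use \<nu> strict that in auto)
    moreover have "finite (columns_of \<nu> T j)" for j
      by (simp add: columns_of_def)
    moreover have "columns_of \<nu> T j = {}" if "j \<notin> {1..part \<nu> 1}" for j
      unfolding columns_of_def using that by (simp only: if_False)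
    ultimately show ?thesis
      unfolding columns_def by (intro CollectI conjI allI impI ballI) simp_all
  qed
  ultimately show ?thesis by (simp add: straight_def)
qed

lemma content_columns_of:
  assumes \<nu>: "is_part \<nu>" and T: "ssyt \<nu> T"
  shows "content (part \<nu> 1) (columns_of \<nu> T) i = card {x \<in> cells \<nu>. T x = i}"
proof -
  have "inj_on snd {x \<in> cells \<nu>. T x = i}"
  proof (rule inj_onI)
    fix x y assume xy: "x \<in> {x \<in> cells \<nu>. T x = i}" "y \<in> {x \<in> cells \<nu>. T x = i}" "snd x = snd y"
    obtain r r' j where x: "x = (r, j)" and y: "y = (r', j)" using xy(3) by (cases x; cases y) auto
    have "\<not> r < r'" "\<not> r' < r"
      using ssyt_column_strict[OF \<nu> T, of r r' j] ssyt_column_strict[OF \<nu> T, of r' r j] xy x y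
      by (auto simp: cells_iff[OF \<nu>])
    then show "x = y" by (simp add: x y)
  qed
  moreover have "snd ` {x \<in> cells \<nu>. T x = i} = {j \<in> {1..part \<nu> 1}. i \<in> columns_of \<nu> T j}"
  proof (intro set_eqI iffI)
    fix j assume "j \<in> snd ` {x \<in> cells \<nu>. T x = i}"
    then obtain r where r: "(r, j) \<in> cells \<nu>" "T (r, j) = i" by auto
    then show "j \<in> {j \<in> {1..part \<nu> 1}. i \<in> columns_of \<nu> T j}"
      using cells_col_le[OF \<nu> r(1)] r by (auto simp: columns_of_def cells_iff[OF \<nu>])
  next
    fix j assume "j \<in> {j \<in> {1..part \<nu> 1}. i \<in> columns_of \<nu> T j}"
    then obtain r where "j \<in> {1..part \<nu> 1}" "r \<in> {1..col_len \<nu> j}" "T (r, j) = i"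
      by (auto simp: columns_of_def)
    then have "(r, j) \<in> {x \<in> cells \<nu>. T x = i}" by (auto simp: cells_iff[OF \<nu>])
    then show "j \<in> snd ` {x \<in> cells \<nu>. T x = i}" by force
  qed
  ultimately show ?thesis
    unfolding content_def using card_image[of snd "{x \<in> cells \<nu>. T x = i}"] by argo
qed

lemma tableau_of_columns_of:
  assumes \<nu>: "is_part \<nu>" and T: "ssyt \<nu> T"
  shows "tableau_of \<nu> (columns_of \<nu> T) = T"
proof
  fix x :: "nat \<times> nat"
  obtain r j where x: "x = (r, j)" by (cases x)
  show "tableau_of \<nu> (columns_of \<nu> T) x = T x"
  proof (cases "x \<in> cells \<nu>")
    case True
    have j: "j \<in> {1..part \<nu> 1}" using cells_col_le[OF \<nu>] True x by blast
    have "sorted_list_of_set (columns_of \<nu> T j) = map (\<lambda>r. T (r, j)) [1..<Suc (col_len \<nu> j)]"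
      by (rule sorted_list_columns_of)
        (use \<nu> j ssyt_column_strict[OF \<nu> T] in \<open>auto simp: cells_iff[OF \<nu>]\<close>)
    then show ?thesis
      using True by (auto simp: tableau_of_def x cells_iff[OF \<nu>] nth_append simp del: upt_Suc)
  next
    case False
    then have "T x = 0" using T unfolding ssyt_def by blast
    then show ?thesis using False by (simp add: tableau_of_def)
  qed
qed

lemma tableau_of_strict:
  assumes \<nu>: "is_part \<nu>" and C: "C \<in> straight \<nu>" and r: "1 \<le> r" "r < r'" and r': "(r', j) \<in> cells \<nu>"
  shows "tableau_of \<nu> C (r, j) < tableau_of \<nu> C (r', j)"
proof -
  have j: "j \<in> {1..part \<nu> 1}" using cells_col_le[OF \<nu> r'] .
  have len: "length (sorted_list_of_set (C j)) = col_len \<nu> j" "finite (C j)"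
    using C j by (auto simp: straight_def columns_def)
  have "sorted_wrt (<) (sorted_list_of_set (C j))"
    by (rule strict_sorted_list_of_set)
  then have "sorted_list_of_set (C j) ! (r - 1) < sorted_list_of_set (C j) ! (r' - 1)"
    using r r' len by (intro sorted_wrt_nth_less[of "(<)"]) (auto simp: cells_iff[OF \<nu>])
  moreover have "(r, j) \<in> cells \<nu>" using r r' by (auto simp: cells_iff[OF \<nu>])
  ultimately show ?thesis using r' by (simp add: tableau_of_def)
qed

lemma columns_of_tableau_of:
  assumes \<nu>: "is_part \<nu>" and C: "C \<in> straight \<nu>"
  shows "columns_of \<nu> (tableau_of \<nu> C) = C"
proof
  fix j
  show "columns_of \<nu> (tableau_of \<nu> C) j = C j"
  proof (cases "j \<in> {1..part \<nu> 1}")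
    case True
    have len: "length (sorted_list_of_set (C j)) = col_len \<nu> j" "finite (C j)"
      using C True by (auto simp: straight_def columns_def)
    have "columns_of \<nu> (tableau_of \<nu> C) j = (\<lambda>r. sorted_list_of_set (C j) ! (r - 1)) ` {1..col_len \<nu> j}"
      using True by (auto simp: columns_of_def tableau_of_def cells_iff[OF \<nu>])
    also have "\<dots> = (\<lambda>i. sorted_list_of_set (C j) ! i) ` {0..<col_len \<nu> j}"
    proof -
      have "{0..<col_len \<nu> j} = (\<lambda>r. r - 1) ` {1..col_len \<nu> j}"
        by (auto simp: image_iff intro!: bexI[of _ "Suc _"])
      then show ?thesis by (simp add: image_image)
    qed
    also have "\<dots> = set (sorted_list_of_set (C j))"
      by (metis len(1) nth_image order_refl take_all)
    finally show ?thesis using len by simp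
  next
    case False
    then have "C j = {}" using C unfolding straight_def columns_def by blast
    then show ?thesis unfolding columns_of_def using False by (simp only: if_False)
  qed
qed

lemma tableau_of_ssyt:
  assumes \<nu>: "is_part \<nu>" and C: "C \<in> straight \<nu>"
  shows "ssyt \<nu> (tableau_of \<nu> C)"
  unfolding ssyt_def
proof (intro conjI allI impI)
  let ?T = "tableau_of \<nu> C"
  fix x assume "x \<notin> cells \<nu>"
  then show "?T x = 0" by (simp add: tableau_of_def)
next
  let ?T = "tableau_of \<nu> C"
  fix r j assume c: "(r, j) \<in> cells \<nu> \<and> (r, j + 1) \<in> cells \<nu>"
  have j: "j \<in> {1..<part \<nu> 1}" using cells_col_le[OF \<nu>, of r j] cells_col_le[OF \<nu>, of r "j + 1"] c by auto
  have strict: "?T (s, i) < ?T (s', i)" if "1 \<le> s" "s < s'" "s' \<le> col_len \<nu> i" "i \<in> {1..part \<nu> 1}" for s s' i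
    using tableau_of_strict[OF \<nu> C that(1,2)] that by (auto simp: cells_iff[OF \<nu>])
  have card_below: "card (C i \<inter> {..<x}) = card {s \<in> {1..col_len \<nu> i}. ?T (s, i) < x}" if "i \<in> {1..part \<nu> 1}" for i x
    using card_columns_of_below[of \<nu> i ?T x] \<nu> strict that columns_of_tableau_of[OF \<nu> C] by auto
  show "?T (r, j) \<le> ?T (r, j + 1)"
  proof (rule ccontr)
    assume "\<not> ?thesis"
    then have gt: "?T (r, Suc j) < ?T (r, j)" by simp
    \<comment> \<open>Just after this entry, column j + 1 has read at least r entries and column j
      at most r - 1, which uses up the lead of one that path j has at the start.\<close>
    define x where "x = Suc (?T (r, Suc j))"
    have le: "?T (s, i) \<le> ?T (s', i)" if "1 \<le> s" "s \<le> s'" "s' \<le> col_len \<nu> i" "i \<in> {1..part \<nu> 1}" for s s' i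
      using strict[OF that(1) _ that(3,4)] that(2) by (cases "s = s'") auto
    have "{1..r} \<subseteq> {s \<in> {1..col_len \<nu> (Suc j)}. ?T (s, Suc j) < x}"
      using le[of _ r "Suc j"] c j by (auto simp: x_def cells_iff[OF \<nu>] less_Suc_eq_le)
    then have "card {1..r} \<le> card {s \<in> {1..col_len \<nu> (Suc j)}. ?T (s, Suc j) < x}"
      by (intro card_mono) auto
    then have 1: "r \<le> card (C (Suc j) \<inter> {..<x})"
      using card_below[of "Suc j" x] j by simp
    have "{s \<in> {1..col_len \<nu> j}. ?T (s, j) < x} \<subseteq> {1..<r}"
    proof
      fix s assume s: "s \<in> {s \<in> {1..col_len \<nu> j}. ?T (s, j) < x}"
      then have "\<not> r \<le> s" using le[of r s j] c j gt by (auto simp: x_def cells_iff[OF \<nu>])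
      then show "s \<in> {1..<r}" using s by auto
    qed
    then have "card {s \<in> {1..col_len \<nu> j}. ?T (s, j) < x} \<le> card {1..<r}"
      by (intro card_mono) auto
    then have 2: "card (C j \<inter> {..<x}) \<le> r - 1"
      using card_below[of j x] j by simp
    have "1 \<le> r" using c by (auto simp: cells_iff[OF \<nu>])
    then have "meets (\<lambda>j. - int j) C j"
      unfolding meets_def height_def using 1 2 by (intro exI[of _ x]) simp
    then show False using C j by (auto simp: straight_def)
  qed
next
  fix r j assume "(r, j) \<in> cells \<nu> \<and> (r + 1, j) \<in> cells \<nu>"
  then show "tableau_of \<nu> C (r, j) < tableau_of \<nu> C (r + 1, j)"
    by (intro tableau_of_strict[OF \<nu> C]) (auto simp: cells_iff[OF \<nu>])
qed

lemma card_ssyt: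
  assumes \<nu>: "is_part \<nu>"
  shows "int (card {T. ssyt \<nu> T \<and> (\<forall>i. card {x \<in> cells \<nu>. T x = i} = m i)}) = kcount (part \<nu> 1) (straight \<nu>) (\<lambda>x. int (m x))"
proof -
  have "bij_betw (columns_of \<nu>) {T. ssyt \<nu> T \<and> (\<forall>i. card {x \<in> cells \<nu>. T x = i} = m i)}
    {C \<in> straight \<nu>. \<forall>x. int (content (part \<nu> 1) C x) = int (m x)}"
  proof (rule bij_betw_byWitness[where f' = "tableau_of \<nu>"])
    show "\<forall>T\<in>{T. ssyt \<nu> T \<and> (\<forall>i. card {x \<in> cells \<nu>. T x = i} = m i)}. tableau_of \<nu> (columns_of \<nu> T) = T"
      using tableau_of_columns_of[OF \<nu>] by blast
    show "\<forall>C\<in>{C \<in> straight \<nu>. \<forall>x. int (content (part \<nu> 1) C x) = int (m x)}. columns_of \<nu> (tableau_of \<nu> C) = C"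
      using columns_of_tableau_of[OF \<nu>] by blast
    show "columns_of \<nu> ` {T. ssyt \<nu> T \<and> (\<forall>i. card {x \<in> cells \<nu>. T x = i} = m i)}
      \<subseteq> {C \<in> straight \<nu>. \<forall>x. int (content (part \<nu> 1) C x) = int (m x)}"
      using columns_of_straight[OF \<nu>] content_columns_of[OF \<nu>] by auto
    show "tableau_of \<nu> ` {C \<in> straight \<nu>. \<forall>x. int (content (part \<nu> 1) C x) = int (m x)}
      \<subseteq> {T. ssyt \<nu> T \<and> (\<forall>i. card {x \<in> cells \<nu>. T x = i} = m i)}"
    proof (rule image_subsetI)
      fix C assume C: "C \<in> {C \<in> straight \<nu>. \<forall>x. int (content (part \<nu> 1) C x) = int (m x)}"
      then have s: "C \<in> straight \<nu>" by blast
      show "tableau_of \<nu> C \<in> {T. ssyt \<nu> T \<and> (\<forall>i. card {x \<in> cells \<nu>. T x = i} = m i)}"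
        using tableau_of_ssyt[OF \<nu> s] content_columns_of[OF \<nu> tableau_of_ssyt[OF \<nu> s]] columns_of_tableau_of[OF \<nu> s] C
        by simp
    qed
  qed
  then show ?thesis
    unfolding kcount_def by (simp add: bij_betw_same_card)
qed

section \<open>Generating functions\<close>

text \<open>Finite fibres are demanded because \<open>card\<close> of an infinite set is 0. Only
  finitely supported monomials are considered, since for these \<open>fmul\<close> is a sum over a
  finite set.\<close>

definition is_gf :: "ser \<Rightarrow> 'a set \<Rightarrow> ('a \<Rightarrow> mono) \<Rightarrow> bool" where
  "is_gf f X wt \<longleftrightarrow> (\<forall>m. finsupp m \<longrightarrow> finite {x \<in> X. wt x = m} \<and> f m = int (card {x \<in> X. wt x = m}))"

lemma finsupp_le:
  assumes m: "finsupp m" and le: "\<And>p i. a p i \<le> m p i"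
  shows "finsupp a"
proof -
  have "{(p, i). a p i \<noteq> 0} \<subseteq> {(p, i). m p i \<noteq> 0}"
  proof
    fix x assume "x \<in> {(p, i). a p i \<noteq> 0}"
    then show "x \<in> {(p, i). m p i \<noteq> 0}"
      using le[of "fst x" "snd x"] by (cases x) auto
  qed
  then show ?thesis
    using m unfolding finsupp_def by (rule finite_subset)
qed

lemma finite_below:
  assumes "finsupp m"
  shows "finite {a :: mono. \<forall>p i. a p i \<le> m p i}"
proof -
  define S where "S = {(p, i). m p i \<noteq> 0}"
  have S: "finite S" using assms by (simp add: S_def finsupp_def)
  define B where "B = (\<Sum>x\<in>S. m (fst x) (snd x))"
  have B: "m p i \<le> B" for p i
  proof (cases "(p, i) \<in> S")
    case True
    then show ?thesis
      unfolding B_def using member_le_sum[OF True, of "\<lambda>x. m (fst x) (snd x)"] S by simp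
  qed (simp add: S_def)
  let ?F = "{f :: nat \<times> nat \<Rightarrow> nat. \<forall>x. (x \<in> S \<longrightarrow> f x \<in> {..B}) \<and> (x \<notin> S \<longrightarrow> f x = 0)}"
  have "{a :: mono. \<forall>p i. a p i \<le> m p i} \<subseteq> (\<lambda>f p i. f (p, i)) ` ?F"
  proof
    fix a :: mono assume a: "a \<in> {a. \<forall>p i. a p i \<le> m p i}"
    then have a': "a p i \<le> m p i" for p i by blast
    have "(\<lambda>x. a (fst x) (snd x)) \<in> ?F"
    proof (intro CollectI allI conjI impI)
      fix x show "a (fst x) (snd x) \<in> {..B}"
        using a'[of "fst x" "snd x"] B[of "fst x" "snd x"] by simp
      assume "x \<notin> S"
      then show "a (fst x) (snd x) = 0"
        using a'[of "fst x" "snd x"] by (cases x) (simp add: S_def)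
    qed
    then show "a \<in> (\<lambda>f p i. f (p, i)) ` ?F"
      by (rule rev_image_eqI) simp
  qed
  moreover have "finite ?F"
    by (rule finite_set_of_finite_funs[OF S]) simp
  ultimately show ?thesis
    by (meson finite_imageI finite_subset)
qed

lemma gf_fmul:
  assumes f: "is_gf f X u" and g: "is_gf g Y v"
  shows "is_gf (fmul f g) (X \<times> Y) (\<lambda>z p i. u (fst z) p i + v (snd z) p i)"
  unfolding is_gf_def
proof (intro allI impI)
  fix m assume m: "finsupp m"
  let ?A = "{a :: mono. \<forall>p i. a p i \<le> m p i}"
  let ?P = "\<lambda>a. {x \<in> X. u x = a} \<times> {y \<in> Y. v y = (\<lambda>p i. m p i - a p i)}"
  let ?Z = "{z \<in> X \<times> Y. (\<lambda>p i. u (fst z) p i + v (snd z) p i) = m}"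
  have Z: "?Z = (\<Union>a\<in>?A. ?P a)"
  proof (intro set_eqI iffI)
    fix z assume z: "z \<in> ?Z"
    then have e: "\<And>p i. u (fst z) p i + v (snd z) p i = m p i" by (auto simp: fun_eq_iff)
    have "u (fst z) \<in> ?A" by (simp add: e[symmetric])
    moreover have "v (snd z) = (\<lambda>p i. m p i - u (fst z) p i)"
      by (simp add: e[symmetric])
    ultimately show "z \<in> (\<Union>a\<in>?A. ?P a)"
      using z by (intro UN_I[of "u (fst z)"]) auto
  next
    fix z assume "z \<in> (\<Union>a\<in>?A. ?P a)"
    then obtain a where "a \<in> ?A" "z \<in> ?P a" by blast
    then show "z \<in> ?Z" by auto
  qed
  have fs: "finsupp a" "finsupp (\<lambda>p i. m p i - a p i)" if "a \<in> ?A" for a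
    using that finsupp_le[OF m] by auto
  have finP: "finite (?P a)" "int (card (?P a)) = f a * g (\<lambda>p i. m p i - a p i)" if "a \<in> ?A" for a
    using f g fs[OF that] unfolding is_gf_def by (auto simp: card_cartesian_product)
  have "finite ?Z" unfolding Z by (rule finite_UN_I[OF finite_below[OF m]]) (rule finP(1))
  moreover have "int (card ?Z) = (\<Sum>a\<in>?A. int (card (?P a)))"
    unfolding Z using finite_below[OF m] finP(1)
    by (subst card_UN_disjoint) auto
  ultimately show "finite ?Z \<and> fmul f g m = int (card ?Z)"
    unfolding fmul_def using finP(2) by simp
qed

lemma gf_bij:
  assumes f: "is_gf f X wt" and h: "bij_betw h Y X" and w: "\<And>y. y \<in> Y \<Longrightarrow> wt' y = wt (h y)"
  shows "is_gf f Y wt'"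
  unfolding is_gf_def
proof (intro allI impI)
  fix m assume m: "finsupp m"
  have "bij_betw h {y \<in> Y. wt' y = m} {x \<in> X. wt x = m}"
    using h w unfolding bij_betw_def by (auto simp: inj_on_def)
  then show "finite {y \<in> Y. wt' y = m} \<and> f m = int (card {y \<in> Y. wt' y = m})"
    using f m bij_betw_finite[of h "{y \<in> Y. wt' y = m}"] bij_betw_same_card[of h "{y \<in> Y. wt' y = m}"]
    unfolding is_gf_def by simp
qed

text \<open>The default \<open>u\<close> off the list turns each tuple into one total function; with
  \<open>undefined\<close> the tuples are those of \<open>PiE\<close>.\<close>

lemma gf_fprodl:
  assumes "distinct js" "\<And>j. j \<in> set js \<Longrightarrow> is_gf (f j) (X j) (wt j)"
  shows "is_gf (fprodl (map f js)) {C. (\<forall>j\<in>set js. C j \<in> X j) \<and> (\<forall>j. j \<notin> set js \<longrightarrow> C j = u)}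
    (\<lambda>C p i. \<Sum>j\<in>set js. wt j (C j) p i)"
  using assms
proof (induction js)
  case Nil
  have e0: "{C. \<forall>j. C j = u} = {\<lambda>_. u}" by auto
  then have e: "{C \<in> {C. \<forall>j. C j = u}. (\<lambda>p i. 0) = m} = (if m = (\<lambda>p i. 0) then {\<lambda>_. u} else {})" for m :: mono
    by auto
  then show ?case
    by (simp add: is_gf_def fprodl_def fone_def e0)
next
  case (Cons j js)
  let ?S = "\<lambda>js. {C. (\<forall>j\<in>set js. C j \<in> X j) \<and> (\<forall>j. j \<notin> set js \<longrightarrow> C j = u)}"
  have j: "j \<notin> set js" using Cons.prems by simp
  have "is_gf (fmul (f j) (fprodl (map f js))) (X j \<times> ?S js)
      (\<lambda>z p i. wt j (fst z) p i + (\<Sum>j\<in>set js. wt j (snd z j) p i))"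
    using Cons by (intro gf_fmul) auto
  moreover have "bij_betw (\<lambda>C. (C j, C(j := u))) (?S (j # js)) (X j \<times> ?S js)"
    by (rule bij_betw_byWitness[where f' = "\<lambda>z. (snd z)(j := fst z)"]) (use j in \<open>auto simp: fun_upd_idem_iff\<close>)
  ultimately have "is_gf (fmul (f j) (fprodl (map f js))) (?S (j # js))
    (\<lambda>C p i. \<Sum>j\<in>set (j # js). wt j (C j) p i)"
  proof (rule gf_bij)
    fix C
    have "(\<Sum>j'\<in>set js. wt j' ((C(j := u)) j') p i) = (\<Sum>j'\<in>set js. wt j' (C j') p i)" for p i
      using j by (intro sum.cong) auto
    then show "(\<lambda>p i. \<Sum>j\<in>set (j # js). wt j (C j) p i) = (\<lambda>p i. wt j (fst (C j, C(j := u))) p i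
        + (\<Sum>j'\<in>set js. wt j' (snd (C j, C(j := u)) j') p i))"
      using j by (simp only: fst_conv snd_conv list.set sum.insert[OF finite_set j])
  qed
  then show ?case by (simp add: fprodl_def)
qed

lemma gf_e_ser: "is_gf (e_ser p d) {A. finite A \<and> int (card A) = d} (\<lambda>A q i. of_bool (q = p \<and> i \<in> A))"
  unfolding is_gf_def
proof (intro allI impI)
  fix m assume m: "finsupp m"
  let ?S = "{A \<in> {A. finite A \<and> int (card A) = d}. (\<lambda>q i. of_bool (q = p \<and> i \<in> A)) = m}"
  let ?A = "{i. m p i = 1}"
  have one: "A = ?A" if "(\<lambda>q i. of_bool (q = p \<and> i \<in> A)) = m" for A
  proof -
    have "m p i = of_bool (i \<in> A)" for i using that by auto
    then show ?thesis by auto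
  qed
  show "finite ?S \<and> e_ser p d m = int (card ?S)"
  proof (cases "(\<forall>q i. q \<noteq> p \<longrightarrow> m q i = 0) \<and> (\<forall>i. m p i \<le> 1) \<and> finite ?A \<and> int (card ?A) = d")
    case True
    have "of_bool (q = p \<and> i \<in> ?A) = m q i" for q i
      using True le_Suc_eq[of "m p i" 0] by (cases "q = p") auto
    then have "?A \<in> ?S" using True by (simp add: fun_eq_iff)
    then have "?S = {?A}" using one by blast
    then show ?thesis using True by (simp add: e_ser_def)
  next
    case False
    have "?S = {}"
    proof (rule ccontr)
      assume "?S \<noteq> {}"
      then obtain A where A: "finite A" "int (card A) = d" "(\<lambda>q i. of_bool (q = p \<and> i \<in> A)) = m" by blast
      have "A = ?A" by (rule one[OF A(3)])
      moreover have "m q i = of_bool (q = p \<and> i \<in> A)" for q i using A(3) by auto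
      ultimately show False using False A(1,2) by (auto simp: of_bool_def split: if_splits)
    qed
    then show ?thesis using False unfolding e_ser_def by (simp only: if_False) simp
  qed
qed

lemma gf_schur:
  assumes \<nu>: "is_part \<nu>"
  shows "is_gf (schur_ser p \<nu>) (straight \<nu>) (\<lambda>C q i. if q = p then content (part \<nu> 1) C i else 0)"
  unfolding is_gf_def
proof (intro allI impI)
  have if_card: "finite (if P then K else {}) \<and> (if P then int (card K) else 0) = int (card (if P then K else {}))"
    if "finite K" for P and K :: "'b set"
    using that by simp
  fix m :: mono assume "finsupp m"
  let ?S = "{C \<in> straight \<nu>. (\<lambda>q i. if q = p then content (part \<nu> 1) C i else 0) = m}"
  let ?K = "{C \<in> straight \<nu>. \<forall>x. int (content (part \<nu> 1) C x) = int (m p x)}"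
  have S: "?S = (if \<forall>q i. q \<noteq> p \<longrightarrow> m q i = 0 then ?K else {})"
    by (auto simp: fun_eq_iff split: if_splits)
  have "straight \<nu> \<subseteq> columns (part \<nu> 1) (\<lambda>j. int (col_len \<nu> j))" by (auto simp: straight_def)
  then have "finite ?K" by (rule finite_with_content)
  then show "finite ?S \<and> schur_ser p \<nu> m = int (card ?S)"
    unfolding S schur_ser_def card_ssyt[OF \<nu>] kcount_def by (rule if_card)
qed

text \<open>The factors use disjoint variable sets, so a monomial splits among them in only one way,
  and a variable from a set beyond k makes the coefficient vanish.\<close>

lemma fprodl_separated:
  assumes gf: "\<And>p. p < k \<Longrightarrow> is_gf (f p) (X p) (\<lambda>C q i. if q = p then w p C i else 0)" and m: "finsupp m"
  shows "fprodl (map f [0..<k]) m =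
    (if \<forall>q\<ge>k. \<forall>i. m q i = 0 then \<Prod>p<k. int (card {C \<in> X p. \<forall>i. w p C i = m p i}) else 0)"
proof -
  let ?wt = "\<lambda>C q i. \<Sum>j\<in>set [0..<k]. if q = j then w j (C j) i else 0"
  let ?S = "{C \<in> {C. (\<forall>j\<in>set [0..<k]. C j \<in> X j) \<and> (\<forall>j. j \<notin> set [0..<k] \<longrightarrow> C j = undefined)}. ?wt C = m}"
  have wt: "?wt C q i = (if q < k then w q (C q) i else 0)" for C q i
    by (simp add: sum.delta')
  have "fprodl (map f [0..<k]) m = int (card ?S)"
    using gf_fprodl[of "[0..<k]" f X "\<lambda>p C q i. if q = p then w p C i else 0"] gf m
    unfolding is_gf_def by auto
  also have "?S = (if \<forall>q\<ge>k. \<forall>i. m q i = 0 then PiE {..<k} (\<lambda>p. {C \<in> X p. \<forall>i. w p C i = m p i}) else {})"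
  proof (cases "\<forall>q\<ge>k. \<forall>i. m q i = 0")
    case True
    have "?wt C = m \<longleftrightarrow> (\<forall>q<k. \<forall>i. w q (C q) i = m q i)" for C
      unfolding fun_eq_iff wt using True by (auto simp: not_less)
    then show ?thesis
      using True by (auto simp: PiE_iff extensional_def)
  next
    case False
    then obtain q i where "q \<ge> k" "m q i \<noteq> 0" by auto
    then have "?wt C \<noteq> m" for C
      unfolding fun_eq_iff wt by (metis not_le)
    then have "?S = {}" by blast
    then show ?thesis using False by (simp only: if_False)
  qed
  also have "int (card \<dots>) = (if \<forall>q\<ge>k. \<forall>i. m q i = 0 then \<Prod>p<k. int (card {C \<in> X p. \<forall>i. w p C i = m p i}) else 0)"
    unfolding if_distrib[of card] if_distrib[of int] card_PiE[OF finite_lessThan] of_nat_prod card.empty of_nat_0 ..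
  finally show ?thesis .
qed

lemma gf_hjt_entry:
  "is_gf (fprodl (map (\<lambda>p. e_ser p (d p)) [0..<k])) (PiE {..<k} (\<lambda>p. {A. finite A \<and> int (card A) = d p}))
    (\<lambda>C q x. of_bool (q < k \<and> x \<in> C q))"
proof -
  have wt: "(\<lambda>q x. of_bool (q < k \<and> x \<in> C q) :: nat) = (\<lambda>q x. \<Sum>j\<in>set [0..<k]. of_bool (q = j \<and> x \<in> C j))" for C
  proof (intro ext)
    fix q x
    have "(\<Sum>j\<in>set [0..<k]. of_bool (q = j \<and> x \<in> C j) :: nat) = (\<Sum>j\<in>set [0..<k]. if q = j then of_bool (x \<in> C j) else 0)"
      by (intro sum.cong) auto
    then show "(of_bool (q < k \<and> x \<in> C q) :: nat) = (\<Sum>j\<in>set [0..<k]. of_bool (q = j \<and> x \<in> C j))"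
      by (simp add: sum.delta')
  qed
  have set: "PiE {..<k} (\<lambda>p. {A. finite A \<and> int (card A) = d p})
      = {C. (\<forall>j\<in>set [0..<k]. C j \<in> {A. finite A \<and> int (card A) = d j}) \<and> (\<forall>j. j \<notin> set [0..<k] \<longrightarrow> C j = undefined)}"
    by (auto simp: PiE_iff extensional_def)
  show ?thesis
    unfolding wt set by (rule gf_fprodl) (auto intro: gf_e_ser)
qed

text \<open>A choice of terms assigns to each row one set for every shape. Exchanging the two
  indices gives one tuple of columns for every shape, and the coefficient factors over the
  shapes.\<close>

lemma hjt_product_coeff:
  assumes m: "finsupp m"
  shows "fprodl (map (\<lambda>i. fprodl (map (\<lambda>p. e_ser p (d p i)) [0..<k])) [1..<n + 1]) m =
    (if \<forall>q\<ge>k. \<forall>i. m q i = 0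
     then \<Prod>p<k. int (card {D \<in> columns n (d p). content n D = m p}) else 0)"
proof -
  let ?J = "[1..<n + 1]"
  let ?E = "\<lambda>i. PiE {..<k} (\<lambda>p. {A. finite A \<and> int (card A) = d p i})"
  let ?wt = "\<lambda>C q x. \<Sum>i\<in>set ?J. (of_bool (q < k \<and> x \<in> C i q) :: nat)"
  let ?S = "{C \<in> {C. (\<forall>i\<in>set ?J. C i \<in> ?E i) \<and> (\<forall>i. i \<notin> set ?J \<longrightarrow> C i = undefined)}. ?wt C = m}"
  let ?K = "\<lambda>p. {D \<in> columns n (d p). content n D = m p}"
  have J: "set ?J = {1..n}" by auto
  have "fprodl (map (\<lambda>i. fprodl (map (\<lambda>p. e_ser p (d p i)) [0..<k])) ?J) m = int (card ?S)"
    using gf_fprodl[of "?J" "\<lambda>i. fprodl (map (\<lambda>p. e_ser p (d p i)) [0..<k])" ?E "\<lambda>i C q x. of_bool (q < k \<and> x \<in> C q)" "undefined"]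
      gf_hjt_entry m unfolding is_gf_def by auto
  moreover have wt: "?wt C q x = (if q < k then card {i \<in> {1..n}. x \<in> C i q} else 0)" for C q x
    unfolding J by (auto simp: Int_def)
  have "card ?S = (if \<forall>q\<ge>k. \<forall>i. m q i = 0 then card (PiE {..<k} ?K) else 0)"
  proof (cases "\<forall>q\<ge>k. \<forall>i. m q i = 0")
    case True
    \<comment> \<open>Off {1..n} one side has the value \<open>undefined\<close> and the other the
      empty set; both maps reset it.\<close>
    define to_pi where "to_pi = (\<lambda>(C :: nat \<Rightarrow> nat \<Rightarrow> nat set). \<lambda>p\<in>{..<k}. \<lambda>i. if i \<in> {1..n} then C i p else {})"
    define from_pi where "from_pi = (\<lambda>(D :: nat \<Rightarrow> nat \<Rightarrow> nat set) i. if i \<in> {1..n} then (\<lambda>p\<in>{..<k}. D p i) else undefined)"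
    have "bij_betw to_pi ?S (PiE {..<k} ?K)"
    proof (rule bij_betw_byWitness[where f' = from_pi])
      show "\<forall>C\<in>?S. from_pi (to_pi C) = C"
      proof (intro ballI ext)
        fix C i p assume C: "C \<in> ?S"
        show "from_pi (to_pi C) i p = C i p"
        proof (cases "i \<in> {1..n}")
          case i: True
          then have "C i \<in> ?E i" using C unfolding J by blast
          then show ?thesis using i by (auto simp: from_pi_def to_pi_def PiE_iff extensional_def)
        next
          case False
          then have "C i = undefined" using C unfolding J by blast
          then show ?thesis using False unfolding from_pi_def by (simp only: if_False)
        qed
      qed
      show "\<forall>D\<in>PiE {..<k} ?K. to_pi (from_pi D) = D"
      proof (intro ballI ext)
        fix D p i assume D: "D \<in> PiE {..<k} ?K"
        show "to_pi (from_pi D) p i = D p i"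
        proof (cases "p < k")
          case True
          then have "D p \<in> columns n (d p)" using D by (auto simp: PiE_iff)
          then show ?thesis using True by (auto simp: from_pi_def to_pi_def columns_def)
        next
          case False
          then show ?thesis using D by (auto simp: to_pi_def PiE_iff extensional_def)
        qed
      qed
      show "to_pi ` ?S \<subseteq> PiE {..<k} ?K"
      proof (intro image_subsetI PiE_I)
        fix C p assume C: "C \<in> ?S"
        show "p \<notin> {..<k} \<Longrightarrow> to_pi C p = undefined" by (simp add: to_pi_def)
        assume p: "p \<in> {..<k}"
        have E: "C i p \<in> {A. finite A \<and> int (card A) = d p i}" if "i \<in> {1..n}" for i
        proof -
          have "C i \<in> ?E i" using C that unfolding J by blast
          then show ?thesis using p by (rule PiE_mem)
        qed
        have top: "to_pi C p = (\<lambda>i. if i \<in> {1..n} then C i p else {})" using p by (simp add: to_pi_def)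
        have "to_pi C p \<in> columns n (d p)"
          unfolding columns_def top using E by auto
        moreover have "content n (to_pi C p) x = m p x" for x
        proof -
          have "?wt C p x = m p x" using C by (auto simp: fun_eq_iff)
          moreover have "{i \<in> {1..n}. x \<in> to_pi C p i} = {i \<in> {1..n}. x \<in> C i p}" by (auto simp: top)
          ultimately show ?thesis using p unfolding wt content_def by simp
        qed
        ultimately show "to_pi C p \<in> ?K p" by (auto simp: fun_eq_iff)
      qed
      show "from_pi ` PiE {..<k} ?K \<subseteq> ?S"
      proof (rule image_subsetI)
        fix D assume D: "D \<in> PiE {..<k} ?K"
        have Dp: "D p \<in> columns n (d p)" "content n (D p) = m p" if "p < k" for p
          using D that by (auto simp: PiE_iff)
        have "from_pi D i \<in> ?E i" if "i \<in> {1..n}" for i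
          using Dp(1) that by (auto simp: from_pi_def columns_def)
        moreover have "from_pi D i = undefined" if "i \<notin> {1..n}" for i
          unfolding from_pi_def using that by (simp only: if_False)
        moreover have "?wt (from_pi D) q x = m q x" for q x
        proof (cases "q < k")
          case q: True
          then have "{i \<in> {1..n}. x \<in> from_pi D i q} = {i \<in> {1..n}. x \<in> D q i}"
            by (auto simp: from_pi_def)
          then show ?thesis using q Dp(2)[OF q] unfolding wt by (simp add: content_def fun_eq_iff)
        next
          case False
          then show ?thesis unfolding wt using True by simp
        qed
        then have "?wt (from_pi D) = m" by (intro ext)
        ultimately show "from_pi D \<in> ?S" unfolding J by blast
      qed
    qed
    then have "card ?S = card (PiE {..<k} ?K)" by (rule bij_betw_same_card)
    then show ?thesis by (simp only: if_P[OF True])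
  next
    case False
    then obtain q i where "q \<ge> k" "m q i \<noteq> 0" by auto
    then have "?wt C \<noteq> m" for C
      unfolding fun_eq_iff wt by (metis not_le)
    then have "?S = {}" by blast
    then show ?thesis by (simp only: if_not_P[OF False] card.empty)
  qed
  moreover have "card (PiE {..<k} ?K) = (\<Prod>p<k. card (?K p))"
    by (simp add: card_PiE)
  ultimately show ?thesis
    by (simp only: if_distrib[of int] of_nat_prod of_nat_0)
qed

section \<open>The signed sum over Hessenberg permutations\<close>

lemma no_block_bound:
  assumes "is_part la" "is_part mu" "no_3x2_block la mu" "1 \<le> i"
  shows "part la (Suc (Suc i)) \<le> Suc (part mu i)"
proof (rule ccontr)
  assume "\<not> ?thesis"
  then have big: "part mu i + 2 \<le> part la (Suc (Suc i))" by simp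
  have la: "part la (Suc (Suc i)) \<le> part la r" if "r \<in> {i, i + 1, i + 2}" for r
    using that assms(4) by (intro part_antimono[OF assms(1)]) auto
  have mu: "part mu r \<le> part mu i" if "r \<in> {i, i + 1, i + 2}" for r
    using that assms(4) by (intro part_antimono[OF assms(2)]) auto
  \<comment> \<open>The forbidden block would occupy the first two columns beyond mu_i.\<close>
  have "part mu r < c \<and> c \<le> part la r" if "r \<in> {i, i + 1, i + 2}" "c \<in> {part mu i + 1, part mu i + 1 + 1}" for r c
    using la[OF that(1)] mu[OF that(1)] big that(2) by auto
  then have "{(i, part mu i + 1), (i, part mu i + 1 + 1), (i + 1, part mu i + 1), (i + 1, part mu i + 1 + 1),
      (i + 2, part mu i + 1), (i + 2, part mu i + 1 + 1)} \<subseteq> {(r, c). 1 \<le> r \<and> part mu r < c \<and> c \<le> part la r}"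
    using assms(4) by auto
  then show False
    using assms(3) unfolding no_3x2_block_def by blast
qed

text \<open>The set chosen in row i is a path from \<open>b (hess_perm S i)\<close> to
  \<open>a i\<close>. Composing with the inverse permutation indexes it by its start and keeps the
  content.\<close>

lemma columns_by_end:
  assumes v: "S \<subseteq> {1..<n}"
  shows "card {D \<in> columns n (\<lambda>i. a i - b (hess_perm S i)). content n D = c}
    = card (path_tuples n a b (hess_inv S) {} c)"
proof -
  let ?w = "hess_perm S" and ?v = "hess_inv S"
  have wv: "?w (?v x) = x" "?v (?w x) = x" for x
    using hess_inv_inverse[of S] by (metis comp_apply id_apply)+
  have p: "?w permutes {1..n}" "?v permutes {1..n}"
    using hess_perm_permutes hess_inv_permutes assms by auto
  have in_iff: "?w i \<in> {1..n} \<longleftrightarrow> i \<in> {1..n}" "?v i \<in> {1..n} \<longleftrightarrow> i \<in> {1..n}" for i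
    using permutes_in_image[OF p(1)] permutes_in_image[OF p(2)] by auto
  have cont: "content n (D \<circ> u) = content n D" if u: "u permutes {1..n}" for D u
  proof
    fix x
    have "{j \<in> {1..n}. x \<in> D j} = u ` {j \<in> {1..n}. x \<in> (D \<circ> u) j}"
    proof (intro set_eqI iffI)
      fix j assume j: "j \<in> {j \<in> {1..n}. x \<in> D j}"
      have "inv u j \<in> {1..n}" "u (inv u j) = j"
        using permutes_in_image[OF permutes_inv[OF u]] permutes_inverses(1)[OF u] j by auto
      then show "j \<in> u ` {j \<in> {1..n}. x \<in> (D \<circ> u) j}"
        using j by (intro image_eqI[of _ _ "inv u j"]) auto
    next
      fix j assume "j \<in> u ` {j \<in> {1..n}. x \<in> (D \<circ> u) j}"
      then show "j \<in> {j \<in> {1..n}. x \<in> D j}"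
        using permutes_in_image[OF u] by auto
    qed
    moreover have "card (u ` {j \<in> {1..n}. x \<in> (D \<circ> u) j}) = card {j \<in> {1..n}. x \<in> (D \<circ> u) j}"
      by (rule card_image[OF permutes_inj_on[OF u]])
    ultimately show "content n (D \<circ> u) x = content n D x"
      unfolding content_def by argo
  qed
  have "bij_betw (\<lambda>D. D \<circ> ?v) {D \<in> columns n (\<lambda>i. a i - b (?w i)). content n D = c} (path_tuples n a b ?v {} c)"
  proof (rule bij_betw_byWitness[where f' = "\<lambda>D. D \<circ> ?w"])
    show "(\<lambda>D. D \<circ> ?v) ` {D \<in> columns n (\<lambda>i. a i - b (?w i)). content n D = c} \<subseteq> path_tuples n a b ?v {} c"
    proof (rule image_subsetI)
      fix D assume D: "D \<in> {D \<in> columns n (\<lambda>i. a i - b (?w i)). content n D = c}"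
      then have out: "\<And>j. j \<notin> {1..n} \<Longrightarrow> D j = {}"
        and ins: "\<And>j. j \<in> {1..n} \<Longrightarrow> finite (D j) \<and> int (card (D j)) = a j - b (?w j)"
        by (auto simp: columns_def)
      have "(D \<circ> ?v) \<in> columns n (\<lambda>j. a (?v j) - b j)"
        unfolding columns_def
      proof (intro CollectI conjI allI impI ballI)
        fix j assume "j \<notin> {1..n}"
        then show "(D \<circ> ?v) j = {}" unfolding comp_apply by (intro out) (simp only: in_iff(2) not_False_eq_True)
      next
        fix j assume "j \<in> {1..n}"
        then have "?v j \<in> {1..n}" using in_iff by blast
        then show "finite ((D \<circ> ?v) j)" "int (card ((D \<circ> ?v) j)) = a (?v j) - b j"
          using ins[of "?v j"] by (simp_all add: wv)
      qed
      then show "D \<circ> ?v \<in> path_tuples n a b ?v {} c"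
        using D cont[OF p(2)] by (simp add: path_tuples_def del: comp_apply)
    qed
    show "(\<lambda>D. D \<circ> ?w) ` path_tuples n a b ?v {} c \<subseteq> {D \<in> columns n (\<lambda>i. a i - b (?w i)). content n D = c}"
    proof (rule image_subsetI)
      fix D assume D: "D \<in> path_tuples n a b ?v {} c"
      then have out: "\<And>j. j \<notin> {1..n} \<Longrightarrow> D j = {}"
        and ins: "\<And>j. j \<in> {1..n} \<Longrightarrow> finite (D j) \<and> int (card (D j)) = a (?v j) - b j"
        by (auto simp: path_tuples_def columns_def)
      have "(D \<circ> ?w) \<in> columns n (\<lambda>i. a i - b (?w i))"
        unfolding columns_def
      proof (intro CollectI conjI allI impI ballI)
        fix j assume "j \<notin> {1..n}"
        then show "(D \<circ> ?w) j = {}" unfolding comp_apply by (intro out) (simp only: in_iff(1) not_False_eq_True)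
      next
        fix j assume "j \<in> {1..n}"
        then have "?w j \<in> {1..n}" using in_iff by blast
        then show "finite ((D \<circ> ?w) j)" "int (card ((D \<circ> ?w) j)) = a j - b (?w j)"
          using ins[of "?w j"] by (simp_all add: wv)
      qed
      then show "D \<circ> ?w \<in> {D \<in> columns n (\<lambda>i. a i - b (?w i)). content n D = c}"
        using D cont[OF p(1)] by (simp add: path_tuples_def del: comp_apply)
    qed
  qed (simp_all add: fun_eq_iff wv)
  then show ?thesis by (rule bij_betw_same_card)
qed

text \<open>Moebius inversion on subsets. Splitting the sign of S - T into the signs of S and T
  gives the self-inverse form of inclusion-exclusion.\<close>

lemma signed_subset_sum_inverse:
  fixes g :: "'a set \<Rightarrow> int"
  assumes "finite I" and f: "\<And>S. S \<subseteq> I \<Longrightarrow> f S = (\<Sum>T\<in>Pow S. (-1) ^ card (S - T) * g T)"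
  shows "(\<Sum>S\<in>Pow I. f S) = g I"
proof -
  define h where "h = (\<lambda>S. \<Sum>T\<in>Pow S. (-1) ^ card T * g T)"
  have "g I = (\<Sum>S\<in>Pow I. (-1) ^ card S * h S)"
    by (rule inclusion_exclusion_symmetric[OF _ assms(1)]) (simp add: h_def)
  also have "\<dots> = (\<Sum>S\<in>Pow I. f S)"
  proof (rule sum.cong[OF refl])
    fix S assume S: "S \<in> Pow I"
    have "(-1 :: int) ^ card S * (-1) ^ card T = (-1) ^ card (S - T)" if "T \<in> Pow S" for T
    proof -
      have fS: "finite S" using S assms(1) finite_subset by blast
      then have "card S = card (S - T) + card T"
        using that by (metis PowD card_Diff_subset card_mono finite_subset le_add_diff_inverse2)
      then show ?thesis by (simp add: power_add mult.assoc flip: power_mult_distrib)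
    qed
    then show "(-1) ^ card S * h S = f S"
      using f S by (simp add: h_def sum_distrib_left mult.assoc[symmetric])
  qed
  finally show ?thesis ..
qed

lemma PiE_fibre:
  assumes U: "U \<in> PiE A B"
  shows "{C \<in> PiE A Z. (\<lambda>p\<in>A. h p (C p)) = U} = PiE A (\<lambda>p. {c \<in> Z p. h p c = U p})"
proof -
  have "(\<lambda>p\<in>A. h p (C p)) = U \<longleftrightarrow> (\<forall>p\<in>A. h p (C p) = U p)" for C
    using U by (auto simp: fun_eq_iff PiE_iff extensional_def)
  then show ?thesis
    unfolding PiE_def Pi_def by blast
qed

context
  fixes n k :: nat and a b :: "nat \<Rightarrow> nat \<Rightarrow> int" and f g :: "nat set \<Rightarrow> int"
  assumes a: "\<And>p i j. p < k \<Longrightarrow> 1 \<le> i \<Longrightarrow> i < j \<Longrightarrow> j \<le> n \<Longrightarrow> a p j < a p i"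
    and b: "\<And>p i. p < k \<Longrightarrow> 1 \<le> i \<Longrightarrow> i < n \<Longrightarrow> b p (Suc i) < b p i"
    and ab: "\<And>p i. p < k \<Longrightarrow> 1 \<le> i \<Longrightarrow> Suc (Suc i) \<le> n \<Longrightarrow> a p (Suc (Suc i)) < b p i"
    and f: "\<And>S. S \<subseteq> {1..<n} \<Longrightarrow> f S = (\<Sum>T\<in>Pow S. (-1) ^ card (S - T) * g T)"
    and g: "\<And>T. 0 \<le> g T"
begin

private abbreviation "J \<equiv> {1..<n}"
private abbreviation "tuples p \<equiv> columns n (\<lambda>j. a p j - b p j)"
private abbreviation "meeting p C \<equiv> {i \<in> J. meets (b p) C i}"
private abbreviation "classes p U \<equiv> {C \<in> tuples p. meeting p C = U}"

text \<open>A family \<open>C\<close> of column tuples, one for each shape, is counted in the term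
  of \<open>S\<close> iff \<open>S\<close> lies in the set \<open>I C\<close> of neighbours that
  meet in every shape. Its total weight is the sum of \<open>f\<close> over the subsets of
  \<open>I C\<close>, which is \<open>g (I C)\<close>.\<close>

lemma signed_product_eq:
  fixes m :: mono
  shows "(\<Sum>S\<in>Pow J. f S * (\<Prod>p<k. int (card {D \<in> columns n (\<lambda>i. a p i - b p (hess_perm S i)). content n D = m p})))
    = (\<Sum>U\<in>PiE {..<k} (\<lambda>_. Pow J). g (J \<inter> (\<Inter>p<k. U p)) * (\<Prod>p<k. kcount n (classes p (U p)) (\<lambda>x. int (m p x))))"
proof -
  define Z where "Z = (\<lambda>p. {C \<in> tuples p. content n C = m p})"
  let ?Us = "PiE {..<k} (\<lambda>_. Pow J)"
  define I where "I = (\<lambda>C. J \<inter> (\<Inter>p<k. meeting p (C p)))"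
  have finZ: "finite (Z p)" for p
    using finite_with_content[of "tuples p" n "\<lambda>j. a p j - b p j" "\<lambda>x. int (m p x)"]
    by (simp add: Z_def fun_eq_iff)
  have finPi: "finite (PiE {..<k} Z)"
    by (intro finite_PiE finZ) simp
  \<comment> \<open>The tail swaps turn the tuples of the permuted matrix entries into tuples of the
    skew shape itself that meet at every element of \<open>S\<close>.\<close>
  have "int (card {D \<in> columns n (\<lambda>i. a p i - b p (hess_perm S i)). content n D = m p})
      = int (card {C \<in> Z p. S \<subseteq> meeting p C})" if S: "S \<in> Pow J" and p: "p < k" for S p
  proof -
    have "card {D \<in> columns n (\<lambda>i. a p i - b p (hess_perm S i)). content n D = m p}
        = card (path_tuples n (a p) (b p) (hess_inv S) {} (m p))"
      using S by (intro columns_by_end) auto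
    also have "\<dots> = card (path_tuples n (a p) (b p) id (S \<union> {}) (m p))"
      by (rule hess_path_tuples_card[symmetric]) (use S a[OF p] b[OF p] ab[OF p] in auto)
    also have "path_tuples n (a p) (b p) id (S \<union> {}) (m p) = {C \<in> Z p. S \<subseteq> meeting p C}"
      using S by (auto simp: path_tuples_def Z_def)
    finally show ?thesis by simp
  qed
  then have "(\<Sum>S\<in>Pow J. f S * (\<Prod>p<k. int (card {D \<in> columns n (\<lambda>i. a p i - b p (hess_perm S i)). content n D = m p})))
    = (\<Sum>S\<in>Pow J. f S * (\<Prod>p<k. int (card {C \<in> Z p. S \<subseteq> meeting p C})))"
    by (intro sum.cong refl arg_cong2[where f = "(*)"] prod.cong) auto
  also have "\<dots> = (\<Sum>S\<in>Pow J. f S * (\<Sum>C\<in>PiE {..<k} Z. of_bool (S \<subseteq> I C)))"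
  proof (rule sum.cong[OF refl])
    fix S assume S: "S \<in> Pow J"
    have "(\<Prod>p<k. int (card {C \<in> Z p. S \<subseteq> meeting p C})) = int (card (PiE {..<k} (\<lambda>p. {C \<in> Z p. S \<subseteq> meeting p C})))"
      by (simp add: card_PiE)
    also have "PiE {..<k} (\<lambda>p. {C \<in> Z p. S \<subseteq> meeting p C}) = {C \<in> PiE {..<k} Z. S \<subseteq> I C}"
      using S unfolding I_def PiE_def Pi_def by blast
    also have "int (card \<dots>) = (\<Sum>C\<in>PiE {..<k} Z. of_bool (S \<subseteq> I C))"
      using finPi by (simp add: Int_def)
    finally show "f S * (\<Prod>p<k. int (card {C \<in> Z p. S \<subseteq> meeting p C})) = f S * (\<Sum>C\<in>PiE {..<k} Z. of_bool (S \<subseteq> I C))"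
      by (rule arg_cong)
  qed
  also have "\<dots> = (\<Sum>C\<in>PiE {..<k} Z. \<Sum>S\<in>Pow J. f S * of_bool (S \<subseteq> I C))"
    unfolding sum_distrib_left by (rule sum.swap)
  also have "\<dots> = (\<Sum>C\<in>PiE {..<k} Z. g (I C))"
  proof (rule sum.cong[OF refl])
    fix C
    have IJ: "I C \<subseteq> J" by (auto simp: I_def)
    have "(\<Sum>S\<in>Pow J. f S * of_bool (S \<subseteq> I C)) = (\<Sum>S\<in>Pow (I C). f S * of_bool (S \<subseteq> I C))"
      using IJ by (intro sum.mono_neutral_right) auto
    also have "\<dots> = (\<Sum>S\<in>Pow (I C). f S)" by (intro sum.cong) auto
    also have "\<dots> = g (I C)"
      using IJ f by (intro signed_subset_sum_inverse) (auto intro: finite_subset)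
    finally show "(\<Sum>S\<in>Pow J. f S * of_bool (S \<subseteq> I C)) = g (I C)" .
  qed
  \<comment> \<open>Families are grouped by their exact meeting sets, on which alone the weight
    depends.\<close>
  also have "\<dots> = (\<Sum>U\<in>PiE {..<k} (\<lambda>_. Pow J). \<Sum>C\<in>{C \<in> PiE {..<k} Z. (\<lambda>p\<in>{..<k}. meeting p (C p)) = U}. g (I C))"
  proof (rule sum.group[symmetric, OF finPi])
    show "finite ?Us" by (intro finite_PiE) auto
    show "(\<lambda>C. \<lambda>p\<in>{..<k}. meeting p (C p)) ` PiE {..<k} Z \<subseteq> ?Us"
      by (intro image_subsetI restrict_PiE_iff[THEN iffD2] ballI PowI) blast
  qed
  also have "\<dots> = (\<Sum>U\<in>PiE {..<k} (\<lambda>_. Pow J). g (J \<inter> (\<Inter>p<k. U p)) * (\<Prod>p<k. kcount n (classes p (U p)) (\<lambda>x. int (m p x))))"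
  proof (rule sum.cong[OF refl])
    fix U assume U: "U \<in> PiE {..<k} (\<lambda>_. Pow J)"
    let ?L = "{C \<in> PiE {..<k} Z. (\<lambda>p\<in>{..<k}. meeting p (C p)) = U}"
    let ?R = "PiE {..<k} (\<lambda>p. {C \<in> classes p (U p). \<forall>x. int (content n C x) = int (m p x)})"
    have "?L = PiE {..<k} (\<lambda>p. {C \<in> Z p. meeting p C = U p})"
      by (rule PiE_fibre[OF U])
    also have "\<dots> = ?R"
      unfolding Z_def of_nat_eq_iff fun_eq_iff by (intro PiE_cong) blast
    finally have "?L = ?R" .
    then have "(\<Sum>C\<in>?L. g (I C)) = (\<Sum>C\<in>?R. g (I C))" by simp
    also have "\<dots> = (\<Sum>C\<in>?R. g (J \<inter> (\<Inter>p<k. U p)))"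
    proof (rule sum.cong[OF refl])
      fix C assume C: "C \<in> ?R"
      have "meeting p (C p) = U p" if "p < k" for p
        using PiE_mem[OF C, of p] that by simp
      then show "g (I C) = g (J \<inter> (\<Inter>p<k. U p))" by (simp add: I_def)
    qed
    also have "\<dots> = g (J \<inter> (\<Inter>p<k. U p)) * int (card ?R)" by (simp only: sum_constant mult.commute)
    also have "int (card ?R) = (\<Prod>p<k. kcount n (classes p (U p)) (\<lambda>x. int (m p x)))"
      by (simp add: card_PiE kcount_def)
    finally show "(\<Sum>C\<in>?L. g (I C)) = g (J \<inter> (\<Inter>p<k. U p)) * (\<Prod>p<k. kcount n (classes p (U p)) (\<lambda>x. int (m p x)))" .
  qed
  finally show ?thesis .
qed

lemma schur_positive_signed_product:
  assumes F: "\<And>m. finsupp m \<Longrightarrow> F m = (\<Sum>S\<in>Pow J. f S *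
    fprodl (map (\<lambda>i. fprodl (map (\<lambda>p. e_ser p (a p i - b p (hess_perm S i))) [0..<k])) [1..<n + 1]) m)"
  shows "schur_positive k F"
proof -
  let ?U = "PiE {..<k} (\<lambda>_. Pow J)"
  \<comment> \<open>Littlewood-Richardson counts of the classes, weighted by \<open>g\<close> at the
    common meeting set. No monomial enters, so one coefficient function serves all of them.\<close>
  define c where "c = (\<lambda>\<nu> :: nat list list. \<Sum>U\<in>?U. g (J \<inter> (\<Inter>p<k. U p)) * (\<Prod>p<k. int (highest_count n (classes p (U p)) (\<nu> ! p))))"
  have c: "0 \<le> c \<nu>" for \<nu>
    unfolding c_def by (intro sum_nonneg mult_nonneg_nonneg g prod_nonneg) auto
  have main: "F m = (\<Sum>\<nu>\<in>{\<nu>. length \<nu> = k \<and> (\<forall>p<k. is_part (\<nu> ! p) \<and> sum_list (\<nu> ! p) = deg p m)}.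
      c \<nu> * fprodl (map (\<lambda>p. schur_ser p (\<nu> ! p)) [0..<k]) m)" if m: "finsupp m" for m
  proof -
    let ?L = "{\<nu>. length \<nu> = k \<and> (\<forall>p<k. is_part (\<nu> ! p) \<and> sum_list (\<nu> ! p) = deg p m)}"
    let ?K = "\<lambda>\<kappa> p. kcount (part \<kappa> 1) (straight \<kappa>) (\<lambda>x. int (m p x))"
    have schur: "fprodl (map (\<lambda>p. schur_ser p (\<nu> ! p)) [0..<k]) m
      = (if \<forall>q\<ge>k. \<forall>i. m q i = 0 then \<Prod>p<k. ?K (\<nu> ! p) p else 0)" if "\<nu> \<in> ?L" for \<nu>
    proof -
      have "fprodl (map (\<lambda>p. schur_ser p (\<nu> ! p)) [0..<k]) m = (if \<forall>q\<ge>k. \<forall>i. m q i = 0 then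
          \<Prod>p<k. int (card {C \<in> straight (\<nu> ! p). \<forall>x. content (part (\<nu> ! p) 1) C x = m p x}) else 0)"
        by (rule fprodl_separated[OF _ m]) (use gf_schur that in auto)
      then show ?thesis
        unfolding kcount_def of_nat_eq_iff .
    qed
    show ?thesis
    proof (cases "\<forall>q\<ge>k. \<forall>i. m q i = 0")
      case False
      have "F m = 0"
        unfolding F[OF m] hjt_product_coeff[OF m] if_not_P[OF False] by simp
      moreover have "(\<Sum>\<nu>\<in>?L. c \<nu> * fprodl (map (\<lambda>p. schur_ser p (\<nu> ! p)) [0..<k]) m) = 0"
        by (rule sum.neutral, rule ballI) (subst schur, assumption, simp only: if_not_P[OF False] mult_zero_right)
      ultimately show ?thesis by simp
    next
      case True
      have expand: "kcount n (classes p (U p)) (\<lambda>x. int (m p x))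
        = (\<Sum>\<kappa>\<in>partitions (deg p m). int (highest_count n (classes p (U p)) \<kappa>) * ?K \<kappa> p)" for p U
      proof -
        \<comment> \<open>The expansion is applied in N variables, where N is chosen so large that
          it covers the p-th part of the monomial.\<close>
        have "finite ((\<lambda>i. (p, i)) -` {(p, i). m p i \<noteq> 0})"
          using m by (intro finite_vimageI) (auto simp: finsupp_def inj_on_def)
        then have fin: "finite {i. m p i \<noteq> 0}" by (simp add: vimage_def)
        then obtain N where N: "{i. m p i \<noteq> 0} \<subseteq> {..<N}"
          using finite_nat_set_iff_bounded by (metis lessThan_iff subsetI)
        have "deg p m = (\<Sum>x<N. m p x)"
          unfolding deg_def using N by (intro sum.mono_neutral_left) auto
        then have s: "(\<Sum>x<N. m p x) = deg p m" ..
        have z: "m p x = 0" if "N \<le> x" for x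
          using N that by (metis (mono_tags, lifting) lessThan_iff mem_Collect_eq not_le subsetD)
        have sub: "classes p (U p) \<subseteq> tuples p" by blast
        show ?thesis
          by (rule kcount_expansion[OF bk_closed_meets sub z s])
      qed
      have "F m = (\<Sum>U\<in>?U. g (J \<inter> (\<Inter>p<k. U p)) * (\<Prod>p<k. kcount n (classes p (U p)) (\<lambda>x. int (m p x))))"
        unfolding F[OF m] hjt_product_coeff[OF m] if_P[OF True] by (rule signed_product_eq)
      also have "\<dots> = (\<Sum>U\<in>?U. g (J \<inter> (\<Inter>p<k. U p)) * (\<Sum>\<kappa>\<in>PiE {..<k} (\<lambda>p. partitions (deg p m)).
          \<Prod>p<k. int (highest_count n (classes p (U p)) (\<kappa> p)) * ?K (\<kappa> p) p))"
        unfolding expand by (subst prod_sum_PiE) (auto simp: finite_partitions)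
      also have "\<dots> = (\<Sum>\<kappa>\<in>PiE {..<k} (\<lambda>p. partitions (deg p m)). \<Sum>U\<in>?U. g (J \<inter> (\<Inter>p<k. U p)) *
          (\<Prod>p<k. int (highest_count n (classes p (U p)) (\<kappa> p)) * ?K (\<kappa> p) p))"
        unfolding sum_distrib_left by (rule sum.swap)
      also have "\<dots> = (\<Sum>\<nu>\<in>?L. \<Sum>U\<in>?U. g (J \<inter> (\<Inter>p<k. U p)) *
          (\<Prod>p<k. int (highest_count n (classes p (U p)) (\<nu> ! p)) * ?K (\<nu> ! p) p))"
      proof (rule sum.reindex_bij_witness[where i = "\<lambda>\<nu>. \<lambda>p\<in>{..<k}. \<nu> ! p" and j = "\<lambda>\<kappa>. map \<kappa> [0..<k]"])
        fix \<kappa> assume \<kappa>: "\<kappa> \<in> PiE {..<k} (\<lambda>p. partitions (deg p m))"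
        show "(\<lambda>p\<in>{..<k}. map \<kappa> [0..<k] ! p) = \<kappa>"
          using \<kappa> by (intro extensionalityI[of _ "{..<k}"]) (auto simp: PiE_iff)
        show "map \<kappa> [0..<k] \<in> ?L"
          using \<kappa> by (auto simp: PiE_iff partitions_def)
        show "(\<Sum>U\<in>?U. g (J \<inter> (\<Inter>p<k. U p)) *
          (\<Prod>p<k. int (highest_count n (classes p (U p)) (map \<kappa> [0..<k] ! p)) * ?K (map \<kappa> [0..<k] ! p) p))
          = (\<Sum>U\<in>?U. g (J \<inter> (\<Inter>p<k. U p)) * (\<Prod>p<k. int (highest_count n (classes p (U p)) (\<kappa> p)) * ?K (\<kappa> p) p))"
          by (intro sum.cong refl arg_cong2[where f = "(*)"] prod.cong) auto
      next
        fix \<nu> assume \<nu>: "\<nu> \<in> ?L"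
        show "map (\<lambda>p\<in>{..<k}. \<nu> ! p) [0..<k] = \<nu>"
          using \<nu> by (intro nth_equalityI) auto
        show "(\<lambda>p\<in>{..<k}. \<nu> ! p) \<in> PiE {..<k} (\<lambda>p. partitions (deg p m))"
          using \<nu> by (auto simp: partitions_def)
      qed
      also have "\<dots> = (\<Sum>\<nu>\<in>?L. c \<nu> * (\<Prod>p<k. ?K (\<nu> ! p) p))"
        unfolding c_def sum_distrib_right prod.distrib mult.assoc ..
      also have "\<dots> = (\<Sum>\<nu>\<in>?L. c \<nu> * fprodl (map (\<lambda>p. schur_ser p (\<nu> ! p)) [0..<k]) m)"
        by (rule sum.cong[OF refl]) (subst schur, assumption, simp only: if_P[OF True])
      finally show ?thesis .
    qed
  qed
  show ?thesis
    unfolding schur_positive_def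
  proof (intro exI[of _ "\<lambda>\<nu>. real_of_int (c \<nu>)"] conjI allI impI)
    fix \<nu> show "0 \<le> real_of_int (c \<nu>)" using c by simp
  next
    fix m assume "finsupp m"
    from main[OF this] show "real_of_int (F m) = (\<Sum>\<nu>\<in>{\<nu>. length \<nu> = k \<and> (\<forall>p<k. is_part (\<nu> ! p) \<and> sum_list (\<nu> ! p) = deg p m)}.
      real_of_int (c \<nu>) * real_of_int (fprodl (map (\<lambda>p. schur_ser p (\<nu> ! p)) [0..<k]) m))"
      by (simp only: of_int_sum of_int_mult)
  qed
qed

end

lemma filter_sorted_list_of_set:
  fixes S :: "nat set"
  assumes "finite S" "T \<subseteq> S"
  shows "filter (\<lambda>i. i \<in> T) (sorted_list_of_set S) = sorted_list_of_set T"
proof (rule sorted_distinct_set_unique)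
  have "finite T" using assms finite_subset by blast
  then show "set (filter (\<lambda>i. i \<in> T) (sorted_list_of_set S)) = set (sorted_list_of_set T)"
    using assms by auto
qed (simp_all add: sorted_wrt_filter)

lemma theta_hess_perm:
  assumes "S \<subseteq> {1..<n}" "\<tau> \<in> Bn n"
  shows "theta n (hess_perm S) \<tau> = (\<Sum>T\<in>Pow S. (-1) ^ card (S - T) * tl_cup_word n (sorted_list_of_set T) \<tau>)"
proof -
  have S: "finite S" using assms(1) finite_subset by blast
  then have set: "set (sorted_list_of_set S) = S" by simp
  have "theta n (hess_perm S) \<tau> = tl_word n (sorted_list_of_set S) \<tau>"
    unfolding hess_perm_def by (rule theta_perm_of_word) (use assms set in auto)
  also have "\<dots> = (\<Sum>T\<in>Pow (set (sorted_list_of_set S)). (-1) ^ card (set (sorted_list_of_set S) - T)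
      * tl_cup_word n (filter (\<lambda>i. i \<in> T) (sorted_list_of_set S)) \<tau>)"
    by (rule tl_word_expand) (use assms set in auto)
  also have "\<dots> = (\<Sum>T\<in>Pow S. (-1) ^ card (S - T) * tl_cup_word n (sorted_list_of_set T) \<tau>)"
    unfolding set by (intro sum.cong refl) (simp add: filter_sorted_list_of_set[OF S])
  finally show ?thesis .
qed

theorem theorem1p3:
  fixes n :: nat and shapes :: "(nat list \<times> nat list) list" and \<tau> :: diag
  assumes "n \<ge> 1"
    and "length shapes \<ge> 1"
    and "\<forall>s \<in> set shapes. is_part (fst s) \<and> is_part (snd s)
           \<and> (\<forall>i. part (snd s) i \<le> part (fst s) i)
           \<and> no_3x2_block (fst s) (snd s)
           \<and> length (fst s) \<le> n"
    and "\<tau> \<in> Bn n"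
  shows "schur_positive (length shapes) (imm_tl n \<tau> (hjt shapes))"
proof -
  define k where "k = length shapes"
  define la where "la = (\<lambda>p. fst (shapes ! p))"
  define mu where "mu = (\<lambda>p. snd (shapes ! p))"
  define a where "a = (\<lambda>p i. int (part (la p) i) - int i)"
  define b where "b = (\<lambda>p i. int (part (mu p) i) - int i)"
  have k: "1 \<le> k" using assms(2) by (simp add: k_def)
  have shape: "is_part (la p)" "is_part (mu p)" "no_3x2_block (la p) (mu p)" if "p < k" for p
    using assms(3) nth_mem[of p shapes] that by (auto simp: k_def la_def mu_def)
  \<comment> \<open>The bound lambda_(j+2) <= mu_j + 1 loses one, the shift from -j to -i gains at
    least two.\<close>
  have ab: "a p i < b p j" if "p < k" "1 \<le> j" "Suc (Suc j) \<le> i" for p i j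
    using part_antimono[OF shape(1)[OF that(1)], of "Suc (Suc j)" i]
      no_block_bound[OF shape[OF that(1)] that(2)] that by (simp add: a_def b_def)
  have hjt: "hjt shapes i j = fprodl (map (\<lambda>p. e_ser p (a p i - b p j)) [0..<k])" for i j
    unfolding hjt_def a_def b_def la_def mu_def k_def by (simp add: algebra_simps)
  let ?coeff = "\<lambda>w m. fprodl (map (\<lambda>i. fprodl (map (\<lambda>p. e_ser p (a p i - b p (w i))) [0..<k])) [1..<n + 1]) m"
  \<comment> \<open>An entry below the subdiagonal has negative degree, so the shape with index 0
    already admits no tuple of columns, and one zero factor suffices.\<close>
  have vanish: "?coeff w m = 0" if m: "finsupp m" and w: "w permutes {1..n}" "w \<notin> hess_perms n" for w m
  proof -
    obtain i where i: "Suc (w i) < i" using w by (auto simp: hess_perms_def not_le)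
    then have "i \<in> {1..n}" using permutes_not_in[OF w(1), of i] by force
    then have wi: "1 \<le> w i" using permutes_in_image[OF w(1), of i] by simp
    have "columns n (\<lambda>i. a 0 i - b 0 (w i)) = {}"
    proof (rule ccontr)
      assume "columns n (\<lambda>i. a 0 i - b 0 (w i)) \<noteq> {}"
      then obtain C where "C \<in> columns n (\<lambda>i. a 0 i - b 0 (w i))" by blast
      then have "int (card (C i)) = a 0 i - b 0 (w i)"
        using \<open>i \<in> {1..n}\<close> by (simp add: columns_def)
      then show False using ab[of 0 "w i" i] k wi i by simp
    qed
    then have "(\<Prod>p<k. int (card {D \<in> columns n (\<lambda>i. a p i - b p (w i)). content n D = m p})) = 0"
      using k by (intro prod_zero) (auto intro!: bexI[of _ 0])
    then show ?thesis
      unfolding hjt_product_coeff[OF m, where d = "\<lambda>p i. a p i - b p (w i)"] by simp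
  qed
  have "imm_tl n \<tau> (hjt shapes) m = (\<Sum>S\<in>Pow {1..<n}. theta n (hess_perm S) \<tau> * ?coeff (hess_perm S) m)"
    if m: "finsupp m" for m
  proof -
    have "imm_tl n \<tau> (hjt shapes) m = (\<Sum>w\<in>{w. w permutes {1..n}}. theta n w \<tau> * ?coeff w m)"
      by (simp add: imm_tl_def hjt)
    also have "\<dots> = (\<Sum>w\<in>hess_perms n. theta n w \<tau> * ?coeff w m)"
      using vanish[OF m] by (intro sum.mono_neutral_right) (auto simp: hess_perms_def finite_permutations)
    also have "\<dots> = (\<Sum>S\<in>Pow {1..<n}. theta n (hess_perm S) \<tau> * ?coeff (hess_perm S) m)"
      by (rule sum.reindex_bij_betw[OF hess_perm_bij, symmetric])
    finally show ?thesis .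
  qed
  then have "schur_positive k (imm_tl n \<tau> (hjt shapes))"
  proof (rule schur_positive_signed_product[where a = a and b = b and f = "\<lambda>S. theta n (hess_perm S) \<tau>"
      and g = "\<lambda>T. tl_cup_word n (sorted_list_of_set T) \<tau>", rotated -1])
    show "a p j < a p i" if "p < k" "1 \<le> i" "i < j" for p i j
      using part_antimono[OF shape(1)[OF that(1) ], of i j] that by (simp add: a_def)
    show "b p (Suc i) < b p i" if "p < k" "1 \<le> i" for p i
      using part_antimono[OF shape(2)[OF that(1)], of i "Suc i"] that by (simp add: b_def)
    show "a p (Suc (Suc i)) < b p i" if "p < k" "1 \<le> i" for p i
      using ab that by simp
  qed (use theta_hess_perm[OF _ assms(4)] tl_cup_word_nonneg in auto)
  then show ?thesis by (simp add: k_def)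
qed

end
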